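(* Let $A=A_\mu dx^\mu$ be a $C^\infty$-smooth $u(N)$-valued 1-form on $\mathbb{R}^d$. Then for every $\gamma\in W^{1,2}_0([0,1],\mathbb{R}^d)$ the limit defining $\Delta^{\{h_n\},1}_LU_1^A(\gamma)$ exists and $$\Delta^{\{h_n\},1}_LU_1^{A}(\gamma)=-U_1^{A}(\gamma)\int_0^1U_t^{A}(\gamma)^{-1}\,\nabla^{\mu}F_{\mu\nu}(\gamma(t))\,U^{A}_t(\gamma)\,\dot{\gamma}^\nu(t)\,dt.$$ Consequently, $A$ satisfies the Yang–Mills equations $\nabla^\mu F_{\mu\nu}=0$ ($\nu=1,\dots,d$) on $\mathbb{R}^d$ if and only if $\Delta^{\{h_n\},1}_LU_1^{A}(\gamma)=0$ for all $\gamma\in W^{1,2}_0([0,1],\mathbb{R}^d)$.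
   Context: $W^{1,2}_0([0,1],\mathbb{R}^d)$ is the Hilbert space of absolutely continuous $\gamma:[0,1]\to\mathbb{R}^d$ with $\gamma(0)=0$ and $\dot\gamma\in L_2$, with inner product $\int_0^1(\dot\gamma_1,\dot\gamma_2)_{\mathbb{R}^d}dt$. Einstein summation over repeated Greek indices in $\{1,\dots,d\}$ is used, indices are raised with the Euclidean metric. $u(N)$ is the Lie algebra of anti-Hermitian $N\times N$ matrices. The covariant derivative of $\phi\in C^1(\mathbb{R}^d,u(N))$ is $\nabla_\mu\phi=\partial_\mu\phi+[A_\mu,\phi]$, the curvature is $F_{\mu\nu}=\partial_\mu A_\nu-\partial_\nu A_\mu+[A_\mu,A_\nu]$, and $\nabla^\mu F_{\mu\nu}=\sum_\mu\nabla_\mu F_{\mu\nu}$. The parallel transport $U^A_t(\gamma)$, $t\in[0,1]$, is the solution of $U^{A}_t(\gamma)=I_N-\int_0^t A_{\mu}(\gamma(s))U_s^{A}(\gamma)\dot{\gamma}^\mu(s)ds$, and $U^A_1$ is regarded as a $C^2$ function $W^{1,2}_0([0,1],\mathbb{R}^d)\to M_N(\mathbb{C})$. Let $h_n(t)=\sqrt2\sin(\pi nt)$, $n\ge1$, and $\{p_1,\dots,p_d\}$ the standard orthonormal basis of $\mathbb{R}^d$. For $f\in C^2(W^{1,2}_0([0,1],\mathbb{R}^d),M_N(\mathbb{C}))$, $$\Delta^{\{h_n\},1}_{L}f(\gamma)=\lim_{n\to\infty}\frac1n\sum_{k=1}^n\sum_{\mu=1}^d\langle f''(\gamma)p_\mu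 h_k,p_\mu h_k\rangle,$$ where $\langle f''(\gamma)u,v\rangle$ is the second Fréchet derivative of $f$ at $\gamma$ evaluated on $(u,v)$. *)

theory Defs
  imports "HOL-Analysis.Analysis"
begin

text \<open>Matrices M_N(C) are complex^'n^'n with N = CARD('n); R^d is real^'d.
  Paths are functions real => real^'d (only values on [0,1] matter).\<close>

type_synonym ('n) cmat = "complex^'n^'n"

definition anti_hermitian :: "('n::finite) cmat \<Rightarrow> bool" where
  "anti_hermitian M \<longleftrightarrow> (\<forall>i j. cnj (M $ j $ i) = - (M $ i $ j))"

definition commutator :: "('n::finite) cmat \<Rightarrow> 'n cmat \<Rightarrow> 'n cmat" where
  "commutator X Y = X ** Y - Y ** X"

definition partial :: "'d::finite \<Rightarrow> (real^'d \<Rightarrow> 'b::real_normed_vector) \<Rightarrow> real^'d \<Rightarrow> 'b" where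
  "partial \<mu> f x = vector_derivative (\<lambda>s. f (x + s *\<^sub>R axis \<mu> 1)) (at 0)"

fun iter_partial :: "'d::finite list \<Rightarrow> (real^'d \<Rightarrow> 'b::real_normed_vector) \<Rightarrow> real^'d \<Rightarrow> 'b" where
  "iter_partial [] f = f"
| "iter_partial (m # ms) f = partial m (iter_partial ms f)"

definition smooth :: "(real^'d::finite \<Rightarrow> 'b::real_normed_vector) \<Rightarrow> bool" where
  "smooth f \<longleftrightarrow> (\<forall>ms. continuous_on UNIV (iter_partial ms f) \<and>
     (\<forall>\<mu> x. ((\<lambda>s. iter_partial ms f (x + s *\<^sub>R axis \<mu> 1))
              has_vector_derivative iter_partial (\<mu> # ms) f x) (at 0)))"

definition curvature :: "('d::finite \<Rightarrow> real^'d \<Rightarrow> ('n::finite) cmat) \<Rightarrow> 'd \<Rightarrow> 'd \<Rightarrow> real^'d \<Rightarrow> 'n cmat" where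
  "curvature A \<mu> \<nu> x = partial \<mu> (A \<nu>) x - partial \<nu> (A \<mu>) x + commutator (A \<mu> x) (A \<nu> x)"

definition cov_deriv :: "('d::finite \<Rightarrow> real^'d \<Rightarrow> ('n::finite) cmat) \<Rightarrow> 'd \<Rightarrow> (real^'d \<Rightarrow> 'n cmat) \<Rightarrow> real^'d \<Rightarrow> 'n cmat" where
  "cov_deriv A \<mu> \<phi> x = partial \<mu> \<phi> x + commutator (A \<mu> x) (\<phi> x)"

definition ym_current :: "('d::finite \<Rightarrow> real^'d \<Rightarrow> ('n::finite) cmat) \<Rightarrow> 'd \<Rightarrow> real^'d \<Rightarrow> 'n cmat" where
  "ym_current A \<nu> x = (\<Sum>\<mu>\<in>UNIV. cov_deriv A \<mu> (curvature A \<mu> \<nu>) x)"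

definition is_L2_deriv :: "(real \<Rightarrow> real^'d::finite) \<Rightarrow> (real \<Rightarrow> real^'d) \<Rightarrow> bool" where
  "is_L2_deriv \<gamma> g \<longleftrightarrow> g \<in> borel_measurable lborel \<and>
     set_integrable lborel {0..1} (\<lambda>t. (norm (g t))\<^sup>2) \<and>
     (\<forall>t\<in>{0..1}. \<gamma> t = (LINT s:{0..t}|lborel. g s))"

definition W120 :: "(real \<Rightarrow> real^'d::finite) set" where
  "W120 = {\<gamma>. \<exists>g. is_L2_deriv \<gamma> g}"

definition path_deriv :: "(real \<Rightarrow> real^'d::finite) \<Rightarrow> real \<Rightarrow> real^'d" where
  "path_deriv \<gamma> = (SOME g. is_L2_deriv \<gamma> g)"

definition par_transport :: "('d::finite \<Rightarrow> real^'d \<Rightarrow> ('n::finite) cmat) \<Rightarrow> (real \<Rightarrow> real^'d) \<Rightarrow> real \<Rightarrow> 'n cmat" where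
  "par_transport A \<gamma> = (THE U. continuous_on {0..1} U \<and> (\<forall>t. t \<notin> {0..1} \<longrightarrow> U t = 0) \<and>
     (\<forall>t\<in>{0..1}. U t = mat 1 - (LINT s:{0..t}|lborel.
         (\<Sum>\<mu>\<in>UNIV. (path_deriv \<gamma> s $ \<mu>) *\<^sub>R (A \<mu> (\<gamma> s) ** U s)))))"

text \<open>Second derivative of f at gamma evaluated on (h,h), i.e. d^2/ds^2 f(gamma + s h) at s = 0
  (for C^2 f this is the second Frechet derivative f''(gamma)(h,h)).\<close>
definition second_deriv_dir :: "((real \<Rightarrow> real^'d::finite) \<Rightarrow> 'b::real_normed_vector) \<Rightarrow> (real \<Rightarrow> real^'d) \<Rightarrow> (real \<Rightarrow> real^'d) \<Rightarrow> 'b" where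
  "second_deriv_dir f \<gamma> h = vector_derivative
     (\<lambda>s. vector_derivative (\<lambda>r. f (\<lambda>t. \<gamma> t + r *\<^sub>R h t)) (at s)) (at 0)"

definition h_basis :: "nat \<Rightarrow> real \<Rightarrow> real" where
  "h_basis n t = sqrt 2 * sin (pi * real n * t)"

definition levy_avg :: "((real \<Rightarrow> real^'d::finite) \<Rightarrow> 'b::real_normed_vector) \<Rightarrow> (real \<Rightarrow> real^'d) \<Rightarrow> nat \<Rightarrow> 'b" where
  "levy_avg f \<gamma> n = (1 / real n) *\<^sub>R (\<Sum>k=1..n. \<Sum>\<mu>\<in>(UNIV::'d set).
      second_deriv_dir f \<gamma> (\<lambda>t. h_basis k t *\<^sub>R axis \<mu> 1))"

definition levy_laplacian :: "((real \<Rightarrow> real^'d::finite) \<Rightarrow> 'b::real_normed_vector) \<Rightarrow> (real \<Rightarrow> real^'d) \<Rightarrow> 'b" where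
  "levy_laplacian f \<gamma> = lim (levy_avg f \<gamma>)"

end

theory Submission
  imports Defs
begin

text \<open>Let $F_{\mu\nu}$ be the curvature and $U_t$ the parallel transport along $\gamma$. Differentiating along
  $\gamma + r h p_\mu$ and integrating the term containing $\dot h$ by parts gives
  $\frac{d}{dr} U_t = -U_t\Phi_t - h A_\mu U_t$ with
  $\Phi_t = \int_0^t h\,U_s^{-1} F_{\mu\nu} U_s \dot\gamma^\nu ds$, so that $\dot h$ disappears at $t = 1$. Differentiating
  once more,
  $$f''(\gamma)(h p_\mu, h p_\mu) = U_1\Bigl(2\int_0^1 \dot\Phi_t \Phi_t\,dt
    - \int_0^1 h^2\, U_t^{-1}\nabla_\mu F_{\mu\nu} U_t \dot\gamma^\nu dt\Bigr).$$
  The Cesaro means of $h_k(t) h_k(s)$ are bounded and tend to $0$ for $s \neq t$ and to $1$ for $s = t$, so by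
  dominated convergence only the second integral survives. Conversely, stopping the path at time $T$ localises
  the vanishing of the integral, which forces $\nabla^\mu F_{\mu\nu} = 0$ at every point.\<close>

section \<open>Indefinite integrals\<close>

text \<open>The tangent of a path in \<open>W120\<close> is only square integrable and only
  determined up to null sets, and \<open>path_deriv\<close> is an arbitrary choice of it.
  Derivatives in t are therefore not taken pointwise along such paths: identities in t are integral
  identities (\<open>primitive\<close>), with chain and product rules proved at that level, and the
  transport is studied for an arbitrary representative of the tangent. Since A takes values in u(N),
  U_t is unitary. Its inverse is then the conjugate transpose, which is real-linear in U_t, and both
  have norms bounded independently of the path. This bound supplies the dominating functions when
  differentiating in the variation parameter r. The second derivative is an iterated one-variable
  derivative, so the first one is computed at every r, not only at r = 0. The factor 2 arises
  because the square of \<Phi> at time 1 is the integral of \<Phi> \<Phi>' + \<Phi>' \<Phi>, while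
  differentiating the conjugating factors U inside \<Phi> contributes the commutator of \<Phi> and
  \<Phi>'.\<close>

lemma set_dominated_convergence:
  fixes f :: "real \<Rightarrow> 'a::euclidean_space"
  assumes w: "set_integrable lborel S w"
    and s: "\<And>n::nat. set_integrable lborel S (s n)"
    and f: "set_borel_measurable lborel S f"
    and lim: "AE t in lborel. t \<in> S \<longrightarrow> (\<lambda>n. s n t) \<longlonglongrightarrow> f t"
    and b: "\<And>n t. t \<in> S \<Longrightarrow> norm (s n t) \<le> w t"
  shows "set_integrable lborel S f"
    and "(\<lambda>n. LINT t:S|lborel. s n t) \<longlonglongrightarrow> (LINT t:S|lborel. f t)"
proof -
  have m: "(\<lambda>t. indicator S t *\<^sub>R f t) \<in> borel_measurable lborel"
    "\<And>n. (\<lambda>t. indicator S t *\<^sub>R s n t) \<in> borel_measurable lborel"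
    "integrable lborel (\<lambda>t. indicator S t *\<^sub>R w t)"
    using f s w by (auto simp: set_borel_measurable_def set_integrable_def borel_measurable_integrable)
  have l: "AE t in lborel. (\<lambda>n. indicator S t *\<^sub>R s n t) \<longlonglongrightarrow> indicator S t *\<^sub>R f t"
    using lim by eventually_elim (auto simp: indicator_def)
  have bb: "\<And>n. AE t in lborel. norm (indicator S t *\<^sub>R s n t) \<le> indicator S t *\<^sub>R w t"
    using b by (auto simp: indicator_def)
  show "set_integrable lborel S f"
    unfolding set_integrable_def by (rule integrable_dominated_convergence[OF m l bb])
  show "(\<lambda>n. LINT t:S|lborel. s n t) \<longlonglongrightarrow> (LINT t:S|lborel. f t)"
    unfolding set_lebesgue_integral_def by (rule integral_dominated_convergence[OF m l bb])
qed

lemma set_measurable_limit: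
  fixes f :: "real \<Rightarrow> 'a::euclidean_space"
  assumes "\<And>n::nat. set_borel_measurable lborel S (s n)"
    and "\<And>t. t \<in> S \<Longrightarrow> (\<lambda>n. s n t) \<longlonglongrightarrow> f t"
  shows "set_borel_measurable lborel S f"
  unfolding set_borel_measurable_def
proof (rule borel_measurable_LIMSEQ_metric)
  show "(\<lambda>t. indicator S t *\<^sub>R s n t) \<in> borel_measurable lborel" for n
    using assms(1)[of n] by (simp add: set_borel_measurable_def)
  show "(\<lambda>n. indicator S t *\<^sub>R s n t) \<longlonglongrightarrow> indicator S t *\<^sub>R f t" for t
    using assms(2)[of t] by (auto simp: indicator_def)
qed

lemma set_integrable_imp_measurable:
  "set_integrable M S f \<Longrightarrow> set_borel_measurable M S (f :: _ \<Rightarrow> 'a::euclidean_space)"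
  by (auto simp: set_integrable_def set_borel_measurable_def)

lemma set_integrable_bilinear:
  fixes C :: "real \<Rightarrow> 'a::euclidean_space" and f :: "real \<Rightarrow> 'b::euclidean_space"
    and B :: "'a \<Rightarrow> 'b \<Rightarrow> 'c::euclidean_space"
  assumes B: "bounded_bilinear B" and f: "set_integrable lborel S f"
    and C: "set_borel_measurable lborel S C" and b: "\<And>t. t \<in> S \<Longrightarrow> norm (C t) \<le> K"
  shows "set_integrable lborel S (\<lambda>t. B (C t) (f t))"
proof -
  interpret bounded_bilinear B by fact
  obtain L where L: "L > 0" "\<And>a b. norm (B a b) \<le> norm a * norm b * L" using pos_bounded by blast
  \<comment> \<open>If \<open>S\<close> is empty, \<open>K\<close> may be negative; the absolute
    value keeps the dominating function nonnegative.\<close>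
  have K: "norm (C t) \<le> \<bar>K\<bar>" if "t \<in> S" for t using b[OF that] by linarith
  have c: "continuous_on UNIV (\<lambda>p::'a\<times>'b. B (fst p) (snd p))"
    by (intro continuous_on continuous_intros)
  have "(\<lambda>t. B (indicator S t *\<^sub>R C t) (indicator S t *\<^sub>R f t)) \<in> borel_measurable lborel"
    using borel_measurable_continuous_Pair[OF C[unfolded set_borel_measurable_def]
      borel_measurable_integrable[OF f[unfolded set_integrable_def]] c] .
  moreover have "(\<lambda>t. B (indicator S t *\<^sub>R C t) (indicator S t *\<^sub>R f t)) = (\<lambda>t. indicator S t *\<^sub>R B (C t) (f t))"
    by (auto simp: indicator_def fun_eq_iff zero_left)
  ultimately have m: "set_borel_measurable lborel S (\<lambda>t. B (C t) (f t))"
    by (simp add: set_borel_measurable_def)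
  have i: "set_integrable lborel S (\<lambda>t. (\<bar>K\<bar> * L) * norm (f t))"
    using set_integrable_norm[OF f] by (intro set_integrable_mult_right)
  show ?thesis
  proof (rule set_integrable_bound[OF i m], rule AE_I2, rule impI)
    fix t assume "t \<in> S"
    have "norm (B (C t) (f t)) \<le> norm (C t) * norm (f t) * L" by (rule L)
    also have "\<dots> \<le> \<bar>K\<bar> * norm (f t) * L" using K[OF \<open>t \<in> S\<close>] L(1) by (intro mult_right_mono) auto
    finally show "norm (B (C t) (f t)) \<le> norm (\<bar>K\<bar> * L * norm (f t))" using L(1) by (simp add: abs_mult mult_ac)
  qed
qed

lemma continuous_imp_set_measurable:
  fixes C :: "real \<Rightarrow> 'a::euclidean_space"
  assumes "continuous_on {a..b} C"
  shows "set_borel_measurable lborel {a..b} C"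
  unfolding set_borel_measurable_def using borel_measurable_continuous_on_indicator[OF _ assms] by simp

lemma continuous_bounded_Icc:
  fixes C :: "real \<Rightarrow> 'a::euclidean_space"
  assumes "continuous_on {a..b} C"
  obtains K where "\<And>t. t \<in> {a..b} \<Longrightarrow> norm (C t) \<le> K"
proof -
  have "bounded (C ` {a..b})" using assms compact_continuous_image compact_imp_bounded by blast
  then show ?thesis using that unfolding bounded_iff by blast
qed

lemma set_integrable_bilinear_continuous:
  fixes C :: "real \<Rightarrow> 'a::euclidean_space" and f :: "real \<Rightarrow> 'b::euclidean_space"
    and B :: "'a \<Rightarrow> 'b \<Rightarrow> 'c::euclidean_space"
  assumes B: "bounded_bilinear B" and f: "set_integrable lborel {a..b} f" and C: "continuous_on {a..b} C"
  shows "set_integrable lborel {a..b} (\<lambda>t. B (C t) (f t))"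
  using continuous_bounded_Icc[OF C] set_integrable_bilinear[OF B f continuous_imp_set_measurable[OF C]]
  by metis

lemma continuous_set_integrable:
  fixes C :: "real \<Rightarrow> 'a::euclidean_space"
  assumes "continuous_on {a..b} C"
  shows "set_integrable lborel {a..b} C"
  using borel_integrable_atLeastAtMost'[OF assms] .

lemma set_integrable_bounded_linear:
  assumes "bounded_linear T" "set_integrable M S f"
  shows "set_integrable M S (\<lambda>t. T (f t))"
    and "(LINT t:S|M. T (f t)) = T (LINT t:S|M. f t)"
proof -
  interpret bounded_linear T by fact
  have e: "(\<lambda>t. indicator S t *\<^sub>R T (f t)) = (\<lambda>t. T (indicator S t *\<^sub>R f t))"
    by (rule ext, rule scaleR[symmetric])
  show "set_integrable M S (\<lambda>t. T (f t))"
    using assms(2) unfolding set_integrable_def e by (rule integrable_bounded_linear[OF assms(1)])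
  show "(LINT t:S|M. T (f t)) = T (LINT t:S|M. f t)"
    using assms(2) unfolding set_lebesgue_integral_def e set_integrable_def
    by (rule integral_bounded_linear[OF assms(1)])
qed

lemma set_integrable_sum:
  assumes "\<And>i. i \<in> I \<Longrightarrow> set_integrable M S (f i)"
  shows "set_integrable M S (\<lambda>t. \<Sum>i\<in>I. f i t)"
  using assms by (simp add: set_integrable_def scaleR_sum_right)

lemma set_integral_sum':
  assumes "\<And>i. i \<in> I \<Longrightarrow> set_integrable M S (f i)"
  shows "(LINT t:S|M. (\<Sum>i\<in>I. f i t)) = (\<Sum>i\<in>I. LINT t:S|M. f i t)"
  using assms by (simp add: set_integrable_def set_lebesgue_integral_def scaleR_sum_right Bochner_Integration.integral_sum)

lemma norm_set_integral_le:
  fixes f :: "_ \<Rightarrow> 'a::euclidean_space"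
  assumes f: "set_integrable M S f" and g: "set_integrable M S g" and le: "\<And>t. t \<in> S \<Longrightarrow> norm (f t) \<le> g t"
  shows "norm (LINT t:S|M. f t) \<le> (LINT t:S|M. g t)"
proof -
  have "norm (LINT t:S|M. f t) \<le> (LINT t:S|M. norm (f t))"
    using integral_norm_bound[of M "\<lambda>t. indicator S t *\<^sub>R f t"] by (simp add: set_lebesgue_integral_def)
  also have "\<dots> \<le> (LINT t:S|M. g t)" by (rule set_integral_mono[OF set_integrable_norm[OF f] g le])
  finally show ?thesis .
qed

lemma set_integral_split:
  fixes f :: "real \<Rightarrow> 'a::euclidean_space"
  assumes f: "set_integrable lborel {a..c} f" and "a \<le> b" "b \<le> c"
  shows "(LINT t:{a..c}|lborel. f t) = (LINT t:{a..b}|lborel. f t) + (LINT t:{b..c}|lborel. f t)"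
proof -
  have i: "set_integrable lborel {a..b} f" "set_integrable lborel {b..c} f"
    using f assms(2,3) by (auto intro: set_integrable_subset)
  have "integral {a..b} f + integral {b..c} f = integral {a..c} f"
    using assms set_borel_integral_eq_integral(1)[OF f] by (intro Henstock_Kurzweil_Integration.integral_combine)
  then show ?thesis using set_borel_integral_eq_integral(2)[OF f] i[THEN set_borel_integral_eq_integral(2)] by simp
qed

section \<open>Absolutely continuous functions: chain rule, product rule, weighted
  uniqueness\<close>

text \<open>Absolute continuity of \<open>F\<close> on [0,1] with derivative \<open>f\<close>,
  encoded by the integral identity instead of almost-everywhere differentiability. \<open>f\<close>
  is one integrable representative, and nothing is said about \<open>F\<close> outside
  [0,1].\<close>

definition primitive :: "(real \<Rightarrow> 'a::euclidean_space) \<Rightarrow> (real \<Rightarrow> 'a) \<Rightarrow> bool" where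
  "primitive F f \<longleftrightarrow> set_integrable lborel {0..1} f \<and> (\<forall>t\<in>{0..1}. (LINT s:{0..t}|lborel. f s) = F t - F 0)"

lemma primitive_integrable: "primitive F f \<Longrightarrow> 0 \<le> a \<Longrightarrow> b \<le> 1 \<Longrightarrow> set_integrable lborel {a..b} f"
  unfolding primitive_def by (auto intro: set_integrable_subset)

lemma primitive_diff_eq:
  assumes "primitive F f" "0 \<le> s" "s \<le> t" "t \<le> 1"
  shows "F t - F s = (LINT u:{s..t}|lborel. f u)"
proof -
  have "(LINT u:{0..t}|lborel. f u) = F t - F 0" "(LINT u:{0..s}|lborel. f u) = F s - F 0"
    using assms unfolding primitive_def by auto
  then show ?thesis using set_integral_split[OF primitive_integrable[OF assms(1)], of 0 t s] assms
    by (simp add: algebra_simps)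
qed

lemma primitive_integral:
  assumes "set_integrable lborel {0..1} f"
  shows "primitive (\<lambda>t. c + (LINT s:{0..t}|lborel. f s)) f"
proof -
  have "(LINT s:{0..0}|lborel. f s) = 0"
    using set_borel_integral_eq_integral(2)[OF set_integrable_subset[OF assms, of "{0..0}"]] by simp
  then show ?thesis using assms unfolding primitive_def by simp
qed

lemma primitive_integral0:
  assumes "set_integrable lborel {0..1} f"
  shows "primitive (\<lambda>t. LINT s:{0..t}|lborel. f s) f"
  using primitive_integral[OF assms, of 0] by simp

lemma primitive_cong:
  assumes "primitive F f" "\<And>t. t \<in> {0..1} \<Longrightarrow> F t = G t" "\<And>t. t \<in> {0..1} \<Longrightarrow> f t = g t"
  shows "primitive G g"
proof -
  have "set_integrable lborel {0..1} g"
    using assms(1,3) unfolding primitive_def by (subst set_integrable_cong[OF refl, where f'=f]) auto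
  moreover have "(LINT s:{0..t}|lborel. g s) = (LINT s:{0..t}|lborel. f s)" if "t \<in> {0..1}" for t
    using assms(3) that by (intro set_lebesgue_integral_cong) auto
  ultimately show ?thesis using assms unfolding primitive_def by auto
qed

lemma primitive_continuous:
  assumes "primitive F f"
  shows "continuous_on {0..1} F"
proof -
  have i: "f integrable_on {0..1}" using assms set_borel_integral_eq_integral(1) unfolding primitive_def by blast
  have "continuous_on {0..1} (\<lambda>t. F 0 + integral {0..t} f)"
    by (intro continuous_intros indefinite_integral_continuous_1 i)
  moreover have "F 0 + integral {0..t} f = F t" if "t \<in> {0..1}" for t
    using assms that set_borel_integral_eq_integral(2)[OF primitive_integrable[OF assms, of 0 t]]
    unfolding primitive_def by auto (metis add.commute atLeastAtMost_iff diff_add_cancel)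
  ultimately show ?thesis by (rule continuous_on_eq)
qed

text \<open>On a fine uniform partition of [0,t] the errors e * (increment of \<open>m\<close>)
  telescope to e * (m t - m 0), and e is arbitrary. In the applications \<open>m\<close> is the
  integral of the norm of an unbounded integrand, so increments are compared with \<open>m\<close>
  and not with the length of the interval.\<close>

lemma primitive_telescope:
  fixes H :: "real \<Rightarrow> 'a::real_normed_vector" and m :: "real \<Rightarrow> real"
  assumes H: "\<And>e. e > 0 \<Longrightarrow> \<exists>d>0. \<forall>s t. 0 \<le> s \<longrightarrow> s \<le> t \<longrightarrow> t \<le> 1 \<longrightarrow> t - s < d \<longrightarrow> norm (H t - H s) \<le> e * (m t - m s)"
    and t: "t \<in> {0..1}"
  shows "H t = H 0"
proof -
  have le: "norm (H t - H 0) \<le> e * (m t - m 0)" if e: "e > 0" for e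
  proof -
    obtain d where d: "d > 0" "\<And>s t. 0 \<le> s \<Longrightarrow> s \<le> t \<Longrightarrow> t \<le> 1 \<Longrightarrow> t - s < d \<Longrightarrow> norm (H t - H s) \<le> e * (m t - m s)"
      using H[OF e] by meson
    obtain n :: nat where n: "n > 0" "1 / n < d" using d(1) by (metis nat_approx_posE of_nat_0_less_iff zero_less_Suc)
    define p where "p i = t * (real i / n)" for i
    have step: "norm (H (p (Suc i)) - H (p i)) \<le> e * (m (p (Suc i)) - m (p i))" if "i < n" for i
    proof (rule d(2))
      show "0 \<le> p i" using t n by (simp add: p_def)
      show "p i \<le> p (Suc i)" using t n by (auto simp: p_def intro!: mult_left_mono divide_right_mono)
      have "p (Suc i) \<le> 1 * 1" unfolding p_def using t n that by (intro mult_mono) (auto simp: divide_simps)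
      then show "p (Suc i) \<le> 1" by simp
      have "p (Suc i) - p i = t * (1/n)" by (simp add: p_def algebra_simps add_divide_distrib)
      also have "\<dots> \<le> 1 * (1/n)" using t n by (intro mult_right_mono) auto
      finally show "p (Suc i) - p i < d" using n by simp
    qed
    have "H t - H 0 = (\<Sum>i<n. H (p (Suc i)) - H (p i))"
      using n by (subst sum_lessThan_telescope) (simp add: p_def)
    also have "norm \<dots> \<le> (\<Sum>i<n. e * (m (p (Suc i)) - m (p i)))"
      by (rule sum_norm_le) (use step in auto)
    also have "\<dots> = e * (\<Sum>i<n. m (p (Suc i)) - m (p i))" by (simp only: sum_distrib_left)
    also have "(\<Sum>i<n. m (p (Suc i)) - m (p i)) = m t - m 0"
      using n by (subst sum_lessThan_telescope[of "\<lambda>i. m (p i)"]) (simp add: p_def)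
    finally show ?thesis .
  qed
  have "norm (H t - H 0) \<le> 0"
  proof (rule field_le_epsilon)
    fix e :: real assume "e > 0"
    \<comment> \<open>The summand 1 makes \<open>K\<close> positive even when the two values of
      \<open>m\<close> agree.\<close>
    define K where "K = \<bar>m t - m 0\<bar> + 1"
    have K: "K > 0" by (simp add: K_def)
    have "norm (H t - H 0) \<le> e / K * (m t - m 0)" using le[of "e/K"] \<open>e > 0\<close> K by simp
    also have "\<dots> \<le> e / K * K" using \<open>e > 0\<close> K by (intro mult_left_mono) (auto simp: K_def)
    finally show "norm (H t - H 0) \<le> 0 + e" using K by simp
  qed
  then show ?thesis by simp
qed

text \<open>On a short interval [s,t] the linearisation error of \<open>\<phi>\<close> at
  \<open>F s\<close> is at most e/2 times the increment of \<open>F\<close>, and freezing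
  \<open>\<phi>'\<close> at \<open>F s\<close> under the integral costs another e/2 times the
  integral of the norm of \<open>f\<close>. Hence \<phi> (F t) minus the integral satisfies the
  hypothesis of \<open>primitive_telescope\<close>.\<close>

lemma primitive_chain:
  fixes \<phi> :: "'a::euclidean_space \<Rightarrow> 'b::euclidean_space" and \<phi>' :: "'a \<Rightarrow> 'a \<Rightarrow>\<^sub>L 'b"
  assumes F: "primitive F f"
    and D: "\<And>x. (\<phi> has_derivative \<phi>' x) (at x)" and cont: "continuous_on UNIV \<phi>'"
  shows "primitive (\<lambda>t. \<phi> (F t)) (\<lambda>t. \<phi>' (F t) (f t))"
proof -
  have cF: "continuous_on {0..1} F" by (rule primitive_continuous[OF F])
  have fi: "set_integrable lborel {a..b} f" if "0 \<le> a" "b \<le> 1" for a b using primitive_integrable[OF F that] .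
  have cF': "continuous_on {0..1} (\<lambda>t. \<phi>' (F t))" by (rule continuous_on_compose2[OF cont cF]) auto
  have bd: "bounded ((\<lambda>t. \<phi>' (F t)) ` {0..1})"
    using cF' compact_continuous_image compact_imp_bounded by blast
  then obtain L where L: "\<And>t. t \<in> {0..1} \<Longrightarrow> norm (\<phi>' (F t)) \<le> L" unfolding bounded_iff by blast
  have m: "set_borel_measurable lborel {0..1} (\<lambda>t. \<phi>' (F t) (f t))"
  proof -
    \<comment> \<open>Expanding \<open>f t\<close> in the basis leaves finitely many products of an
      integrable scalar with a continuous vector, whose measurability is known.\<close>
    have e: "(\<lambda>t. indicator {0..1} t *\<^sub>R \<phi>' (F t) (f t)) = (\<lambda>t. \<Sum>b\<in>Basis. indicator {0..1} t *\<^sub>R ((f t \<bullet> b) *\<^sub>R \<phi>' (F t) b))"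
      apply (rule ext)
      subgoal for t
        apply (subst (1) euclidean_representation[of "f t", symmetric])
        apply (simp add: blinfun.sum_right blinfun.scaleR_right scaleR_sum_right)
        done
      done
    have "set_integrable lborel {0..1} (\<lambda>t. (f t \<bullet> b) *\<^sub>R \<phi>' (F t) b)" for b
    proof (rule set_integrable_bilinear_continuous[OF bounded_bilinear.flip[OF bounded_bilinear_scaleR]])
      show "set_integrable lborel {0..1} (\<lambda>t. f t \<bullet> b)"
        by (rule set_integrable_bounded_linear[OF bounded_linear_inner_left fi]) auto
      show "continuous_on {0..1} (\<lambda>t. \<phi>' (F t) b)" by (intro continuous_intros cF')
    qed
    then show ?thesis unfolding set_borel_measurable_def e
      by (intro borel_measurable_sum) (auto simp: set_integrable_def borel_measurable_integrable)
  qed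
  have int: "set_integrable lborel {0..1} (\<lambda>t. \<phi>' (F t) (f t))"
  proof (rule set_integrable_bound[OF _ m])
    show "set_integrable lborel {0..1} (\<lambda>t. L * norm (f t))"
      using set_integrable_norm[OF fi[of 0 1]] by auto
    show "AE t in lborel. t \<in> {0..1} \<longrightarrow> norm (\<phi>' (F t) (f t)) \<le> norm (L * norm (f t))"
    proof (rule AE_I2, rule impI)
      fix t::real assume t: "t \<in> {0..1}"
      have "norm (\<phi>' (F t) (f t)) \<le> norm (\<phi>' (F t)) * norm (f t)" by (rule norm_blinfun)
      also have "\<dots> \<le> L * norm (f t)" using L[OF t] by (intro mult_right_mono) auto
      finally show "norm (\<phi>' (F t) (f t)) \<le> norm (L * norm (f t))" by simp
    qed
  qed
  have inti: "set_integrable lborel {a..b} (\<lambda>t. \<phi>' (F t) (f t))" if "0 \<le> a" "b \<le> 1" for a b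
    by (rule set_integrable_subset[OF int]) (use that in auto)
  obtain R where R: "\<And>t. t \<in> {0..1} \<Longrightarrow> norm (F t) \<le> R" using continuous_bounded_Icc[OF cF] by blast
  define H where "H t = \<phi> (F t) - (LINT s:{0..t}|lborel. \<phi>' (F s) (f s))" for t
  define n where "n t = (LINT s:{0..t}|lborel. norm (f s))" for t
  have HH0: "H t = H 0" if "t \<in> {0..1}" for t
  proof (rule primitive_telescope[OF _ that, where m=n])
    fix e :: real assume "e > 0"
    have uc: "uniformly_continuous_on (cball 0 R) \<phi>'"
      by (rule compact_uniformly_continuous[OF continuous_on_subset[OF cont]]) auto
    obtain d0 where d0: "d0 > 0" "\<And>x y. x \<in> cball 0 R \<Longrightarrow> y \<in> cball 0 R \<Longrightarrow> dist x y < d0 \<Longrightarrow> dist (\<phi>' x) (\<phi>' y) < e/2"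
      using uc[unfolded uniformly_continuous_on_def] \<open>e > 0\<close> by (metis half_gt_zero)
    have "uniformly_continuous_on {0..1} F" by (rule compact_uniformly_continuous[OF cF]) auto
    then obtain d where d: "d > 0" "\<And>s t. s \<in> {0..1} \<Longrightarrow> t \<in> {0..1} \<Longrightarrow> dist s t < d \<Longrightarrow> dist (F s) (F t) < d0"
      unfolding uniformly_continuous_on_def using d0(1) by metis
    show "\<exists>d>0. \<forall>s t. 0 \<le> s \<longrightarrow> s \<le> t \<longrightarrow> t \<le> 1 \<longrightarrow> t - s < d \<longrightarrow> norm (H t - H s) \<le> e * (n t - n s)"
    proof (intro exI conjI allI impI)
      show "d > 0" by fact
      fix s t :: real assume st: "0 \<le> s" "s \<le> t" "t \<le> 1" "t - s < d"
      have FF: "F t - F s = (LINT u:{s..t}|lborel. f u)" by (rule primitive_diff_eq[OF F st(1-3)])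
      have nn: "n t - n s = (LINT u:{s..t}|lborel. norm (f u))"
        unfolding n_def by (rule primitive_diff_eq[OF primitive_integral0[OF set_integrable_norm[OF fi]] st(1-3)]) auto
      have n1: "norm (F t - F s) \<le> n t - n s"
        unfolding FF nn using st by (intro norm_set_integral_le set_integrable_norm fi) auto
      have close: "dist (F s) (F u) < d0" if "u \<in> {s..t}" for u
        by (rule d(2)) (use st that in \<open>auto simp: dist_real_def\<close>)
      have Rin: "F u \<in> cball 0 R" if "u \<in> {s..t}" for u using R[of u] st that by auto
      have a: "norm (\<phi> (F t) - \<phi> (F s) - \<phi>' (F s) (F t - F s)) \<le> norm (F t - F s) * (e/2)"
      \<comment> \<open>The set is convex, so it contains the segment from \<open>F s\<close> to
        \<open>F t\<close>. The first ball is the compact set on which \<open>\<phi>'\<close> is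
        uniformly continuous; the second keeps \<open>\<phi>'\<close> within e/2 of its value at
        \<open>F s\<close>.\<close>
      proof (rule differentiable_bound_linearization[where S="cball 0 R \<inter> ball (F s) d0" and f'="\<lambda>x. blinfun_apply (\<phi>' x)"])
        fix \<tau> :: real assume \<tau>: "\<tau> \<in> {0..1}"
        have cv: "convex (cball 0 R \<inter> ball (F s) d0)" by (intro convex_Int convex_cball convex_ball)
        have "(1-\<tau>) *\<^sub>R F s + \<tau> *\<^sub>R F t \<in> cball 0 R \<inter> ball (F s) d0"
          by (rule convexD[OF cv]) (use \<tau> Rin[of s] Rin[of t] st close[of t] d0(1) in auto)
        then show "F s + \<tau> *\<^sub>R (F t - F s) \<in> cball 0 R \<inter> ball (F s) d0" by (simp add: algebra_simps)
      next
        fix x assume "x \<in> cball 0 R \<inter> ball (F s) d0"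
        then have "dist (\<phi>' x) (\<phi>' (F s)) < e/2" using Rin[of s] st by (intro d0(2)) (auto simp: dist_commute)
        then have "norm (\<phi>' x - \<phi>' (F s)) \<le> e/2" by (simp add: dist_norm)
        then show "onorm (blinfun_apply (\<phi>' x) - blinfun_apply (\<phi>' (F s))) \<le> e/2"
          by (simp add: norm_blinfun.rep_eq minus_blinfun.rep_eq fun_diff_def)
      qed (use Rin[of s] st d0(1) in \<open>auto intro!: has_derivative_at_withinI[OF D]\<close>)
      have b: "\<phi>' (F s) (F t - F s) = (LINT u:{s..t}|lborel. \<phi>' (F s) (f u))"
        unfolding FF by (rule set_integrable_bounded_linear(2)[symmetric, OF blinfun.bounded_linear_right fi]) (use st in auto)
      have HH: "H t - H s = (\<phi> (F t) - \<phi> (F s) - \<phi>' (F s) (F t - F s)) + (LINT u:{s..t}|lborel. \<phi>' (F s) (f u) - \<phi>' (F u) (f u))"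
      proof -
        have "(LINT s:{0..t}|lborel. \<phi>' (F s) (f s)) - (LINT s:{0..s}|lborel. \<phi>' (F s) (f s)) = (LINT u:{s..t}|lborel. \<phi>' (F u) (f u))"
          by (rule primitive_diff_eq[OF primitive_integral0[OF int] st(1-3)])
        moreover have "(LINT u:{s..t}|lborel. \<phi>' (F s) (f u) - \<phi>' (F u) (f u)) = (LINT u:{s..t}|lborel. \<phi>' (F s) (f u)) - (LINT u:{s..t}|lborel. \<phi>' (F u) (f u))"
          using st by (intro set_integral_diff inti set_integrable_bounded_linear(1)[OF blinfun.bounded_linear_right] fi) auto
        ultimately show ?thesis unfolding H_def b by (simp add: algebra_simps)
      qed
      have c: "norm (LINT u:{s..t}|lborel. \<phi>' (F s) (f u) - \<phi>' (F u) (f u)) \<le> (LINT u:{s..t}|lborel. (e/2) * norm (f u))"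
      proof (rule norm_set_integral_le)
        show "set_integrable lborel {s..t} (\<lambda>u. \<phi>' (F s) (f u) - \<phi>' (F u) (f u))"
          using st by (intro set_integral_diff(1) inti set_integrable_bounded_linear(1)[OF blinfun.bounded_linear_right] fi) auto
        show "set_integrable lborel {s..t} (\<lambda>u. (e/2) * norm (f u))"
          using set_integrable_norm[OF fi[of s t]] st by auto
        fix u assume u: "u \<in> {s..t}"
        have "norm (\<phi>' (F s) (f u) - \<phi>' (F u) (f u)) = norm ((\<phi>' (F s) - \<phi>' (F u)) (f u))" by (simp add: blinfun.diff_left)
        also have "\<dots> \<le> norm (\<phi>' (F s) - \<phi>' (F u)) * norm (f u)" by (rule norm_blinfun)
        also have "\<dots> \<le> (e/2) * norm (f u)"
          using d0(2)[OF Rin[of s] Rin[OF u] close[OF u]] st by (intro mult_right_mono) (auto simp: dist_norm)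
        finally show "norm (\<phi>' (F s) (f u) - \<phi>' (F u) (f u)) \<le> (e/2) * norm (f u)" .
      qed
      have "norm (H t - H s) \<le> norm (F t - F s) * (e/2) + (e/2) * (n t - n s)"
        unfolding HH by (rule order_trans[OF norm_triangle_ineq]) (use a c nn in auto)
      also have "\<dots> \<le> (n t - n s) * (e/2) + (e/2) * (n t - n s)"
        using n1 \<open>e > 0\<close> by (intro add_right_mono mult_right_mono) auto
      finally show "norm (H t - H s) \<le> e * (n t - n s)" by (simp add: field_simps)
    qed
  qed
  have "H 0 = \<phi> (F 0)"
    using set_borel_integral_eq_integral(2)[OF inti[of 0 0]] by (simp add: H_def)
  then have "(LINT s:{0..t}|lborel. \<phi>' (F s) (f s)) = \<phi> (F t) - \<phi> (F 0)" if "t \<in> {0..1}" for t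
    using HH0[OF that] by (simp add: H_def algebra_simps)
  then show ?thesis unfolding primitive_def using int by auto
qed

lemma primitive_linear:
  assumes "bounded_linear T" "primitive F f"
  shows "primitive (\<lambda>t. T (F t)) (\<lambda>t. T (f t))"
proof -
  interpret bounded_linear T by fact
  show ?thesis unfolding primitive_def
    using assms(2) set_integrable_bounded_linear[OF assms(1) primitive_integrable[OF assms(2)]]
    by (auto simp: primitive_def diff)
qed

lemma primitive_add:
  assumes "primitive F f" "primitive G g"
  shows "primitive (\<lambda>t. F t + G t) (\<lambda>t. f t + g t)"
proof -
  have "(LINT s:{0..t}|lborel. f s + g s) = (LINT s:{0..t}|lborel. f s) + (LINT s:{0..t}|lborel. g s)" if "t \<in> {0..1}" for t
    using that by (intro set_integral_add primitive_integrable[OF assms(1)] primitive_integrable[OF assms(2)]) auto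
  then show ?thesis using assms unfolding primitive_def by (auto intro: set_integral_add(1)) 
qed

lemma primitive_Pair:
  assumes "primitive F f" "primitive G g"
  shows "primitive (\<lambda>t. (F t, G t)) (\<lambda>t. (f t, g t))"
proof -
  have "primitive (\<lambda>t. (F t, 0)) (\<lambda>t. (f t, 0))"
    by (rule primitive_linear[OF _ assms(1)]) (intro bounded_linear_Pair bounded_linear_ident bounded_linear_zero)
  moreover have "primitive (\<lambda>t. (0, G t)) (\<lambda>t. (0, g t))"
    by (rule primitive_linear[OF _ assms(2)]) (intro bounded_linear_Pair bounded_linear_ident bounded_linear_zero)
  ultimately show ?thesis using primitive_add by fastforce
qed

text \<open>The chain rule for \<open>B\<close>, viewed as a function on the product space, along
  the pair (F, G); this is what replaces integration by parts.\<close>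

lemma primitive_bilinear:
  fixes B :: "'a::euclidean_space \<Rightarrow> 'b::euclidean_space \<Rightarrow> 'c::euclidean_space"
  assumes B: "bounded_bilinear B" and "primitive F f" "primitive G g"
  shows "primitive (\<lambda>t. B (F t) (G t)) (\<lambda>t. B (F t) (g t) + B (f t) (G t))"
proof -
  interpret bounded_bilinear B by fact
  define D where "D p = Blinfun (\<lambda>q. B (fst p) (snd q) + B (fst q) (snd p))" for p :: "'a \<times> 'b"
  have bl: "bounded_linear (\<lambda>q. B (fst p) (snd q) + B (fst q) (snd p))" for p
    by (intro bounded_linear_add bounded_linear_compose[OF bounded_linear_right bounded_linear_snd]
      bounded_linear_compose[OF bounded_linear_left bounded_linear_fst])
  have D: "D p q = B (fst p) (snd q) + B (fst q) (snd p)" for p q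
    unfolding D_def by (simp add: bounded_linear_Blinfun_apply[OF bl])
  have "primitive (\<lambda>t. (\<lambda>p. B (fst p) (snd p)) (F t, G t)) (\<lambda>t. D (F t, G t) (f t, g t))"
  proof (rule primitive_chain[OF primitive_Pair[OF assms(2,3)]])
    show "((\<lambda>p. B (fst p) (snd p)) has_derivative D x) (at x)" for x
      unfolding D[abs_def] by (rule FDERIV) (auto intro!: derivative_eq_intros)
    show "continuous_on UNIV D"
      by (rule continuous_on_blinfun_componentwise) (auto simp: D intro!: continuous_on continuous_intros)
  qed
  then show ?thesis by (simp add: D)
qed

lemma primitive_zero_imp_const:
  fixes F :: "real \<Rightarrow> 'a::euclidean_space"
  assumes "primitive F (\<lambda>t. 0)" "t \<in> {0..1}"
  shows "F t = F 0"
proof -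
  have "(LINT s:{0..t}|lborel. (0::'a)) = F t - F 0" using assms unfolding primitive_def by blast
  then show ?thesis by simp
qed

lemma primitive_of_deriv:
  fixes F :: "real \<Rightarrow> 'a::euclidean_space"
  assumes "\<And>t. (F has_vector_derivative F' t) (at t)" "continuous_on UNIV F'"
  shows "primitive F F'"
proof -
  have i: "set_integrable lborel {0..t} F'" for t
    by (rule continuous_set_integrable[OF continuous_on_subset[OF assms(2)]]) auto
  have "(LINT s:{0..t}|lborel. F' s) = F t - F 0" if "t \<ge> 0" for t
  proof -
    have "(F' has_integral F t - F 0) {0..t}"
      using that assms(1) by (intro fundamental_theorem_of_calculus) (auto intro: has_vector_derivative_at_within)
    then show ?thesis using set_borel_integral_eq_integral(2)[OF i[of t]] by (simp add: integral_unique)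
  qed
  then show ?thesis unfolding primitive_def using i by auto
qed

text \<open>Replaces an almost-everywhere uniqueness statement for the derivative of an absolutely
  continuous path: against a continuous weight, only the path itself matters.\<close>
lemma primitive_unique_weighted:
  fixes C :: "real \<Rightarrow> 'a::euclidean_space" and f g :: "real \<Rightarrow> 'b::euclidean_space"
    and B :: "'a \<Rightarrow> 'b \<Rightarrow> 'c::euclidean_space"
  assumes B: "bounded_bilinear B" and f: "primitive F f" and g: "primitive F g"
    and C: "continuous_on {0..1} C" and t: "t \<in> {0..1}"
  shows "(LINT s:{0..t}|lborel. B (C s) (f s)) = (LINT s:{0..t}|lborel. B (C s) (g s))"
proof -
  interpret bounded_bilinear B by fact
  obtain L where L: "L > 0" "\<And>a b. norm (B a b) \<le> norm a * norm b * L" using pos_bounded by blast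
  define h where "h t = f t - g t" for t
  have hi: "set_integrable lborel {a..b} h" if "0 \<le> a" "b \<le> 1" for a b
    unfolding h_def using primitive_integrable[OF f that] primitive_integrable[OF g that] by (rule set_integral_diff)
  have h0: "(LINT u:{s..t}|lborel. h u) = 0" if "0 \<le> s" "s \<le> t" "t \<le> 1" for s t
    unfolding h_def using primitive_diff_eq[OF f that] primitive_diff_eq[OF g that]
      set_integral_diff(2)[OF primitive_integrable[OF f, of s t] primitive_integrable[OF g, of s t]] that by auto
  have int: "set_integrable lborel {a..b} (\<lambda>s. B (C s) (k s))" if "0 \<le> a" "b \<le> 1" "set_integrable lborel {0..1} k" for a b k
    by (rule set_integrable_subset[OF set_integrable_bilinear_continuous[OF B that(3) C]]) (use that in auto)
  define H where "H t = (LINT s:{0..t}|lborel. B (C s) (h s))" for t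
  define n where "n t = (LINT s:{0..t}|lborel. norm (h s))" for t
  have "H t = H 0"
  proof (rule primitive_telescope[OF _ t, where m=n])
    fix e :: real assume "e > 0"
    have "uniformly_continuous_on {0..1} C" by (rule compact_uniformly_continuous[OF C]) auto
    moreover have "e / L > 0" using \<open>e > 0\<close> L by simp
    ultimately obtain d where d: "d > 0" "\<And>s t. s \<in> {0..1} \<Longrightarrow> t \<in> {0..1} \<Longrightarrow> dist s t < d \<Longrightarrow> dist (C s) (C t) < e / L"
      unfolding uniformly_continuous_on_def by metis
    show "\<exists>d>0. \<forall>s t. 0 \<le> s \<longrightarrow> s \<le> t \<longrightarrow> t \<le> 1 \<longrightarrow> t - s < d \<longrightarrow> norm (H t - H s) \<le> e * (n t - n s)"
    proof (intro exI conjI allI impI)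
      show "d > 0" by fact
      fix s t :: real assume st: "0 \<le> s" "s \<le> t" "t \<le> 1" "t - s < d"
      have "H t - H s = (LINT u:{s..t}|lborel. B (C u) (h u))"
        unfolding H_def by (rule primitive_diff_eq[OF primitive_integral0[OF int] st(1-3)]) (use hi in auto)
      \<comment> \<open>The subtracted integral is zero: with \<open>C\<close> frozen at s it equals
        B (C s) applied to the integral of \<open>h\<close>, which vanishes because \<open>f\<close>
        and \<open>g\<close> have the same primitive. Only the oscillation of \<open>C\<close> on
        [s,t] remains.\<close>
      also have "\<dots> = (LINT u:{s..t}|lborel. B (C u) (h u)) - (LINT u:{s..t}|lborel. B (C s) (h u))"
        using set_integrable_bounded_linear(2)[OF bounded_linear_right hi, of s t "C s"] h0[OF st(1-3)] st by (simp add: zero_right)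
      also have "\<dots> = (LINT u:{s..t}|lborel. B (C u) (h u) - B (C s) (h u))"
        using st by (intro set_integral_diff(2)[symmetric] int hi set_integrable_bounded_linear(1)[OF bounded_linear_right]) auto
      finally have HH: "H t - H s = \<dots>" .
      have nn: "n t - n s = (LINT u:{s..t}|lborel. norm (h u))"
        unfolding n_def by (rule primitive_diff_eq[OF primitive_integral0[OF set_integrable_norm[OF hi]] st(1-3)]) auto
      have "norm (H t - H s) \<le> (LINT u:{s..t}|lborel. e * norm (h u))"
        unfolding HH
      proof (rule norm_set_integral_le)
        show "set_integrable lborel {s..t} (\<lambda>u. B (C u) (h u) - B (C s) (h u))"
          using st by (intro set_integral_diff(1) int hi set_integrable_bounded_linear(1)[OF bounded_linear_right]) auto
        show "set_integrable lborel {s..t} (\<lambda>u. e * norm (h u))"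
          using set_integrable_norm[OF hi[of s t]] st by auto
        fix u assume u: "u \<in> {s..t}"
        have "dist (C u) (C s) < e / L" by (rule d(2)) (use u st in \<open>auto simp: dist_real_def\<close>)
        then have "norm (C u - C s) * L \<le> e" using L(1) by (simp add: dist_norm pos_less_divide_eq)
        then have "norm (C u - C s) * L * norm (h u) \<le> e * norm (h u)" by (intro mult_right_mono) auto
        then show "norm (B (C u) (h u) - B (C s) (h u)) \<le> e * norm (h u)"
          using L(2)[of "C u - C s" "h u"] by (simp add: diff_left mult_ac)
      qed
      then show "norm (H t - H s) \<le> e * (n t - n s)" using nn by simp
    qed
  qed
  also have "H 0 = 0" unfolding H_def using set_borel_integral_eq_integral(2)[OF int[of 0 0 h]] hi by simp
  finally have "(LINT s:{0..t}|lborel. B (C s) (f s) - B (C s) (g s)) = 0" by (simp add: H_def h_def diff_right)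
  moreover have "(LINT s:{0..t}|lborel. B (C s) (f s) - B (C s) (g s)) = (LINT s:{0..t}|lborel. B (C s) (f s)) - (LINT s:{0..t}|lborel. B (C s) (g s))"
    using t f g by (intro set_integral_diff int) (auto simp: primitive_def)
  ultimately show ?thesis by simp
qed

section \<open>Limits and derivatives under the integral sign\<close>

lemma has_vector_derivative_iff_quotient:
  fixes f :: "real \<Rightarrow> 'a::real_normed_vector"
  shows "(f has_vector_derivative D) (at x) \<longleftrightarrow> ((\<lambda>h. (f (x + h) - f x) /\<^sub>R h) \<longlongrightarrow> D) (at 0)"
proof -
  have "bounded_linear (\<lambda>h::real. h *\<^sub>R D)" by (rule bounded_linear_scaleR_left)
  then have "(f has_vector_derivative D) (at x) \<longleftrightarrow> ((\<lambda>h. norm (f (x + h) - f x - h *\<^sub>R D) / norm h) \<longlongrightarrow> 0) (at 0)"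
    by (simp add: has_vector_derivative_def has_derivative_at)
  also have "\<dots> \<longleftrightarrow> ((\<lambda>h. norm ((f (x + h) - f x) /\<^sub>R h - D)) \<longlongrightarrow> 0) (at 0)"
  proof (rule filterlim_cong[OF refl refl])
    show "\<forall>\<^sub>F h in at 0. norm (f (x + h) - f x - h *\<^sub>R D) / norm h = norm ((f (x + h) - f x) /\<^sub>R h - D)"
    proof (rule eventually_at_filter[THEN iffD2], rule always_eventually, intro allI impI)
      fix h :: real assume "h \<noteq> 0"
      then have "(f (x + h) - f x) /\<^sub>R h - D = (f (x + h) - f x - h *\<^sub>R D) /\<^sub>R h"
        by (simp add: scaleR_diff_right)
      then show "norm (f (x + h) - f x - h *\<^sub>R D) / norm h = norm ((f (x + h) - f x) /\<^sub>R h - D)"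
        by (simp add: divide_inverse mult.commute)
    qed
  qed
  also have "\<dots> \<longleftrightarrow> ((\<lambda>h. (f (x + h) - f x) /\<^sub>R h) \<longlongrightarrow> D) (at 0)"
    by (simp only: tendsto_norm_zero_iff LIM_zero_iff)
  finally show ?thesis .
qed

lemma tendsto_set_integral_dominated:
  fixes f :: "real \<Rightarrow> real \<Rightarrow> 'a::euclidean_space"
  assumes w: "set_integrable lborel S w"
    and i: "\<And>h. set_integrable lborel S (f h)"
    and b: "\<And>t h. t \<in> S \<Longrightarrow> \<bar>h\<bar> < 1 \<Longrightarrow> h \<noteq> 0 \<Longrightarrow> norm (f h t) \<le> w t"
    and l: "\<And>t. t \<in> S \<Longrightarrow> ((\<lambda>h. f h t) \<longlongrightarrow> g t) (at 0)"
  shows "set_integrable lborel S g"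
    and "((\<lambda>h. LINT t:S|lborel. f h t) \<longlongrightarrow> (LINT t:S|lborel. g t)) (at 0)"
proof -
  have lim: "set_integrable lborel S g \<and> (\<lambda>n. LINT t:S|lborel. f (a n) t) \<longlonglongrightarrow> (LINT t:S|lborel. g t)"
    if a: "\<And>n. a n \<noteq> 0" "a \<longlonglongrightarrow> 0" "\<And>n. \<bar>a n\<bar> < 1" for a
  proof -
    have l: "(\<lambda>n. f (a n) t) \<longlonglongrightarrow> g t" if "t \<in> S" for t
      using filterlim_compose[OF l[OF that], of a sequentially] a by (simp add: filterlim_at)
    have m: "set_borel_measurable lborel S g"
      by (rule set_measurable_limit[OF set_integrable_imp_measurable[OF i] l])
    show ?thesis
      using set_dominated_convergence[OF w, of "\<lambda>n. f (a n)"] i m l a b by auto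
  qed
  \<comment> \<open>Any admissible sequence would do; the shift by 2 keeps all its terms strictly
    below 1.\<close>
  show "set_integrable lborel S g"
    using lim[of "\<lambda>n. 1 / (real n + 2)"] LIMSEQ_ignore_initial_segment[OF lim_1_over_n, of 2] by (auto simp: divide_simps add_ac)
  show "((\<lambda>h. LINT t:S|lborel. f h t) \<longlongrightarrow> (LINT t:S|lborel. g t)) (at 0)"
  proof (rule LIMSEQ_SEQ_conv[THEN iffD1], intro allI impI, elim conjE)
    fix a :: "nat \<Rightarrow> real" assume a: "\<forall>n. a n \<noteq> 0" "a \<longlonglongrightarrow> 0"
    then have "\<forall>\<^sub>F n in sequentially. dist (a n) 0 < 1" by (intro tendstoD) auto
    then obtain N where "\<And>n. n \<ge> N \<Longrightarrow> \<bar>a n\<bar> < 1" unfolding eventually_sequentially by auto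
    then have "(\<lambda>n. LINT t:S|lborel. f (a (n + N)) t) \<longlonglongrightarrow> (LINT t:S|lborel. g t)"
      using lim[of "\<lambda>n. a (n + N)"] a LIMSEQ_ignore_initial_segment[OF a(2), of N] by auto
    then show "(\<lambda>n. LINT t:S|lborel. f (a n) t) \<longlonglongrightarrow> (LINT t:S|lborel. g t)" by (rule LIMSEQ_offset)
  qed
qed

text \<open>The mean value inequality on the ball of radius 1 around \<open>r0\<close>. It converts
  a bound for the derivative in the parameter into one for the difference quotients.\<close>

lemma vector_derivative_lipschitz:
  fixes f :: "real \<Rightarrow> 'a::real_normed_vector"
  assumes D: "\<And>r. (f has_vector_derivative f' r) (at r)"
    and b: "\<And>r. \<bar>r - r0\<bar> < 1 \<Longrightarrow> norm (f' r) \<le> w" and r: "\<bar>r - r0\<bar> < 1"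
  shows "norm (f r - f r0) \<le> w * \<bar>r - r0\<bar>"
proof -
  have "norm (f r - f r0) \<le> w * norm (r - r0)"
  proof (rule differentiable_bound[where S="ball r0 1" and f'="\<lambda>r h. h *\<^sub>R f' r"])
    fix x assume x: "x \<in> ball r0 1"
    show "(f has_derivative (\<lambda>h. h *\<^sub>R f' x)) (at x within ball r0 1)"
      using D[of x] by (simp add: has_vector_derivative_def has_derivative_at_withinI)
    have "onorm (\<lambda>h. h *\<^sub>R f' x) = onorm (\<lambda>h::real. h) * norm (f' x)"
      by (rule onorm_scaleR_left) (rule bounded_linear_ident)
    also have "onorm (\<lambda>h::real. h) = 1" by (rule onorm_id)
    finally show "onorm (\<lambda>h. h *\<^sub>R f' x) \<le> w"
      using b[of x] x by (simp add: dist_real_def abs_minus_commute)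
  qed (use r in \<open>auto simp: dist_real_def abs_minus_commute\<close>)
  then show ?thesis by simp
qed

text \<open>The difference quotients at \<open>r0\<close> are dominated by \<open>w\<close> through
  the mean value inequality. A bound for parameters within distance 1 of \<open>r0\<close> suffices,
  so \<open>w\<close> may depend on \<open>r0\<close>.\<close>

lemma has_vector_derivative_set_integral:
  fixes f :: "real \<Rightarrow> real \<Rightarrow> 'a::euclidean_space"
  assumes i: "\<And>r. set_integrable lborel S (f r)"
    and D: "\<And>r t. t \<in> S \<Longrightarrow> ((\<lambda>r. f r t) has_vector_derivative f' r t) (at r)"
    and w: "set_integrable lborel S w" and b: "\<And>r t. t \<in> S \<Longrightarrow> \<bar>r - r0\<bar> < 1 \<Longrightarrow> norm (f' r t) \<le> w t"
  shows "set_integrable lborel S (f' r0)"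
    and "((\<lambda>r. LINT t:S|lborel. f r t) has_vector_derivative (LINT t:S|lborel. f' r0 t)) (at r0)"
proof -
  define q where "q h t = (f (r0 + h) t - f r0 t) /\<^sub>R h" for h t
  have qi: "set_integrable lborel S (q h)" for h
    unfolding q_def by (intro set_integrable_scaleR_right set_integral_diff i)
  have qb: "norm (q h t) \<le> w t" if "t \<in> S" "\<bar>h\<bar> < 1" "h \<noteq> 0" for h t
    using vector_derivative_lipschitz[OF D[OF that(1)] b[OF that(1)], of r0 "r0 + h"] that
    by (simp add: q_def divide_simps mult_ac)
  have ql: "((\<lambda>h. q h t) \<longlongrightarrow> f' r0 t) (at 0)" if "t \<in> S" for t
    using D[OF that, of r0] by (simp only: has_vector_derivative_iff_quotient q_def)
  show "set_integrable lborel S (f' r0)"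
    using w qi qb ql by (rule tendsto_set_integral_dominated)
  have "((\<lambda>h. LINT t:S|lborel. q h t) \<longlongrightarrow> (LINT t:S|lborel. f' r0 t)) (at 0)"
    using w qi qb ql by (rule tendsto_set_integral_dominated)
  moreover have "(LINT t:S|lborel. q h t) = ((LINT t:S|lborel. f (r0 + h) t) - (LINT t:S|lborel. f r0 t)) /\<^sub>R h" for h
    using set_integral_diff(2)[OF i i] by (simp add: q_def)
  ultimately show "((\<lambda>r. LINT t:S|lborel. f r t) has_vector_derivative (LINT t:S|lborel. f' r0 t)) (at r0)"
    by (simp only: has_vector_derivative_iff_quotient)
qed

section \<open>Matrices\<close>

lemma matrix_scaleR_left: "(c *\<^sub>R X) ** Y = c *\<^sub>R (X ** Y)" for X :: "complex^'n^'m"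
  by (simp add: matrix_matrix_mult_def vec_eq_iff scaleR_sum_right)

lemma matrix_scaleR_right: "X ** (c *\<^sub>R Y) = c *\<^sub>R (X ** Y)" for X :: "complex^'n^'m"
  by (simp add: matrix_matrix_mult_def vec_eq_iff scaleR_sum_right)

lemma bounded_bilinear_cmat: "bounded_bilinear ((**) :: complex^'n^'m \<Rightarrow> complex^'k^'n \<Rightarrow> complex^'k^'m)"
proof -
  have "bilinear ((**) :: complex^'n^'m \<Rightarrow> complex^'k^'n \<Rightarrow> complex^'k^'m)"
    unfolding bilinear_def
    by (auto intro!: linearI simp: matrix_add_ldistrib matrix_scaleR_left matrix_scaleR_right)
      (simp add: matrix_matrix_mult_def vec_eq_iff distrib_right sum.distrib)
  then show ?thesis by (simp add: bilinear_conv_bounded_bilinear)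
qed

interpretation cmat: bounded_bilinear "(**) :: complex^'n^'n \<Rightarrow> complex^'n^'n \<Rightarrow> complex^'n^'n"
  by (rule bounded_bilinear_cmat)

lemmas cmat_minus = cmat.minus_left cmat.minus_right
lemmas cmat_arith = cmat.add_left cmat.add_right cmat.diff_left cmat.diff_right cmat.minus_left cmat.minus_right
  matrix_mul_assoc

section \<open>The conjugate transpose and bounds for unitary matrices\<close>

text \<open>The conjugate transpose. It stands in for the inverse of the transport: unlike
  \<open>matrix_inv\<close> it is a bounded real-linear map, so it commutes with integrals,
  derivatives and limits.\<close>

definition cadj :: "complex^'n^'n \<Rightarrow> complex^'n^'n" where
  "cadj X = (\<chi> i j. cnj (X $ j $ i))"

lemma bounded_linear_cadj: "bounded_linear cadj"
  by (subst linear_conv_bounded_linear[symmetric]) (auto intro!: linearI simp: cadj_def vec_eq_iff)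

lemma cadj_minus: "cadj (- X) = - cadj X"
  by (simp add: cadj_def vec_eq_iff)

lemma cadj_diff: "cadj (X - Y) = cadj X - cadj Y"
  by (simp add: cadj_def vec_eq_iff)

lemma cadj_add: "cadj (X + Y) = cadj X + cadj Y"
  by (simp add: cadj_def vec_eq_iff)

lemma cadj_mult: "cadj (X ** Y) = cadj Y ** cadj X"
  by (simp add: cadj_def matrix_matrix_mult_def vec_eq_iff mult.commute)

lemma cadj_cadj [simp]: "cadj (cadj X) = X"
  by (simp add: cadj_def vec_eq_iff)

lemma cadj_mat1 [simp]: "cadj (mat 1) = mat 1"
  by (auto simp: cadj_def mat_def vec_eq_iff)

lemma anti_hermitian_iff: "anti_hermitian X \<longleftrightarrow> cadj X = - X"
  by (auto simp: anti_hermitian_def cadj_def vec_eq_iff)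

lemma cmat_inverse_commute: "X ** Y = mat 1 \<Longrightarrow> Y ** X = mat 1" for X Y :: "complex^'n^'n"
  by (simp add: matrix_left_right_inverse)

text \<open>The diagonal of \<open>cadj U ** U\<close> says that the columns of \<open>U\<close> are
  unit vectors, so all entries have modulus at most 1. The constant is crude; what counts is that it
  depends on the dimension alone.\<close>

lemma unitary_norm_le:
  fixes U :: "complex^'n^'n"
  assumes "cadj U ** U = mat 1"
  shows "norm U \<le> real CARD('n) * real CARD('n)"
proof -
  have e: "norm (U $ i $ j) \<le> 1" for i j
  proof -
    have "(\<Sum>k\<in>UNIV. cnj (U $ k $ j) * U $ k $ j) = 1"
      using assms by (simp add: vec_eq_iff cadj_def matrix_matrix_mult_def mat_def)
    then have "of_real (\<Sum>k\<in>UNIV. (norm (U $ k $ j))\<^sup>2) = (1::complex)"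
      by (simp add: complex_norm_square mult.commute flip: of_real_power)
    then have s: "(\<Sum>k\<in>UNIV. (norm (U $ k $ j))\<^sup>2) = 1" using of_real_eq_1_iff by blast
    have "(norm (U $ i $ j))\<^sup>2 \<le> (\<Sum>k\<in>UNIV. (norm (U $ k $ j))\<^sup>2)"
      by (rule member_le_sum) auto
    then show ?thesis using s by (simp add: abs_square_le_1)
  qed
  have r: "norm (U $ i) \<le> real CARD('n)" for i
  proof -
    have "norm (U $ i) \<le> (\<Sum>j\<in>UNIV. norm (U $ i $ j))"
      unfolding norm_vec_def by (rule L2_set_le_sum) auto
    also have "\<dots> \<le> (\<Sum>j\<in>(UNIV::'n set). 1)" by (intro sum_mono e)
    finally show ?thesis by simp
  qed
  have "norm U \<le> (\<Sum>i\<in>UNIV. norm (U $ i))"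
    unfolding norm_vec_def[of U] by (rule L2_set_le_sum) auto
  also have "\<dots> \<le> (\<Sum>j\<in>(UNIV::'n set). real CARD('n))" by (intro sum_mono r)
  finally show ?thesis by simp
qed

text \<open>\<open>C\<close> depends on \<open>R\<close> and the operator constant of the matrix
  product only. With \<open>X\<close> and \<open>Y\<close> bounded by unitarity, an integrable bound
  for \<open>f\<close> becomes one for the conjugated field.\<close>

lemma sandwich_bound:
  fixes R :: real
  obtains C where "C \<ge> 0"
    "\<And>(X::complex^'n^'n) (f::complex^'n^'n) (Y::complex^'n^'n). norm X \<le> R \<Longrightarrow> norm Y \<le> R \<Longrightarrow> norm (X ** f ** Y) \<le> C * norm f"
proof -
  obtain K where K: "K > 0" "\<And>X Y. norm ((X::complex^'n^'n) ** (Y::complex^'n^'n)) \<le> norm X * norm Y * K"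
    using cmat.pos_bounded by blast
  have 1: "norm (X ** f ** Y) \<le> (\<bar>R\<bar> * \<bar>R\<bar> * K * K) * norm f" if "norm X \<le> R" "norm Y \<le> R" for X f Y :: "complex^'n^'n"
  proof -
    have "norm (X ** f ** Y) \<le> norm (X ** f) * norm Y * K" by (rule K)
    also have "\<dots> \<le> (norm X * norm f * K) * norm Y * K"
      using K by (intro mult_right_mono) auto
    also have "\<dots> \<le> (\<bar>R\<bar> * norm f * K) * \<bar>R\<bar> * K"
      using that K(1) by (intro mult_right_mono mult_mono) auto
    finally show ?thesis by (simp add: mult_ac)
  qed
  have 2: "\<bar>R\<bar> * \<bar>R\<bar> * K * K \<ge> 0" using K(1) by (intro mult_nonneg_nonneg) auto
  show ?thesis by (rule that[OF 2 1])
qed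

lemma sandwich_integrable:
  fixes X Y f :: "real \<Rightarrow> complex^'n^'n"
  assumes "continuous_on {a..b} X" "continuous_on {a..b} Y" "set_integrable lborel {a..b} f"
  shows "set_integrable lborel {a..b} (\<lambda>t. X t ** f t ** Y t)"
  by (rule set_integrable_bilinear_continuous[OF bounded_bilinear.flip[OF bounded_bilinear_cmat] _ assms(2)])
    (rule set_integrable_bilinear_continuous[OF bounded_bilinear_cmat assms(3,1)])

section \<open>Linear evolution equations\<close>

text \<open>The integral form of U' = - M U, U(0) = 1 for an abstract integrable coefficient.
  Parallel transport is the case where \<open>M\<close> is the connection contracted with the
  tangent.\<close>

definition transport :: "(real \<Rightarrow> complex^'n^'n) \<Rightarrow> (real \<Rightarrow> complex^'n^'n) \<Rightarrow> bool" where
  "transport M U \<longleftrightarrow> primitive U (\<lambda>s. - (M s ** U s)) \<and> U 0 = mat 1"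

lemma transport_continuous: "transport M U \<Longrightarrow> continuous_on {0..1} U"
  unfolding transport_def using primitive_continuous by blast

text \<open>The recursion of the Picard bounds: integrating c^n / n! against the derivative of
  \<open>c\<close> raises n by one. It goes through the chain rule because \<open>g\<close> is
  merely integrable.\<close>

lemma primitive_power_fact:
  fixes c g :: "real \<Rightarrow> real"
  assumes "primitive c g"
  shows "primitive (\<lambda>t. c t ^ Suc n / fact (Suc n)) (\<lambda>t. (c t ^ n / fact n) * g t)"
proof -
  have "primitive (\<lambda>t. (\<lambda>x. x ^ Suc n / fact (Suc n)) (c t)) (\<lambda>t. ((c t ^ n / fact n) *\<^sub>R id_blinfun) (g t))"
  proof (rule primitive_chain[OF assms])
    fix x :: real
    have e: "blinfun_apply ((x ^ n / fact n) *\<^sub>R id_blinfun) = (\<lambda>h. h * (x ^ n / fact n))"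
      by (auto simp: blinfun.scaleR_left)
    have "((\<lambda>x. x ^ Suc n / fact (Suc n)) has_real_derivative (real (Suc n) * x ^ n) / fact (Suc n)) (at x)"
      by (auto intro!: derivative_eq_intros simp del: fact_Suc power_Suc)
    moreover have "(real (Suc n) * x ^ n) / fact (Suc n) = x ^ n / fact n" by (simp add: divide_simps)
    ultimately show "((\<lambda>x. x ^ Suc n / fact (Suc n)) has_derivative ((x ^ n / fact n) *\<^sub>R id_blinfun)) (at x)"
      unfolding e by (simp only: has_field_derivative_def mult_commute_abs)
    show "continuous_on UNIV (\<lambda>x::real. (x ^ n / fact n) *\<^sub>R (id_blinfun :: real \<Rightarrow>\<^sub>L real))"
      by (intro continuous_intros) auto
  qed
  then show ?thesis by (simp add: blinfun.scaleR_left)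
qed

text \<open>Picard iteration; the $n$-th increment is bounded by $\|1\|(K\int_0^t\|M\|)^{n}/n!$.\<close>
lemma transport_exists:
  fixes M :: "real \<Rightarrow> complex^'n^'n"
  assumes M: "set_integrable lborel {0..1} M"
  shows "\<exists>U. transport M U"
proof -
  obtain K where K: "K > 0" "\<And>X Y. norm ((X::complex^'n^'n) ** (Y::complex^'n^'n)) \<le> norm X * norm Y * K"
    using cmat.pos_bounded by blast
  define c where "c t = (LINT s:{0..t}|lborel. K * norm (M s))" for t
  have ci: "set_integrable lborel {0..1} (\<lambda>s. K * norm (M s))"
    using set_integrable_norm[OF M] by auto
  have cp: "primitive c (\<lambda>s. K * norm (M s))"
    unfolding c_def by (rule primitive_integral0[OF ci])
  have c0: "c 0 = 0" unfolding c_def using set_borel_integral_eq_integral(2)[OF set_integrable_subset[OF ci, of "{0..0}"]] by simp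
  have cmono: "0 \<le> c t \<and> c t \<le> c 1" if "t \<in> {0..1}" for t
  proof -
    have nn: "(LINT u:{a..b}|lborel. K * norm (M u)) \<ge> 0" for a b
      unfolding set_lebesgue_integral_def using K(1) by (intro Bochner_Integration.integral_nonneg) (auto simp: indicator_def)
    show ?thesis using nn[of 0 t] nn[of t 1] primitive_diff_eq[OF cp, of t 1] that by (auto simp: c_def)
  qed
  define S where "S = rec_nat (\<lambda>t. mat 1) (\<lambda>_ S t. mat 1 - (LINT s:{0..t}|lborel. M s ** S s))"
  have S0: "S 0 t = mat 1" for t by (simp add: S_def)
  have SS: "S (Suc n) t = mat 1 - (LINT s:{0..t}|lborel. M s ** S n s)" for n t by (simp add: S_def)
  have MX: "set_integrable lborel {a..b} (\<lambda>s. M s ** X s)" if "continuous_on {0..1} X" "0 \<le> a" "b \<le> 1" for X a b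
    by (rule set_integrable_subset[OF set_integrable_bilinear_continuous[OF bounded_bilinear.flip[OF bounded_bilinear_cmat] M that(1)]]) (use that in auto)
  have Sc: "continuous_on {0..1} (S n)" for n
  proof (induction n)
    case 0 then show ?case by (simp add: S_def)
  next
    case (Suc n)
    have "primitive (\<lambda>t. mat 1 + (LINT s:{0..t}|lborel. - (M s ** S n s))) (\<lambda>s. - (M s ** S n s))"
      by (rule primitive_integral) (use MX[OF Suc, of 0 1] in \<open>auto intro: set_integrable_bounded_linear(1)[OF bounded_linear_minus[OF bounded_linear_ident]]\<close>)
    then have "continuous_on {0..1} (\<lambda>t. mat 1 + (LINT s:{0..t}|lborel. - (M s ** S n s)))" by (rule primitive_continuous)
    moreover have "mat 1 + (LINT s:{0..t}|lborel. - (M s ** S n s)) = S (Suc n) t" if "t \<in> {0..1}" for t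
      using set_integral_uminus[OF MX[OF Suc, of 0 t]] that by (simp add: SS)
    ultimately show ?case by (rule continuous_on_eq)
  qed
  define N where "N = norm (mat 1 :: complex^'n^'n)"
  have inc: "norm (S (Suc n) t - S n t) \<le> N * (c t ^ Suc n / fact (Suc n))" if "t \<in> {0..1}" for n t
    using that
  proof (induction n arbitrary: t)
    case 0
    have "norm (S (Suc 0) t - S 0 t) = norm (LINT s:{0..t}|lborel. M s ** mat 1)" by (simp add: SS S0[abs_def] S0)
    also have "\<dots> \<le> (LINT s:{0..t}|lborel. N * (K * norm (M s)))"
    proof (rule norm_set_integral_le)
      show "set_integrable lborel {0..t} (\<lambda>s. M s ** mat 1)" using MX[of "\<lambda>_. mat 1" 0 t] 0 by auto
      show "set_integrable lborel {0..t} (\<lambda>s. N * (K * norm (M s)))"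
        using primitive_integrable[OF cp, of 0 t] 0 by auto
      show "norm (M s ** mat 1) \<le> N * (K * norm (M s))" for s using K(2)[of "M s" "mat 1"] by (simp add: N_def mult_ac)
    qed
    also have "\<dots> = N * c t" by (simp add: c_def)
    finally show ?case by simp
  next
    case (Suc n)
    have "S (Suc (Suc n)) t - S (Suc n) t = - (LINT s:{0..t}|lborel. M s ** (S (Suc n) s - S n s))"
      using Suc.prems set_integral_diff(2)[OF MX[OF Sc, of 0 t "Suc n"] MX[OF Sc, of 0 t n]]
      by (subst (1 2) SS) (simp add: cmat.diff_right)
    then have "norm (S (Suc (Suc n)) t - S (Suc n) t) = norm (LINT s:{0..t}|lborel. M s ** (S (Suc n) s - S n s))" by simp
    also have "\<dots> \<le> (LINT s:{0..t}|lborel. N * ((c s ^ Suc n / fact (Suc n)) * (K * norm (M s))))"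
    proof (rule norm_set_integral_le)
      show "set_integrable lborel {0..t} (\<lambda>s. M s ** (S (Suc n) s - S n s))"
        using Suc.prems by (intro MX continuous_intros Sc) auto
      show "set_integrable lborel {0..t} (\<lambda>s. N * ((c s ^ Suc n / fact (Suc n)) * (K * norm (M s))))"
        using primitive_integrable[OF primitive_power_fact[OF cp], of 0 t "Suc n"] Suc.prems by auto
      fix s assume s: "s \<in> {0..t}"
      have "norm (M s ** (S (Suc n) s - S n s)) \<le> norm (M s) * norm (S (Suc n) s - S n s) * K" by (rule K)
      also have "\<dots> \<le> norm (M s) * (N * (c s ^ Suc n / fact (Suc n))) * K"
        using s Suc.prems K(1) by (intro mult_right_mono mult_left_mono Suc.IH) auto
      finally show "norm (M s ** (S (Suc n) s - S n s)) \<le> N * ((c s ^ Suc n / fact (Suc n)) * (K * norm (M s)))"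
        by (simp add: mult_ac)
    qed
    also have "\<dots> = N * (LINT s:{0..t}|lborel. (c s ^ Suc n / fact (Suc n)) * (K * norm (M s)))"
      by (rule set_integral_mult_right)
    also have "(LINT s:{0..t}|lborel. (c s ^ Suc n / fact (Suc n)) * (K * norm (M s))) = c t ^ Suc (Suc n) / fact (Suc (Suc n))"
      using primitive_diff_eq[OF primitive_power_fact[OF cp, of "Suc n"], of 0 t] Suc.prems c0 by simp
    finally show ?case .
  qed
  have summ: "summable (\<lambda>n. N * (c t ^ n / fact n))" for t
    using summable_exp[of "c t"] by (intro summable_mult) (simp add: divide_inverse mult.commute)
  \<comment> \<open>Summing the increments bounds all iterates by an exponential, uniformly in n and
    t; this gives the dominating function for the limit inside the integral equation.\<close>
  have bdd: "norm (S n t) \<le> N * exp (c 1)" if t: "t \<in> {0..1}" for n t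
  proof -
    have "norm (S n t) \<le> (\<Sum>k\<le>n. N * (c t ^ k / fact k))"
    proof (induction n)
      case 0 then show ?case by (simp add: S0 N_def)
    next
      case (Suc n)
      have "norm (S (Suc n) t) \<le> norm (S n t) + norm (S (Suc n) t - S n t)" by (metis add_diff_cancel_left' norm_triangle_ineq diff_add_cancel add.commute)
      also have "\<dots> \<le> (\<Sum>k\<le>n. N * (c t ^ k / fact k)) + N * (c t ^ Suc n / fact (Suc n))"
        using Suc inc[OF t] by (rule add_mono)
      finally show ?case by simp
    qed
    also have "\<dots> \<le> (\<Sum>k. N * (c t ^ k / fact k))"
      using cmono[OF t] by (intro sum_le_suminf summ) (auto simp: N_def)
    also have "\<dots> = N * exp (c t)"
      using summable_exp[of "c t"] by (simp add: suminf_mult exp_def divide_inverse mult.commute)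
    also have "\<dots> \<le> N * exp (c 1)" using cmono[OF t] by (intro mult_left_mono) (auto simp: N_def)
    finally show ?thesis .
  qed
  have conv: "convergent (\<lambda>n. S n t)" if t: "t \<in> {0..1}" for t
  proof -
    have "summable (\<lambda>n. S (Suc n) t - S n t)"
      by (rule summable_comparison_test'[OF summable_Suc_iff[THEN iffD2, OF summ[of t]], of 0]) (use inc[OF t] in auto)
    then have "convergent (\<lambda>n. \<Sum>k<n. S (Suc k) t - S k t)" by (simp add: summable_iff_convergent)
    then have "convergent (\<lambda>n. S n t - S 0 t)" by (simp add: sum_lessThan_telescope[of "\<lambda>n. S n t"])
    then show ?thesis by (simp add: convergent_diff_const_right_iff)
  qed
  define U where "U t = lim (\<lambda>n. S n t)" for t
  have lim: "(\<lambda>n. S n t) \<longlonglongrightarrow> U t" if "t \<in> {0..1}" for t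
    using conv[OF that] by (simp add: U_def convergent_LIMSEQ_iff)
  have MU: "set_integrable lborel {0..t} (\<lambda>s. M s ** U s) \<and>
      (\<lambda>n. LINT s:{0..t}|lborel. M s ** S n s) \<longlonglongrightarrow> (LINT s:{0..t}|lborel. M s ** U s)" if "t \<in> {0..1}" for t
  proof -
    have w: "set_integrable lborel {0..t} (\<lambda>s. (N * exp (c 1)) * (K * norm (M s)))"
      using primitive_integrable[OF cp, of 0 t] that by auto
    have i: "set_integrable lborel {0..t} (\<lambda>s. M s ** S n s)" for n using MX[OF Sc] that by auto
    have l: "(\<lambda>n. M s ** S n s) \<longlonglongrightarrow> M s ** U s" if "s \<in> {0..t}" for s
      using lim[of s] that \<open>t \<in> {0..1}\<close> by (intro cmat.tendsto tendsto_const) auto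
    have m: "set_borel_measurable lborel {0..t} (\<lambda>s. M s ** U s)"
      by (rule set_measurable_limit[OF set_integrable_imp_measurable[OF i] l])
    have b: "norm (M s ** S n s) \<le> (N * exp (c 1)) * (K * norm (M s))" if "s \<in> {0..t}" for n s
    proof -
      have "norm (M s ** S n s) \<le> norm (M s) * norm (S n s) * K" by (rule K)
      also have "\<dots> \<le> norm (M s) * (N * exp (c 1)) * K"
        using bdd[of s n] that \<open>t \<in> {0..1}\<close> K(1) by (intro mult_right_mono mult_left_mono) auto
      finally show ?thesis by (simp add: mult_ac)
    qed
    have l': "AE s in lborel. s \<in> {0..t} \<longrightarrow> (\<lambda>n. M s ** S n s) \<longlonglongrightarrow> M s ** U s" using l by (intro AE_I2) blast
    show ?thesis using set_dominated_convergence[OF w i m l' b] by blast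
  qed
  have Ueq: "U t = mat 1 - (LINT s:{0..t}|lborel. M s ** U s)" if "t \<in> {0..1}" for t
  proof (rule LIMSEQ_unique)
    show "(\<lambda>n. S (Suc n) t) \<longlonglongrightarrow> U t" using lim[OF that] by (rule LIMSEQ_Suc)
    show "(\<lambda>n. S (Suc n) t) \<longlonglongrightarrow> mat 1 - (LINT s:{0..t}|lborel. M s ** U s)"
      unfolding SS using MU[OF that] by (intro tendsto_diff tendsto_const) auto
  qed
  have "primitive (\<lambda>t. mat 1 + (LINT s:{0..t}|lborel. - (M s ** U s))) (\<lambda>s. - (M s ** U s))"
    by (rule primitive_integral) (use MU[of 1] in \<open>auto intro: set_integrable_bounded_linear(1)[OF bounded_linear_minus[OF bounded_linear_ident]]\<close>)
  then have "primitive U (\<lambda>s. - (M s ** U s))"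
    by (rule primitive_cong) (use Ueq set_integral_uminus[OF MU[THEN conjunct1]] in auto)
  moreover have "U 0 = mat 1" using Ueq[of 0] set_borel_integral_eq_integral(2)[of "{0..0}" "\<lambda>s. M s ** U s"] MU[of 0] by simp
  ultimately show ?thesis unfolding transport_def by blast
qed

text \<open>As \<open>M\<close> is skew, the adjoint of U' = - M U reads (cadj U)' = cadj U M, so in
  the product rule the two coefficients combine to M - N. Unitarity, uniqueness and the dependence
  on parameters all come from this identity.\<close>

lemma transport_duhamel:
  assumes U: "transport M U" and V: "transport N V" and sk: "\<And>t. t \<in> {0..1} \<Longrightarrow> cadj (M t) = - M t"
  shows "primitive (\<lambda>t. cadj (U t) ** V t) (\<lambda>t. cadj (U t) ** (M t - N t) ** V t)"
proof -
  have "primitive (\<lambda>t. cadj (U t) ** V t) (\<lambda>t. cadj (U t) ** (- (N t ** V t)) + cadj (- (M t ** U t)) ** V t)"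
    using U V unfolding transport_def
    by (intro primitive_bilinear[OF bounded_bilinear_cmat] primitive_linear[OF bounded_linear_cadj]) auto
  then show ?thesis
    by (rule primitive_cong) (simp_all add: cadj_minus cadj_mult sk cmat_arith)
qed

text \<open>Duhamel's identity for \<open>U\<close> against itself has integrand zero, so
  \<open>cadj (U t) ** U t\<close> keeps its initial value; for square matrices the other order
  follows.\<close>

lemma transport_unitary:
  assumes U: "transport M U" and sk: "\<And>t. t \<in> {0..1} \<Longrightarrow> cadj (M t) = - M t" and t: "t \<in> {0..1}"
  shows "cadj (U t) ** U t = mat 1" "U t ** cadj (U t) = mat 1"
proof -
  have "primitive (\<lambda>t. cadj (U t) ** U t) (\<lambda>t. 0)"
    using transport_duhamel[OF U U sk] by (rule primitive_cong) auto
  then show *: "cadj (U t) ** U t = mat 1"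
    using primitive_zero_imp_const[of "\<lambda>t. cadj (U t) ** U t", OF _ t] U unfolding transport_def by simp
  show "U t ** cadj (U t) = mat 1" by (rule cmat_inverse_commute[OF *])
qed

text \<open>With equal coefficients the Duhamel integrand vanishes, hence
  \<open>cadj (U t) ** V t\<close> is the identity, and multiplying by the unitary
  \<open>U t\<close> gives the claim.\<close>

lemma transport_unique:
  assumes U: "transport M U" and V: "transport M V" and sk: "\<And>t. t \<in> {0..1} \<Longrightarrow> cadj (M t) = - M t" and t: "t \<in> {0..1}"
  shows "U t = V t"
proof -
  have "primitive (\<lambda>t. cadj (U t) ** V t) (\<lambda>t. 0)"
    using transport_duhamel[OF U V sk] by (rule primitive_cong) auto
  then have "cadj (U t) ** V t = mat 1"
    using primitive_zero_imp_const[of "\<lambda>t. cadj (U t) ** V t", OF _ t] U V unfolding transport_def by simp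
  then have "U t ** (cadj (U t) ** V t) = U t" by simp
  then show ?thesis using transport_unitary(2)[OF U sk t] by (simp add: matrix_mul_assoc)
qed

lemma transport_norm_le:
  fixes U :: "real \<Rightarrow> complex^'n^'n"
  assumes U: "transport M U" and sk: "\<And>t. t \<in> {0..1} \<Longrightarrow> cadj (M t) = - M t" and t: "t \<in> {0..1}"
  shows "norm (U t) \<le> real CARD('n) * real CARD('n)" "norm (cadj (U t)) \<le> real CARD('n) * real CARD('n)"
  using transport_unitary[OF U sk t] by (auto intro: unitary_norm_le)

text \<open>Duhamel's formula turns the difference quotients of $U$ into integrals of those of $M$.\<close>
lemma transport_deriv_parameter:
  fixes M M' U :: "real \<Rightarrow> real \<Rightarrow> complex^'n^'n"
  assumes sk: "\<And>r t. t \<in> {0..1} \<Longrightarrow> cadj (M r t) = - M r t"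
    and tr: "\<And>r. transport (M r) (U r)" and Mi: "\<And>r. set_integrable lborel {0..1} (M r)"
    and D: "\<And>r t. t \<in> {0..1} \<Longrightarrow> ((\<lambda>r. M r t) has_vector_derivative M' r t) (at r)"
    and w: "set_integrable lborel {0..1} w"
    and b: "\<And>r t. t \<in> {0..1} \<Longrightarrow> \<bar>r - r0\<bar> < 1 \<Longrightarrow> norm (M' r t) \<le> w t" and t: "t \<in> {0..1}"
  shows "((\<lambda>r. U r t) has_vector_derivative - (U r0 t ** (LINT s:{0..t}|lborel. cadj (U r0 s) ** M' r0 s ** U r0 s))) (at r0)"
proof -
  define R where "R = real CARD('n) * real CARD('n)"
  obtain C where C: "C \<ge> 0" "\<And>(X::complex^'n^'n) (f::complex^'n^'n) (Y::complex^'n^'n). norm X \<le> R \<Longrightarrow> norm Y \<le> R \<Longrightarrow> norm (X ** f ** Y) \<le> C * norm f"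
    using sandwich_bound by blast
  obtain K where K: "K > 0" "\<And>X Y. norm ((X::complex^'n^'n) ** (Y::complex^'n^'n)) \<le> norm X * norm Y * K"
    using cmat.pos_bounded by blast
  have UR: "norm (U r t) \<le> R" "norm (cadj (U r t)) \<le> R" if "t \<in> {0..1}" for r t
    using transport_norm_le[OF tr sk that] by (simp_all add: R_def)
  have R0: "R \<ge> 0" by (simp add: R_def)
  have lip: "norm (M r t - M r0 t) \<le> w t * \<bar>r - r0\<bar>" if "t \<in> {0..1}" "\<bar>r - r0\<bar> < 1" for r t
    using vector_derivative_lipschitz[OF D[OF that(1)] b[OF that(1)] that(2)] .
  have cU: "continuous_on {0..t} (U r)" "continuous_on {0..t} (\<lambda>s. cadj (U r s))" if "t \<in> {0..1}" for r t
    using transport_continuous[OF tr[of r]] that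
    by (auto intro: continuous_on_subset bounded_linear.continuous_on[OF bounded_linear_cadj])
  have si: "set_integrable lborel {0..t} (\<lambda>s. cadj (U r0 s) ** f s ** U r s)"
    if "set_integrable lborel {0..1} f" "t \<in> {0..1}" for f r t
    by (rule sandwich_integrable[OF cU(2)[OF that(2)] cU(1)[OF that(2)] set_integrable_subset[OF that(1)]]) (use that in auto)
  have Mdi: "set_integrable lborel {0..1} (\<lambda>s. M r s - M r' s)" for r r'
    by (rule set_integral_diff(1)[OF Mi Mi])
  have duh: "U r t - U r0 t = U r0 t ** (LINT s:{0..t}|lborel. cadj (U r0 s) ** (M r0 s - M r s) ** U r s)"
    if t: "t \<in> {0..1}" for r t
  proof -
    have "cadj (U r0 t) ** U r t - mat 1 = (LINT s:{0..t}|lborel. cadj (U r0 s) ** (M r0 s - M r s) ** U r s)"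
      using primitive_diff_eq[OF transport_duhamel[OF tr[of r0] tr[of r] sk], of 0 t] t tr[of r0] tr[of r]
      by (simp add: transport_def)
    then have "U r0 t ** (LINT s:{0..t}|lborel. cadj (U r0 s) ** (M r0 s - M r s) ** U r s) = U r0 t ** (cadj (U r0 t) ** U r t - mat 1)"
      by simp
    moreover have "U r0 t ** cadj (U r0 t) = mat 1" by (rule transport_unitary(2)[OF tr sk t])
    ultimately show ?thesis by (simp add: cmat.diff_right matrix_mul_assoc)
  qed
  define L where "L = R * (LINT s:{0..1}|lborel. C * w s) * K"
  have w0: "0 \<le> w s" if "s \<in> {0..1}" for s by (rule order_trans[OF norm_ge_zero b[OF that, of r0]]) simp
  have wi: "set_integrable lborel {0..t} (\<lambda>s. C * w s)" if "t \<in> {0..1}" for t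
    by (rule set_integrable_subset[of _ "{0..1}"]) (use w that in auto)
  have wmono: "(LINT s:{0..t}|lborel. C * w s) \<le> (LINT s:{0..1}|lborel. C * w s)" if "t \<in> {0..1}" for t
  proof -
    have "0 \<le> (LINT s:{t..1}|lborel. C * w s)"
      unfolding set_lebesgue_integral_def using that C(1) w0
      by (intro Bochner_Integration.integral_nonneg) (auto simp: indicator_def)
    then show ?thesis using set_integral_split[OF wi[of 1], of t] that by simp
  qed
  \<comment> \<open>The integrand of the difference quotient still contains U at the shifted
    parameter. This Lipschitz estimate gives the continuity in r needed for its pointwise
    limit.\<close>
  have Lip: "norm (U r t - U r0 t) \<le> L * \<bar>r - r0\<bar>" if t: "t \<in> {0..1}" and r: "\<bar>r - r0\<bar> < 1" for r t
  proof -
    have "norm (LINT s:{0..t}|lborel. cadj (U r0 s) ** (M r0 s - M r s) ** U r s) \<le> (LINT s:{0..t}|lborel. (C * w s) * \<bar>r - r0\<bar>)"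
    proof (rule norm_set_integral_le[OF si[OF Mdi t]])
      show "set_integrable lborel {0..t} (\<lambda>s. C * w s * \<bar>r - r0\<bar>)" using wi[OF t] by (rule set_integrable_mult_left)
      fix s assume "s \<in> {0..t}"
      then have s: "s \<in> {0..1}" using t by auto
      have "norm (cadj (U r0 s) ** (M r0 s - M r s) ** U r s) \<le> C * norm (M r0 s - M r s)" by (rule C(2)[OF UR(2)[OF s] UR(1)[OF s]])
      also have "\<dots> \<le> C * (w s * \<bar>r - r0\<bar>)" using lip[OF s r] C(1) by (intro mult_left_mono) (auto simp: norm_minus_commute)
      finally show "norm (cadj (U r0 s) ** (M r0 s - M r s) ** U r s) \<le> C * w s * \<bar>r - r0\<bar>" by simp
    qed
    also have "\<dots> = (LINT s:{0..t}|lborel. C * w s) * \<bar>r - r0\<bar>" by (rule set_integral_mult_left)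
    also have "\<dots> \<le> (LINT s:{0..1}|lborel. C * w s) * \<bar>r - r0\<bar>" using wmono[OF t] by (rule mult_right_mono) simp
    finally have i: "norm (LINT s:{0..t}|lborel. cadj (U r0 s) ** (M r0 s - M r s) ** U r s) \<le> (LINT s:{0..1}|lborel. C * w s) * \<bar>r - r0\<bar>" .
    have "norm (U r t - U r0 t) \<le> norm (U r0 t) * norm (LINT s:{0..t}|lborel. cadj (U r0 s) ** (M r0 s - M r s) ** U r s) * K"
      unfolding duh[OF t] by (rule K)
    also have "\<dots> \<le> R * ((LINT s:{0..1}|lborel. C * w s) * \<bar>r - r0\<bar>) * K"
      using i UR(1)[OF t] K(1) R0 by (intro mult_right_mono mult_mono) auto
    finally show ?thesis by (simp add: L_def mult_ac)
  qed
  have Ulim: "((\<lambda>h. U (r0 + h) t) \<longlongrightarrow> U r0 t) (at 0)" if "t \<in> {0..1}" for t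
  proof -
    have "((\<lambda>h. L * \<bar>h\<bar>) \<longlongrightarrow> L * \<bar>0::real\<bar>) (at 0)" by (intro tendsto_intros)
    then have l0: "((\<lambda>h. L * \<bar>h\<bar>) \<longlongrightarrow> 0) (at 0)" by simp
    have "\<forall>\<^sub>F h in at 0. norm (U (r0 + h) t - U r0 t) \<le> L * \<bar>h\<bar>"
      unfolding eventually_at using Lip[OF that, of "r0 + _"] by (intro exI[of _ 1]) (auto simp: dist_real_def)
    then have "((\<lambda>h. U (r0 + h) t - U r0 t) \<longlongrightarrow> 0) (at 0)" using l0 by (rule Lim_null_comparison)
    then show ?thesis by (simp add: LIM_zero_iff)
  qed
  \<comment> \<open>Duhamel's integrand divided by h. The difference of coefficients is taken as old
    minus new, which produces the minus sign in front of \<open>M'\<close>.\<close>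
  define q where "q h s = cadj (U r0 s) ** ((M r0 s - M (r0 + h) s) /\<^sub>R h) ** U (r0 + h) s" for h s
  have qi: "set_integrable lborel {0..t} (q h)" for h
    unfolding q_def by (rule si[OF _ t]) (intro set_integrable_scaleR_right Mdi)
  have qb: "norm (q h s) \<le> C * w s" if "s \<in> {0..t}" "\<bar>h\<bar> < 1" "h \<noteq> 0" for h s
  proof -
    have s: "s \<in> {0..1}" using that t by auto
    have "norm (q h s) \<le> C * norm ((M r0 s - M (r0 + h) s) /\<^sub>R h)" unfolding q_def by (rule C(2)[OF UR(2)[OF s] UR(1)[OF s]])
    also have "\<dots> \<le> C * w s"
      using lip[OF s, of "r0 + h"] that C(1) by (intro mult_left_mono) (auto simp: norm_minus_commute divide_simps mult_ac)
    finally show ?thesis .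
  qed
  have ql: "((\<lambda>h. q h s) \<longlongrightarrow> cadj (U r0 s) ** (- M' r0 s) ** U r0 s) (at 0)" if "s \<in> {0..t}" for s
  proof -
    have s: "s \<in> {0..1}" using that t by auto
    have "((\<lambda>h. - ((M (r0 + h) s - M r0 s) /\<^sub>R h)) \<longlongrightarrow> - M' r0 s) (at 0)"
      using D[OF s, of r0] unfolding has_vector_derivative_iff_quotient by (rule tendsto_minus)
    then have "((\<lambda>h. (M r0 s - M (r0 + h) s) /\<^sub>R h) \<longlongrightarrow> - M' r0 s) (at 0)"
      by (simp add: scaleR_diff_right)
    then show ?thesis unfolding q_def by (intro cmat.tendsto tendsto_const Ulim[OF s])
  qed
  have "((\<lambda>h. LINT s:{0..t}|lborel. q h s) \<longlongrightarrow> (LINT s:{0..t}|lborel. cadj (U r0 s) ** (- M' r0 s) ** U r0 s)) (at 0)"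
    using wi[OF t] qi qb ql by (rule tendsto_set_integral_dominated)
  moreover have "set_integrable lborel {0..t} (\<lambda>s. cadj (U r0 s) ** (- M' r0 s) ** U r0 s)"
    using wi[OF t] qi qb ql by (rule tendsto_set_integral_dominated)
  then have "(LINT s:{0..t}|lborel. cadj (U r0 s) ** (- M' r0 s) ** U r0 s) = - (LINT s:{0..t}|lborel. cadj (U r0 s) ** M' r0 s ** U r0 s)"
    using set_integral_uminus[of lborel "{0..t}" "\<lambda>s. cadj (U r0 s) ** (- M' r0 s) ** U r0 s"] by (simp add: cmat_minus)
  ultimately have "((\<lambda>h. U r0 t ** (LINT s:{0..t}|lborel. q h s)) \<longlongrightarrow> U r0 t ** - (LINT s:{0..t}|lborel. cadj (U r0 s) ** M' r0 s ** U r0 s)) (at 0)"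
    by (intro cmat.tendsto tendsto_const) simp
  moreover have "U r0 t ** (LINT s:{0..t}|lborel. q h s) = (U (r0 + h) t - U r0 t) /\<^sub>R h" for h
    unfolding duh[OF t] q_def
    by (simp add: matrix_scaleR_left matrix_scaleR_right)
  ultimately show "((\<lambda>r. U r t) has_vector_derivative - (U r0 t ** (LINT s:{0..t}|lborel. cadj (U r0 s) ** M' r0 s ** U r0 s))) (at r0)"
    unfolding has_vector_derivative_iff_quotient by (simp add: cmat.minus_right)
qed

text \<open>The first variation $M'$ of the coefficient splits into a curvature part $G$ and a total
  derivative $\frac{d}{dt}(U^*\beta U)$ with $\beta$ vanishing at both ends; only $G$ and its covariant
  derivative $G' + [\beta, G]$ survive in the second variation.\<close>
lemma second_variation:
  fixes M M' U \<beta> G G' :: "real \<Rightarrow> real \<Rightarrow> complex^'n^'n"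
  defines "P \<equiv> \<lambda>r t. cadj (U r t) ** G r t ** U r t"
  defines "\<Phi> \<equiv> \<lambda>r t. LINT s:{0..t}|lborel. P r s"
  assumes sk: "\<And>r t. t \<in> {0..1} \<Longrightarrow> cadj (M r t) = - M r t"
    and tr: "\<And>r. transport (M r) (U r)" and Mi: "\<And>r. set_integrable lborel {0..1} (M r)"
    and D: "\<And>r t. t \<in> {0..1} \<Longrightarrow> ((\<lambda>r. M r t) has_vector_derivative M' r t) (at r)"
    and w: "\<And>r0. \<exists>w. set_integrable lborel {0..1} w \<and>
      (\<forall>r t. t \<in> {0..1} \<longrightarrow> \<bar>r - r0\<bar> < 1 \<longrightarrow> norm (M' r t) \<le> w t \<and> norm (G r t) \<le> w t \<and> norm (G' r t) \<le> w t)"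
    and Gi: "\<And>r. set_integrable lborel {0..1} (G r)"
    and skG: "\<And>r t. t \<in> {0..1} \<Longrightarrow> cadj (G r t) = - G r t"
    and skb: "\<And>r t. t \<in> {0..1} \<Longrightarrow> cadj (\<beta> r t) = - \<beta> r t"
    and DG: "\<And>r t. t \<in> {0..1} \<Longrightarrow> ((\<lambda>r. G r t) has_vector_derivative G' r t) (at r)"
    and bprim: "\<And>r. primitive (\<lambda>t. cadj (U r t) ** \<beta> r t ** U r t) (\<lambda>t. cadj (U r t) ** (M' r t - G r t) ** U r t)"
    and b0: "\<And>r. \<beta> r 0 = 0" and b1: "\<And>r. \<beta> r 1 = 0"
  shows "((\<lambda>r. U r 1) has_vector_derivative - (U r 1 ** \<Phi> r 1)) (at r)"
    and "((\<lambda>r. - (U r 1 ** \<Phi> r 1)) has_vector_derivative U r 1 **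
      (2 *\<^sub>R (LINT t:{0..1}|lborel. P r t ** \<Phi> r t)
       - (LINT t:{0..1}|lborel. cadj (U r t) ** (G' r t + \<beta> r t ** G r t - G r t ** \<beta> r t) ** U r t))) (at r)"
proof -
  define dU where "dU r t = - (U r t ** (LINT s:{0..t}|lborel. cadj (U r s) ** M' r s ** U r s))" for r t
  have cU: "continuous_on {0..1} (U r)" "continuous_on {0..1} (\<lambda>s. cadj (U r s))" for r
    using transport_continuous[OF tr[of r]] by (auto intro: bounded_linear.continuous_on[OF bounded_linear_cadj])
  have DU: "((\<lambda>r. U r t) has_vector_derivative dU r t) (at r)" if "t \<in> {0..1}" for r t
  proof -
    obtain v where v: "set_integrable lborel {0..1} v" "\<And>\<rho> t. t \<in> {0..1} \<Longrightarrow> \<bar>\<rho> - r\<bar> < 1 \<Longrightarrow> norm (M' \<rho> t) \<le> v t"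
      using w[of r] by blast
    show ?thesis unfolding dU_def by (rule transport_deriv_parameter[OF sk tr Mi D v that])
  qed
  have M'i: "set_integrable lborel {0..1} (M' r)" for r
  proof -
    obtain v where v: "set_integrable lborel {0..1} v" "\<And>\<rho> t. t \<in> {0..1} \<Longrightarrow> \<bar>\<rho> - r\<bar> < 1 \<Longrightarrow> norm (M' \<rho> t) \<le> v t"
      using w[of r] by blast
    show ?thesis by (rule has_vector_derivative_set_integral(1)[OF Mi D v])
  qed
  have Pi: "set_integrable lborel {0..1} (P r)" for r
    unfolding P_def by (rule sandwich_integrable[OF cU(2) cU(1) Gi])
  have \<Phi>p: "primitive (\<Phi> r) (P r)" for r unfolding \<Phi>_def by (rule primitive_integral0[OF Pi])
  have \<Phi>c: "continuous_on {0..1} (\<Phi> r)" for r by (rule primitive_continuous[OF \<Phi>p])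
  have \<Phi>0: "\<Phi> r 0 = 0" for r
    unfolding \<Phi>_def using set_borel_integral_eq_integral(2)[OF set_integrable_subset[OF Pi, of "{0..0}"]] by simp
  have un: "U r t ** cadj (U r t) = mat 1" "cadj (U r t) ** U r t = mat 1" if "t \<in> {0..1}" for r t
    using transport_unitary[OF tr[of r] sk that] by auto
  \<comment> \<open>The integrated variation of the coefficient is \<open>\<Phi>\<close> plus the
    boundary value of the total derivative; the contribution at 0 drops out since
    \<open>\<beta>\<close> vanishes there. At t = 1 the other boundary value drops out as
    well.\<close>
  have Psi: "(LINT s:{0..t}|lborel. cadj (U r s) ** M' r s ** U r s) = \<Phi> r t + cadj (U r t) ** \<beta> r t ** U r t"
    if t: "t \<in> {0..1}" for r t
  proof -
    have i: "set_integrable lborel {0..t} (P r)" "set_integrable lborel {0..t} (\<lambda>s. cadj (U r s) ** (M' r s - G r s) ** U r s)"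
      using primitive_integrable[OF \<Phi>p, of 0 t] primitive_integrable[OF bprim, of 0 t] t by auto
    have "(LINT s:{0..t}|lborel. cadj (U r s) ** (M' r s - G r s) ** U r s) = cadj (U r t) ** \<beta> r t ** U r t"
      using primitive_diff_eq[OF bprim, of 0 t] t by (simp add: b0)
    then have "\<Phi> r t + cadj (U r t) ** \<beta> r t ** U r t = (LINT s:{0..t}|lborel. P r s + cadj (U r s) ** (M' r s - G r s) ** U r s)"
      using set_integral_add(2)[OF i] by (simp add: \<Phi>_def)
    also have "\<dots> = (LINT s:{0..t}|lborel. cadj (U r s) ** M' r s ** U r s)"
      by (intro set_lebesgue_integral_cong) (auto simp: P_def cmat_arith)
    finally show ?thesis by simp
  qed
  have dU: "dU r t = - (U r t ** \<Phi> r t + \<beta> r t ** U r t)" if t: "t \<in> {0..1}" for r t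
    unfolding dU_def Psi[OF t] by (simp add: cmat.add_right matrix_mul_assoc un[OF t])
  show D1: "((\<lambda>r. U r 1) has_vector_derivative - (U r 1 ** \<Phi> r 1)) (at r)" for r
    using DU[of 1 r] dU[of 1 r] by (simp add: b1)
  define P' where "P' r t = cadj (U r t) ** G r t ** dU r t + (cadj (U r t) ** G' r t + cadj (dU r t) ** G r t) ** U r t" for r t
  have DP: "((\<lambda>r. P r t) has_vector_derivative P' r t) (at r)" if "t \<in> {0..1}" for r t
    unfolding P_def P'_def
    by (rule cmat.has_vector_derivative[OF cmat.has_vector_derivative[OF bounded_linear.has_vector_derivative[OF bounded_linear_cadj]]])
      (rule DU[OF that] DG[OF that])+
  \<comment> \<open>Skewness of \<open>\<Phi>\<close> lets the adjoint of \<open>dU\<close> be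
    written through \<open>\<Phi>\<close> and \<open>\<beta>\<close> again, so that both variations
    of U in \<open>P'\<close> combine to commutators.\<close>
  have skP: "cadj (\<Phi> r t) = - \<Phi> r t" if "t \<in> {0..1}" for r t
  proof -
    have i: "set_integrable lborel {0..t} (P r)" using primitive_integrable[OF \<Phi>p, of 0 t] that by auto
    have "cadj (\<Phi> r t) = (LINT s:{0..t}|lborel. cadj (P r s))"
      unfolding \<Phi>_def by (rule set_integrable_bounded_linear(2)[OF bounded_linear_cadj i, symmetric])
    also have "\<dots> = (LINT s:{0..t}|lborel. - P r s)"
      using that by (intro set_lebesgue_integral_cong) (auto simp: P_def cadj_mult skG matrix_mul_assoc cmat_minus)
    also have "\<dots> = - \<Phi> r t" unfolding \<Phi>_def by (rule set_integral_uminus[OF i])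
    finally show ?thesis .
  qed
  define Q where "Q r t = cadj (U r t) ** (G' r t + \<beta> r t ** G r t - G r t ** \<beta> r t) ** U r t" for r t
  \<comment> \<open>The part \<open>\<beta> U\<close> of the variation of U completes
    \<open>G'\<close> to the covariant derivative collected in \<open>Q\<close>; the part
    \<open>U \<Phi>\<close> yields the commutator of \<open>\<Phi>\<close> with
    \<open>P\<close>.\<close>
  have P'eq: "P' r t = \<Phi> r t ** P r t - P r t ** \<Phi> r t + Q r t" if t: "t \<in> {0..1}" for r t
  proof -
    have c: "cadj (dU r t) = \<Phi> r t ** cadj (U r t) + cadj (U r t) ** \<beta> r t"
      unfolding dU[OF t] by (simp add: cadj_minus cadj_add cadj_diff cadj_mult skP[OF t] skb[OF t] cmat_minus)
    show ?thesis unfolding P'_def c unfolding dU[OF t] P_def Q_def by (simp add: cmat_arith)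
  qed
  show "((\<lambda>r. - (U r 1 ** \<Phi> r 1)) has_vector_derivative U r 1 **
      (2 *\<^sub>R (LINT t:{0..1}|lborel. P r t ** \<Phi> r t)
       - (LINT t:{0..1}|lborel. cadj (U r t) ** (G' r t + \<beta> r t ** G r t - G r t ** \<beta> r t) ** U r t))) (at r)"
  proof -
    obtain v where v: "set_integrable lborel {0..1} v"
      "\<And>\<rho> t. t \<in> {0..1} \<Longrightarrow> \<bar>\<rho> - r\<bar> < 1 \<Longrightarrow> norm (M' \<rho> t) \<le> v t \<and> norm (G \<rho> t) \<le> v t \<and> norm (G' \<rho> t) \<le> v t"
      using w[of r] by blast
    define R where "R = real CARD('n) * real CARD('n)"
    have R0: "R \<ge> 0" by (simp add: R_def)
    have UR: "norm (U r t) \<le> R" "norm (cadj (U r t)) \<le> R" if "t \<in> {0..1}" for r t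
      using transport_norm_le[OF tr[of r] sk that] by (simp_all add: R_def)
    obtain C where C: "C \<ge> 0" "\<And>(X::complex^'n^'n) (f::complex^'n^'n) (Y::complex^'n^'n). norm X \<le> R \<Longrightarrow> norm Y \<le> R \<Longrightarrow> norm (X ** f ** Y) \<le> C * norm f"
      using sandwich_bound by blast
    obtain K where K: "K > 0" "\<And>X Y. norm ((X::complex^'n^'n) ** (Y::complex^'n^'n)) \<le> norm X * norm Y * K"
      using cmat.pos_bounded by blast
    obtain A where A: "A > 0" "\<And>X::complex^'n^'n. norm (cadj X) \<le> norm X * A"
      using bounded_linear.pos_bounded[OF bounded_linear_cadj] by blast
    have v0: "0 \<le> v t" if "t \<in> {0..1}" for t
      using order_trans[OF norm_ge_zero v(2)[OF that, of r, THEN conjunct1]] by simp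
    have vi: "set_integrable lborel {a..b} (\<lambda>s. C * v s)" if "0 \<le> a" "b \<le> 1" for a b
      by (rule set_integrable_subset[of _ "{0..1}"]) (use v(1) that in auto)
    define L where "L = R * (LINT s:{0..1}|lborel. C * v s) * K"
    have dUL: "norm (dU \<rho> t) \<le> L" if t: "t \<in> {0..1}" and \<rho>: "\<bar>\<rho> - r\<bar> < 1" for \<rho> t
    proof -
      have "norm (LINT s:{0..t}|lborel. cadj (U \<rho> s) ** M' \<rho> s ** U \<rho> s) \<le> (LINT s:{0..t}|lborel. C * v s)"
      proof (rule norm_set_integral_le)
        show "set_integrable lborel {0..t} (\<lambda>s. cadj (U \<rho> s) ** M' \<rho> s ** U \<rho> s)"
          by (rule set_integrable_subset[OF sandwich_integrable[OF cU(2) cU(1) M'i]]) (use t in auto)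
        show "set_integrable lborel {0..t} (\<lambda>s. C * v s)" using vi t by auto
        fix s assume "s \<in> {0..t}"
        then have s: "s \<in> {0..1}" using t by auto
        have "norm (cadj (U \<rho> s) ** M' \<rho> s ** U \<rho> s) \<le> C * norm (M' \<rho> s)" by (rule C(2)[OF UR(2)[OF s] UR(1)[OF s]])
        also have "\<dots> \<le> C * v s" using v(2)[OF s \<rho>] C(1) by (intro mult_left_mono) auto
        finally show "norm (cadj (U \<rho> s) ** M' \<rho> s ** U \<rho> s) \<le> C * v s" .
      qed
      also have "\<dots> \<le> (LINT s:{0..1}|lborel. C * v s)"
      proof -
        have "0 \<le> (LINT s:{t..1}|lborel. C * v s)"
          unfolding set_lebesgue_integral_def using t C(1) v0
          by (intro Bochner_Integration.integral_nonneg) (auto simp: indicator_def)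
        then show ?thesis using set_integral_split[OF vi[of 0 1], of t] t by simp
      qed
      finally have i: "norm (LINT s:{0..t}|lborel. cadj (U \<rho> s) ** M' \<rho> s ** U \<rho> s) \<le> (LINT s:{0..1}|lborel. C * v s)" .
      have "norm (dU \<rho> t) \<le> norm (U \<rho> t) * norm (LINT s:{0..t}|lborel. cadj (U \<rho> s) ** M' \<rho> s ** U \<rho> s) * K"
        unfolding dU_def norm_minus_cancel by (rule K)
      also have "\<dots> \<le> L" unfolding L_def using i UR(1)[OF t] K(1) R0 by (intro mult_right_mono mult_mono) auto
      finally show ?thesis .
    qed
    have L0: "L \<ge> 0" using order_trans[OF norm_ge_zero dUL[of 0 r]] by simp
    \<comment> \<open>One radius majorising U, its variation and both adjoints, so that a single
      sandwich constant handles all three terms of \<open>P'\<close>.\<close>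
    define R' where "R' = R + L + L * A"
    have LA: "L * A \<ge> 0" using L0 A(1) by simp
    obtain C' where C': "C' \<ge> 0" "\<And>(X::complex^'n^'n) (f::complex^'n^'n) (Y::complex^'n^'n). norm X \<le> R' \<Longrightarrow> norm Y \<le> R' \<Longrightarrow> norm (X ** f ** Y) \<le> C' * norm f"
      using sandwich_bound by blast
    have P'b: "norm (P' \<rho> t) \<le> (3 * C') * v t" if t: "t \<in> {0..1}" and \<rho>: "\<bar>\<rho> - r\<bar> < 1" for \<rho> t
    proof -
      have a: "norm (cadj (dU \<rho> t)) \<le> L * A"
        by (rule order_trans[OF A(2) mult_right_mono[OF dUL[OF t \<rho>]]]) (use A(1) in simp)
      have n: "norm (U \<rho> t) \<le> R'" "norm (cadj (U \<rho> t)) \<le> R'" "norm (dU \<rho> t) \<le> R'" "norm (cadj (dU \<rho> t)) \<le> R'"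
        unfolding R'_def using UR[OF t, of \<rho>] dUL[OF t \<rho>] L0 R0 LA a by linarith+
      have "norm (P' \<rho> t) \<le> norm (cadj (U \<rho> t) ** G \<rho> t ** dU \<rho> t) + (norm (cadj (U \<rho> t) ** G' \<rho> t ** U \<rho> t) + norm (cadj (dU \<rho> t) ** G \<rho> t ** U \<rho> t))"
        unfolding P'_def cmat.add_left by (intro norm_triangle_le add_left_mono norm_triangle_ineq)
      also have "\<dots> \<le> C' * v t + (C' * v t + C' * v t)"
        using v(2)[OF t \<rho>] C'(1)
        by (intro add_mono order_trans[OF C'(2)[OF n(2) n(3)]] order_trans[OF C'(2)[OF n(2) n(1)]] order_trans[OF C'(2)[OF n(4) n(1)]] mult_left_mono) auto
      finally show ?thesis by simp
    qed
    have v3: "set_integrable lborel {0..1} (\<lambda>t. (3 * C') * v t)" using v(1) by (rule set_integrable_mult_right)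
    have P'i: "set_integrable lborel {0..1} (P' r)"
      by (rule has_vector_derivative_set_integral(1)[OF Pi DP v3 P'b])
    have D\<Phi>: "((\<lambda>r. \<Phi> r 1) has_vector_derivative (LINT t:{0..1}|lborel. P' r t)) (at r)"
      unfolding \<Phi>_def by (rule has_vector_derivative_set_integral(2)[OF Pi DP v3 P'b])
    have i1: "set_integrable lborel {0..1} (\<lambda>t. \<Phi> r t ** P r t)"
      by (rule set_integrable_bilinear_continuous[OF bounded_bilinear_cmat Pi \<Phi>c])
    have i2: "set_integrable lborel {0..1} (\<lambda>t. P r t ** \<Phi> r t)"
      by (rule set_integrable_bilinear_continuous[OF bounded_bilinear.flip[OF bounded_bilinear_cmat] Pi \<Phi>c])
    have "set_integrable lborel {0..1} (\<lambda>t. P' r t - (\<Phi> r t ** P r t - P r t ** \<Phi> r t))"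
      by (intro set_integral_diff(1) P'i i1 i2)
    then have Qi: "set_integrable lborel {0..1} (Q r)"
      by (rule set_integrable_cong[THEN iffD1, rotated -1]) (auto simp: P'eq)
    have IP': "(LINT t:{0..1}|lborel. P' r t) = (LINT t:{0..1}|lborel. \<Phi> r t ** P r t) - (LINT t:{0..1}|lborel. P r t ** \<Phi> r t) + (LINT t:{0..1}|lborel. Q r t)"
    proof -
      have "(LINT t:{0..1}|lborel. P' r t) = (LINT t:{0..1}|lborel. \<Phi> r t ** P r t - P r t ** \<Phi> r t + Q r t)"
        by (intro set_lebesgue_integral_cong) (auto simp: P'eq)
      then show ?thesis by (simp add: set_integral_add(2) set_integral_diff i1 i2 Qi)
    qed
    \<comment> \<open>The product rule for the square of \<open>\<Phi>\<close>, with
      \<open>\<Phi> r 0 = 0\<close>. After subtracting the commutator in \<open>IP'\<close>, the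
      terms with \<open>\<Phi>\<close> on the left cancel and those with \<open>\<Phi>\<close> on
      the right double.\<close>
    have PP: "\<Phi> r 1 ** \<Phi> r 1 = (LINT t:{0..1}|lborel. \<Phi> r t ** P r t) + (LINT t:{0..1}|lborel. P r t ** \<Phi> r t)"
      using primitive_diff_eq[OF primitive_bilinear[OF bounded_bilinear_cmat \<Phi>p[of r] \<Phi>p[of r]], of 0 1] set_integral_add(2)[OF i1 i2]
      by (simp add: \<Phi>0)
    have "((\<lambda>r. - (U r 1 ** \<Phi> r 1)) has_vector_derivative - (U r 1 ** (LINT t:{0..1}|lborel. P' r t) + (- (U r 1 ** \<Phi> r 1)) ** \<Phi> r 1)) (at r)"
      by (intro has_vector_derivative_minus cmat.has_vector_derivative D1 D\<Phi>)
    moreover have "- (U r 1 ** (LINT t:{0..1}|lborel. P' r t) + (- (U r 1 ** \<Phi> r 1)) ** \<Phi> r 1) =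
       U r 1 ** (2 *\<^sub>R (LINT t:{0..1}|lborel. P r t ** \<Phi> r t) - (LINT t:{0..1}|lborel. Q r t))"
    proof -
      have "- (U r 1 ** (LINT t:{0..1}|lborel. P' r t) + (- (U r 1 ** \<Phi> r 1)) ** \<Phi> r 1) =
        U r 1 ** (\<Phi> r 1 ** \<Phi> r 1) - U r 1 ** (LINT t:{0..1}|lborel. P' r t)" by (simp add: cmat_arith)
      also have "\<dots> = U r 1 ** (2 *\<^sub>R (LINT t:{0..1}|lborel. P r t ** \<Phi> r t) - (LINT t:{0..1}|lborel. Q r t))"
        unfolding PP IP' scaleR_2 cmat.add_right cmat.diff_right by (simp only: algebra_simps)
      finally show ?thesis .
    qed
    ultimately show ?thesis by (simp add: Q_def)
  qed
qed

section \<open>Continuously differentiable fields\<close>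

text \<open>The regularity used of A and of its curvature. It is phrased with derivatives along the
  axes, matching \<open>smooth\<close>; total differentiability is derived from it in
  \<open>C1_has_derivative\<close>.\<close>

definition C1 :: "(real^'d \<Rightarrow> 'b::euclidean_space) \<Rightarrow> bool" where
  "C1 f \<longleftrightarrow> continuous_on UNIV f \<and> (\<forall>\<mu>. continuous_on UNIV (partial \<mu> f) \<and>
     (\<forall>x. ((\<lambda>s. f (x + s *\<^sub>R axis \<mu> 1)) has_vector_derivative partial \<mu> f x) (at 0)))"

lemma partial_eqI: "((\<lambda>s. f (x + s *\<^sub>R axis \<mu> 1)) has_vector_derivative p) (at 0) \<Longrightarrow> partial \<mu> f x = p"
  unfolding partial_def by (rule vector_derivative_at)

lemma C1I:
  assumes "continuous_on UNIV f" "\<And>\<mu>. continuous_on UNIV (p \<mu>)"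
    and "\<And>\<mu> x. ((\<lambda>s. f (x + s *\<^sub>R axis \<mu> 1)) has_vector_derivative p \<mu> x) (at 0)"
  shows "C1 f"
proof -
  have "partial \<mu> f = p \<mu>" for \<mu> using partial_eqI[OF assms(3)] by blast
  then show ?thesis using assms unfolding C1_def by auto
qed

lemma C1_continuous: "C1 f \<Longrightarrow> continuous_on UNIV f"
  and C1_continuous_partial: "C1 f \<Longrightarrow> continuous_on UNIV (partial \<mu> f)"
  and C1_partial: "C1 f \<Longrightarrow> ((\<lambda>s. f (x + s *\<^sub>R axis \<mu> 1)) has_vector_derivative partial \<mu> f x) (at 0)"
  by (auto simp: C1_def)

lemma C1_diff: "C1 f \<Longrightarrow> C1 g \<Longrightarrow> C1 (\<lambda>x. f x - g x)"
  by (rule C1I[where p="\<lambda>\<mu> x. partial \<mu> f x - partial \<mu> g x"])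
    (intro continuous_on_diff has_vector_derivative_diff C1_continuous C1_continuous_partial C1_partial, assumption+)+

lemma C1_add: "C1 f \<Longrightarrow> C1 g \<Longrightarrow> C1 (\<lambda>x. f x + g x)"
  by (rule C1I[where p="\<lambda>\<mu> x. partial \<mu> f x + partial \<mu> g x"])
    (intro continuous_on_add has_vector_derivative_add C1_continuous C1_continuous_partial C1_partial, assumption+)+

lemma C1_mult:
  fixes f g :: "real^'d \<Rightarrow> complex^'n^'n"
  assumes "C1 f" "C1 g"
  shows "C1 (\<lambda>x. f x ** g x)"
proof (rule C1I[where p="\<lambda>\<mu> x. f x ** partial \<mu> g x + partial \<mu> f x ** g x"])
  show "continuous_on UNIV (\<lambda>x. f x ** g x)"
    using assms by (intro cmat.continuous_on C1_continuous)
  show "continuous_on UNIV (\<lambda>x. f x ** partial \<mu> g x + partial \<mu> f x ** g x)" for \<mu>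
    using assms by (intro continuous_on_add cmat.continuous_on C1_continuous C1_continuous_partial)
  show "((\<lambda>s. f (x + s *\<^sub>R axis \<mu> 1) ** g (x + s *\<^sub>R axis \<mu> 1)) has_vector_derivative
      f x ** partial \<mu> g x + partial \<mu> f x ** g x) (at 0)" for \<mu> x
    using cmat.has_vector_derivative[OF C1_partial[OF assms(1)] C1_partial[OF assms(2)], of x \<mu> x \<mu>] by simp
qed

lemma smooth_C1: "smooth f \<Longrightarrow> C1 f"
  unfolding smooth_def C1_def
  by (metis iter_partial.simps)

lemma iter_partial_partial: "iter_partial ms (partial \<mu> f) = iter_partial (ms @ [\<mu>]) f"
  by (induction ms) auto

lemma smooth_partial: "smooth f \<Longrightarrow> smooth (partial \<mu> f)"
  unfolding smooth_def iter_partial_partial by (metis append_Cons)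

lemma C1_directional:
  assumes "C1 f"
  shows "((\<lambda>r. f (x + (r * h) *\<^sub>R axis \<mu> 1)) has_vector_derivative h *\<^sub>R partial \<mu> f (x + (r * h) *\<^sub>R axis \<mu> 1)) (at r)"
proof -
  \<comment> \<open>Moving the base point to the current position reduces the derivative at an
    arbitrary r to the axis derivative at parameter 0.\<close>
  define y where "y = x + (r * h) *\<^sub>R axis \<mu> 1"
  have a: "((\<lambda>\<rho>. (\<rho> - r) * h) has_vector_derivative h) (at r)"
    by (auto intro!: derivative_eq_intros simp: has_real_derivative_iff_has_vector_derivative[symmetric])
  have b: "((\<lambda>s. f (y + s *\<^sub>R axis \<mu> 1)) has_vector_derivative partial \<mu> f y) (at ((r - r) * h))"
    using C1_partial[OF assms] by simp
  have c: "(\<lambda>s. f (y + s *\<^sub>R axis \<mu> 1)) \<circ> (\<lambda>\<rho>. (\<rho> - r) * h) = (\<lambda>r. f (x + (r * h) *\<^sub>R axis \<mu> 1))"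
    by (auto simp: fun_eq_iff y_def algebra_simps)
  show ?thesis using vector_diff_chain_at[OF a b] unfolding c by (simp only: y_def)
qed

text \<open>The increment is made one coordinate at a time. The mean value inequality on each axis
  segment and continuity of the partials give an error of at most e' times the norm of
  \<open>v\<close> per coordinate, and \<open>e'\<close> is \<open>e\<close> divided by the
  dimension.\<close>

lemma C1_has_derivative:
  fixes f :: "real^'d::finite \<Rightarrow> 'b::euclidean_space"
  assumes "C1 f"
  shows "(f has_derivative (\<lambda>v. \<Sum>\<mu>\<in>UNIV. v $ \<mu> *\<^sub>R partial \<mu> f x)) (at x)"
  unfolding has_derivative_at_alt
proof (intro conjI allI impI)
  show "bounded_linear (\<lambda>v. \<Sum>\<mu>\<in>UNIV. v $ \<mu> *\<^sub>R partial \<mu> f x)"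
    by (intro bounded_linear_sum bounded_linear_scaleR_const bounded_linear_vec_nth)
  fix e :: real assume "e > 0"
  define e' where "e' = e / real CARD('d)"
  have e': "e' > 0" using \<open>e > 0\<close> by (simp add: e'_def)
  have "\<exists>d>0. \<forall>y. dist y x < d \<longrightarrow> dist (partial \<mu> f y) (partial \<mu> f x) < e'" for \<mu>
    using C1_continuous_partial[OF assms, of \<mu>] e' unfolding continuous_on_iff by auto
  then obtain D where D: "\<And>\<mu>. D \<mu> > 0" "\<And>\<mu> y. dist y x < D \<mu> \<Longrightarrow> dist (partial \<mu> f y) (partial \<mu> f x) < e'"
    by metis
  define d where "d = Min (range D)"
  have d: "d > 0" "\<And>\<mu>. d \<le> D \<mu>" using D(1) by (auto simp: d_def)
  have claim: "norm (f (x + (\<Sum>i\<in>S. v $ i *\<^sub>R axis i 1)) - f x - (\<Sum>i\<in>S. v $ i *\<^sub>R partial i f x)) \<le> real (card S) * (e' * norm v)"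
    if v: "norm v < d" for v and S :: "'d set"
    using finite[of S]
  proof (induction S rule: finite_induct)
    case empty
    then show ?case by simp
  next
    case (insert j S)
    define y where "y = x + (\<Sum>i\<in>S. v $ i *\<^sub>R axis i 1)"
    define g where "g s = f (y + s *\<^sub>R axis j 1) - s *\<^sub>R partial j f x" for s
    have comp: "(y + s *\<^sub>R axis j 1 - x) $ k = (if k \<in> S then v $ k else if k = j then s else 0)" for s k
    proof -
      have "(\<Sum>i\<in>S. v $ i *\<^sub>R axis i 1) $ k = (\<Sum>i\<in>S. if k = i then v $ i else 0)"
        by (simp add: axis_def if_distrib cong: if_cong)
      then show ?thesis using insert.hyps by (auto simp: y_def axis_def)
    qed
    \<comment> \<open>Each coordinate of the intermediate displacement is bounded in modulus by that
      of \<open>v\<close>, so the whole axis segment stays in the neighbourhood where the partial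
      varies by less than \<open>e'\<close>.\<close>
    have near: "dist (y + s *\<^sub>R axis j 1) x < D j" if "\<bar>s\<bar> \<le> \<bar>v $ j\<bar>" for s
    proof -
      have "norm (y + s *\<^sub>R axis j 1 - x) \<le> norm v"
        using that by (intro norm_le_componentwise_cart) (auto simp only: comp split: if_splits, auto)
      then show ?thesis using v d(2)[of j] by (simp add: dist_norm)
    qed
    have "norm (g (v $ j) - g 0) \<le> e' * norm (v $ j - 0)"
    proof (rule differentiable_bound[where S="{-\<bar>v $ j\<bar>..\<bar>v $ j\<bar>}" and f'="\<lambda>s h. h *\<^sub>R (partial j f (y + s *\<^sub>R axis j 1) - partial j f x)"])
      fix s assume s: "s \<in> {-\<bar>v $ j\<bar>..\<bar>v $ j\<bar>}"
      have "(g has_vector_derivative 1 *\<^sub>R partial j f (y + (s * 1) *\<^sub>R axis j 1) - partial j f x) (at s)"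
        unfolding g_def using C1_directional[OF assms, of y 1 j s]
        by (intro has_vector_derivative_diff) (auto intro!: derivative_eq_intros simp: has_vector_derivative_def)
      then show "(g has_derivative (\<lambda>h. h *\<^sub>R (partial j f (y + s *\<^sub>R axis j 1) - partial j f x))) (at s within {-\<bar>v $ j\<bar>..\<bar>v $ j\<bar>})"
        by (simp add: has_vector_derivative_def has_derivative_at_withinI)
      have "onorm (\<lambda>h. h *\<^sub>R (partial j f (y + s *\<^sub>R axis j 1) - partial j f x)) = onorm (\<lambda>h::real. h) * norm (partial j f (y + s *\<^sub>R axis j 1) - partial j f x)"
        by (rule onorm_scaleR_left) (rule bounded_linear_ident)
      also have "onorm (\<lambda>h::real. h) = 1" by (rule onorm_id)
      finally show "onorm (\<lambda>h. h *\<^sub>R (partial j f (y + s *\<^sub>R axis j 1) - partial j f x)) \<le> e'"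
        using D(2)[OF near, of s] s by (simp add: dist_norm abs_le_iff less_imp_le)
    qed auto
    also have "\<dots> \<le> e' * norm v" using e' component_le_norm_cart[of v j] by (intro mult_left_mono) auto
    finally have 1: "norm (f (y + v $ j *\<^sub>R axis j 1) - f y - v $ j *\<^sub>R partial j f x) \<le> e' * norm v"
      by (simp add: g_def algebra_simps)
    have 2: "f (x + (\<Sum>i\<in>insert j S. v $ i *\<^sub>R axis i 1)) - f x - (\<Sum>i\<in>insert j S. v $ i *\<^sub>R partial i f x)
      = (f (y + v $ j *\<^sub>R axis j 1) - f y - v $ j *\<^sub>R partial j f x) + (f y - f x - (\<Sum>i\<in>S. v $ i *\<^sub>R partial i f x))"
      using insert.hyps by (simp add: y_def algebra_simps)
    have 3: "norm (f y - f x - (\<Sum>i\<in>S. v $ i *\<^sub>R partial i f x)) \<le> real (card S) * (e' * norm v)"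
      using insert.IH by (simp add: y_def)
    have "norm (f (x + (\<Sum>i\<in>insert j S. v $ i *\<^sub>R axis i 1)) - f x - (\<Sum>i\<in>insert j S. v $ i *\<^sub>R partial i f x))
      \<le> e' * norm v + real (card S) * (e' * norm v)" 
      unfolding 2 by (rule norm_triangle_le[OF add_mono[OF 1 3]])
    also have "\<dots> = real (card (insert j S)) * (e' * norm v)" using insert.hyps by (simp add: algebra_simps)
    finally show ?case .
  qed
  show "\<exists>d>0. \<forall>y. norm (y - x) < d \<longrightarrow> norm (f y - f x - (\<Sum>\<mu>\<in>UNIV. (y - x) $ \<mu> *\<^sub>R partial \<mu> f x)) \<le> e * norm (y - x)"
  proof (intro exI conjI allI impI)
    show "d > 0" by fact
    fix y assume y: "norm (y - x) < d"
    have "(\<Sum>i\<in>UNIV. (y - x) $ i *\<^sub>R axis i 1) = y - x"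
      using basis_expansion[of "y - x"] by (simp add: scalar_mult_eq_scaleR)
    then show "norm (f y - f x - (\<Sum>\<mu>\<in>UNIV. (y - x) $ \<mu> *\<^sub>R partial \<mu> f x)) \<le> e * norm (y - x)"
      using claim[OF y, of UNIV] by (simp add: e'_def)
  qed
qed

lemma primitive_C1:
  fixes f :: "real^'d::finite \<Rightarrow> 'b::euclidean_space"
  assumes f: "C1 f" and \<gamma>: "primitive \<gamma> g"
  shows "primitive (\<lambda>t. f (\<gamma> t)) (\<lambda>t. \<Sum>\<mu>\<in>UNIV. g t $ \<mu> *\<^sub>R partial \<mu> f (\<gamma> t))"
proof -
  define f' where "f' x = Blinfun (\<lambda>v. \<Sum>\<mu>\<in>UNIV. v $ \<mu> *\<^sub>R partial \<mu> f x)" for x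
  have f': "blinfun_apply (f' x) = (\<lambda>v. \<Sum>\<mu>\<in>UNIV. v $ \<mu> *\<^sub>R partial \<mu> f x)" for x
    unfolding f'_def by (rule bounded_linear_Blinfun_apply[OF has_derivative_bounded_linear[OF C1_has_derivative[OF f]]])
  have "primitive (\<lambda>t. f (\<gamma> t)) (\<lambda>t. f' (\<gamma> t) (g t))"
  proof (rule primitive_chain[OF \<gamma>])
    show "(f has_derivative f' x) (at x)" for x unfolding f' by (rule C1_has_derivative[OF f])
    show "continuous_on UNIV f'"
      by (rule continuous_on_blinfun_componentwise) (auto simp: f' intro!: continuous_intros C1_continuous_partial[OF f])
  qed
  then show ?thesis by (simp add: f')
qed

section \<open>Curvature\<close>

lemma curvature_C1:
  assumes "\<And>\<mu>. smooth (A \<mu>)"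
  shows "C1 (curvature A \<mu> \<nu>)"
  unfolding curvature_def[abs_def] commutator_def
  by (intro C1_add C1_diff C1_mult smooth_C1 smooth_partial assms)

text \<open>Because of this, adding a multiple of \<open>axis \<mu> 1\<close> to the tangent does
  not change its contraction with F_{\<mu>\<nu>}; the curvature part of the first variation is
  therefore free of the derivative of h.\<close>

lemma curvature_self: "curvature A \<mu> \<mu> x = 0"
  by (simp add: curvature_def commutator_def)

lemma partial_skew:
  assumes "C1 f" "\<And>x. cadj (f x) = - f x"
  shows "cadj (partial \<mu> f x) = - partial \<mu> f x"
proof -
  have "((\<lambda>s. cadj (f (x + s *\<^sub>R axis \<mu> 1))) has_vector_derivative cadj (partial \<mu> f x)) (at 0)"
    by (rule bounded_linear.has_vector_derivative[OF bounded_linear_cadj C1_partial[OF assms(1)]])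
  moreover have "((\<lambda>s. - f (x + s *\<^sub>R axis \<mu> 1)) has_vector_derivative - partial \<mu> f x) (at 0)"
    by (rule has_vector_derivative_minus[OF C1_partial[OF assms(1)]])
  ultimately show ?thesis using vector_derivative_unique_at unfolding assms(2) by blast
qed

lemma curvature_skew:
  assumes "\<And>\<mu>. smooth (A \<mu>)" "\<And>\<mu> x. cadj (A \<mu> x) = - A \<mu> x"
  shows "cadj (curvature A \<mu> \<nu> x) = - curvature A \<mu> \<nu> x"
  by (simp add: curvature_def commutator_def cadj_add cadj_diff cadj_mult assms(2) cmat_minus
    partial_skew[OF smooth_C1[OF assms(1)] assms(2)])

lemma cov_deriv_curvature_continuous:
  fixes A :: "'d::finite \<Rightarrow> real^'d \<Rightarrow> complex^'n^'n"
  assumes "\<And>\<mu>. smooth (A \<mu>)"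
  shows "continuous_on UNIV (cov_deriv A \<mu> (curvature A \<mu> \<nu>))"
  unfolding cov_deriv_def[abs_def] commutator_def
  by (intro continuous_on_add continuous_on_diff cmat.continuous_on C1_continuous_partial C1_continuous
    curvature_C1 smooth_C1 assms)

lemma ym_current_continuous:
  fixes A :: "'d::finite \<Rightarrow> real^'d \<Rightarrow> complex^'n^'n"
  assumes "\<And>\<mu>. smooth (A \<mu>)"
  shows "continuous_on UNIV (ym_current A \<nu>)"
  unfolding ym_current_def[abs_def] by (intro continuous_on_sum cov_deriv_curvature_continuous assms)

section \<open>Parallel transport\<close>

text \<open>On the unit interval square integrability implies integrability, here through x <= 1 +
  x^2.\<close>

lemma L2_deriv_primitive:
  assumes "is_L2_deriv \<gamma> g"
  shows "primitive \<gamma> g"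
proof -
  have g: "g \<in> borel_measurable lborel" "set_integrable lborel {0..1} (\<lambda>t. (norm (g t))\<^sup>2)"
    "\<And>t. t \<in> {0..1} \<Longrightarrow> \<gamma> t = (LINT s:{0..t}|lborel. g s)" using assms by (auto simp: is_L2_deriv_def)
  have "set_integrable lborel {0..1} (\<lambda>t. 1 + (norm (g t))\<^sup>2)"
    by (intro set_integral_add(1) g(2) continuous_set_integrable continuous_intros)
  then have i: "set_integrable lborel {0..1} g"
  proof (rule set_integrable_bound)
    show "set_borel_measurable lborel {0..1} g"
      unfolding set_borel_measurable_def using g(1) by (intro borel_measurable_scaleR borel_measurable_indicator) auto
    have "x \<le> 1 + x\<^sup>2" if "0 \<le> x" for x :: real
      using power2_eq_square zero_le_power2[of "x - 1"] that by (simp add: power2_diff)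
    then show "AE t in lborel. t \<in> {0..1} \<longrightarrow> norm (g t) \<le> norm (1 + (norm (g t))\<^sup>2)"
      by (intro AE_I2) auto
  qed
  have "primitive (\<lambda>t. LINT s:{0..t}|lborel. g s) g" by (rule primitive_integral0[OF i])
  then show ?thesis by (rule primitive_cong) (use g(3) in auto)
qed

lemma L2_deriv_start: "is_L2_deriv \<gamma> g \<Longrightarrow> \<gamma> 0 = 0"
  using set_borel_integral_eq_integral(2)[OF primitive_integrable[OF L2_deriv_primitive, of \<gamma> g 0 0]]
  by (auto simp: is_L2_deriv_def)

lemma is_L2_derivI:
  assumes "primitive \<gamma> g" "\<gamma> 0 = 0" "g \<in> borel_measurable lborel" "set_integrable lborel {0..1} (\<lambda>t. (norm (g t))\<^sup>2)"
  shows "is_L2_deriv \<gamma> g"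
  using assms by (auto simp: is_L2_deriv_def primitive_def)

text \<open>Keeps the varied paths inside \<open>W120\<close>: a continuous tangent is bounded on
  [0,1], and the square of a sum is at most twice the sum of squares.\<close>

lemma is_L2_deriv_add:
  assumes g: "is_L2_deriv \<gamma> g" and c: "primitive \<eta> c" "\<eta> 0 = 0" "continuous_on UNIV c"
  shows "is_L2_deriv (\<lambda>t. \<gamma> t + \<eta> t) (\<lambda>t. g t + c t)"
proof (rule is_L2_derivI)
  show "primitive (\<lambda>t. \<gamma> t + \<eta> t) (\<lambda>t. g t + c t)" by (rule primitive_add[OF L2_deriv_primitive[OF g] c(1)])
  show "\<gamma> 0 + \<eta> 0 = 0" using L2_deriv_start[OF g] c(2) by simp
  have cm: "c \<in> borel_measurable lborel" using borel_measurable_continuous_onI[OF c(3)] by simp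
  have gm: "g \<in> borel_measurable lborel" using g by (simp add: is_L2_deriv_def)
  show m: "(\<lambda>t. g t + c t) \<in> borel_measurable lborel" using gm cm by (rule borel_measurable_add)
  have "set_integrable lborel {0..1} (\<lambda>t. 2 * (norm (g t))\<^sup>2 + 2 * (norm (c t))\<^sup>2)"
    using g continuous_on_subset[OF c(3)]
    by (intro set_integral_add(1) set_integrable_mult_right continuous_set_integrable[of _ _ "\<lambda>t. (norm (c t))\<^sup>2"] continuous_intros)
      (auto simp: is_L2_deriv_def)
  then show "set_integrable lborel {0..1} (\<lambda>t. (norm (g t + c t))\<^sup>2)"
  proof (rule set_integrable_bound)
    have "(\<lambda>t. (norm (g t + c t))\<^sup>2) \<in> borel_measurable lborel" using m by measurable
    then show "set_borel_measurable lborel {0..1} (\<lambda>t. (norm (g t + c t))\<^sup>2)"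
      unfolding set_borel_measurable_def by (intro borel_measurable_scaleR borel_measurable_indicator) auto
    have "(norm (g t + c t))\<^sup>2 \<le> 2 * (norm (g t))\<^sup>2 + 2 * (norm (c t))\<^sup>2" for t
    proof -
      have "(norm (g t + c t))\<^sup>2 \<le> (norm (g t) + norm (c t))\<^sup>2" by (intro power_mono norm_triangle_ineq) auto
      also have "\<dots> \<le> 2 * (norm (g t))\<^sup>2 + 2 * (norm (c t))\<^sup>2"
        using zero_le_power2[of "norm (g t) - norm (c t)"] by (simp add: power2_diff power2_sum)
      finally show ?thesis .
    qed
    then show "AE t in lborel. t \<in> {0..1} \<longrightarrow> norm ((norm (g t + c t))\<^sup>2) \<le> norm (2 * (norm (g t))\<^sup>2 + 2 * (norm (c t))\<^sup>2)"
      by (intro AE_I2) auto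
  qed
qed

text \<open>The connection form evaluated on the tangent. The representative \<open>g\<close> is an
  explicit argument, so that results can be stated for every choice of it.\<close>

definition conn :: "('d::finite \<Rightarrow> real^'d \<Rightarrow> complex^'n::finite^'n) \<Rightarrow> (real \<Rightarrow> real^'d) \<Rightarrow> (real \<Rightarrow> real^'d) \<Rightarrow> real \<Rightarrow> complex^'n^'n" where
  "conn A \<gamma> g s = (\<Sum>\<mu>\<in>UNIV. g s $ \<mu> *\<^sub>R A \<mu> (\<gamma> s))"

lemma weighted_sum_integrable:
  fixes \<gamma> g :: "real \<Rightarrow> real^'d::finite" and \<Psi> :: "'d \<Rightarrow> real \<Rightarrow> 'b::euclidean_space"
  assumes "primitive \<gamma> g" "\<And>\<mu>. continuous_on {0..1} (\<Psi> \<mu>)"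
  shows "set_integrable lborel {0..1} (\<lambda>s. \<Sum>\<mu>\<in>UNIV. g s $ \<mu> *\<^sub>R \<Psi> \<mu> s)"
proof (rule set_integrable_sum)
  fix \<mu> :: 'd
  have "set_integrable lborel {0..1} (\<lambda>s. g s $ \<mu>)"
    by (rule set_integrable_bounded_linear(1)[OF bounded_linear_vec_nth primitive_integrable[OF assms(1)]]) auto
  then show "set_integrable lborel {0..1} (\<lambda>s. g s $ \<mu> *\<^sub>R \<Psi> \<mu> s)"
    by (rule set_integrable_bilinear_continuous[OF bounded_bilinear.flip[OF bounded_bilinear_scaleR] _ assms(2)])
qed

lemma weighted_sum_unique:
  fixes \<gamma> g g' :: "real \<Rightarrow> real^'d::finite" and \<Psi> :: "'d \<Rightarrow> real \<Rightarrow> 'b::euclidean_space"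
  assumes g: "primitive \<gamma> g" and g': "primitive \<gamma> g'" and c: "\<And>\<mu>. continuous_on {0..1} (\<Psi> \<mu>)" and t: "t \<in> {0..1}"
  shows "(LINT s:{0..t}|lborel. (\<Sum>\<mu>\<in>UNIV. g s $ \<mu> *\<^sub>R \<Psi> \<mu> s)) = (LINT s:{0..t}|lborel. (\<Sum>\<mu>\<in>UNIV. g' s $ \<mu> *\<^sub>R \<Psi> \<mu> s))"
proof -
  have i: "set_integrable lborel {0..t} (\<lambda>s. k s $ \<mu> *\<^sub>R \<Psi> \<mu> s)" if "primitive \<gamma> k" for k \<mu>
  proof -
    have "set_integrable lborel {0..1} (\<lambda>s. k s $ \<mu>)"
      by (rule set_integrable_bounded_linear(1)[OF bounded_linear_vec_nth primitive_integrable[OF that]]) auto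
    then have "set_integrable lborel {0..1} (\<lambda>s. k s $ \<mu> *\<^sub>R \<Psi> \<mu> s)"
      by (rule set_integrable_bilinear_continuous[OF bounded_bilinear.flip[OF bounded_bilinear_scaleR] _ c])
    then show ?thesis by (rule set_integrable_subset) (use t in auto)
  qed
  have "(LINT s:{0..t}|lborel. g s $ \<mu> *\<^sub>R \<Psi> \<mu> s) = (LINT s:{0..t}|lborel. g' s $ \<mu> *\<^sub>R \<Psi> \<mu> s)" for \<mu>
    by (rule primitive_unique_weighted[OF bounded_bilinear.flip[OF bounded_bilinear_scaleR]
      primitive_linear[OF bounded_linear_vec_nth g] primitive_linear[OF bounded_linear_vec_nth g'] c t])
  then show ?thesis by (simp add: set_integral_sum' i g g')
qed

lemma conn_integrable:
  fixes A :: "'d::finite \<Rightarrow> real^'d \<Rightarrow> complex^'n^'n"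
  assumes "\<And>\<mu>. smooth (A \<mu>)" "primitive \<gamma> g"
  shows "set_integrable lborel {0..1} (conn A \<gamma> g)"
  unfolding conn_def
  by (rule weighted_sum_integrable[OF assms(2)])
    (rule continuous_on_compose2[OF C1_continuous[OF smooth_C1[OF assms(1)]] primitive_continuous[OF assms(2)]], auto)

lemma conn_skew:
  assumes "\<And>\<mu> x. cadj (A \<mu> x) = - A \<mu> x"
  shows "cadj (conn A \<gamma> g s) = - conn A \<gamma> g s"
proof -
  interpret l: linear cadj by (rule bounded_linear.linear[OF bounded_linear_cadj])
  show ?thesis by (simp add: conn_def l.sum l.scale assms sum_negf)
qed

lemma conn_mult: "conn A \<gamma> g s ** (X :: complex^'n::finite^'n) = (\<Sum>\<mu>\<in>UNIV. g s $ \<mu> *\<^sub>R (A \<mu> (\<gamma> s) ** X))"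
  by (simp add: conn_def cmat.sum_left matrix_scaleR_left)

lemma transport_conn_iff:
  fixes A :: "'d::finite \<Rightarrow> real^'d \<Rightarrow> complex^'n^'n"
  assumes A: "\<And>\<mu>. smooth (A \<mu>)" and g: "primitive \<gamma> g"
  shows "transport (conn A \<gamma> g) U \<longleftrightarrow> continuous_on {0..1} U \<and>
    (\<forall>t\<in>{0..1}. U t = mat 1 - (LINT s:{0..t}|lborel. (\<Sum>\<mu>\<in>UNIV. g s $ \<mu> *\<^sub>R (A \<mu> (\<gamma> s) ** U s))))"
    (is "?L \<longleftrightarrow> ?R")
proof -
  have i: "set_integrable lborel {0..t} (\<lambda>s. conn A \<gamma> g s ** U s)" if "continuous_on {0..1} U" "t \<in> {0..1}" for t
    by (rule set_integrable_subset[OF set_integrable_bilinear_continuous[OF bounded_bilinear.flip[OF bounded_bilinear_cmat] conn_integrable[OF A g] that(1)]])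
      (use that in auto)
  have e: "(LINT s:{0..t}|lborel. - (conn A \<gamma> g s ** U s)) = - (LINT s:{0..t}|lborel. (\<Sum>\<mu>\<in>UNIV. g s $ \<mu> *\<^sub>R (A \<mu> (\<gamma> s) ** U s)))"
    if "continuous_on {0..1} U" "t \<in> {0..1}" for t
    using set_integral_uminus[OF i[OF that]] by (simp add: conn_mult)
  show ?thesis
  proof
    assume L: ?L
    have c: "continuous_on {0..1} U" by (rule transport_continuous[OF L])
    have "U t = mat 1 - (LINT s:{0..t}|lborel. (\<Sum>\<mu>\<in>UNIV. g s $ \<mu> *\<^sub>R (A \<mu> (\<gamma> s) ** U s)))" if "t \<in> {0..1}" for t
    proof -
      have "(LINT s:{0..t}|lborel. - (conn A \<gamma> g s ** U s)) = U t - mat 1" "U 0 = mat 1"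
        using L that unfolding transport_def primitive_def by auto
      then show ?thesis using e[OF c that] by (simp add: algebra_simps)
    qed
    then show ?R using c by blast
  next
    assume R: ?R
    have ni: "set_integrable lborel {0..1} (\<lambda>s. - (conn A \<gamma> g s ** U s))"
      using i[of 1] R by (intro set_integrable_bounded_linear(1)[OF bounded_linear_minus[OF bounded_linear_ident]]) auto
    have "primitive U (\<lambda>s. - (conn A \<gamma> g s ** U s))"
      by (rule primitive_cong[OF primitive_integral[OF ni, of "mat 1"]]) (use R e in auto)
    moreover have "(LINT s:{0..0}|lborel. (\<Sum>\<mu>\<in>UNIV. g s $ \<mu> *\<^sub>R (A \<mu> (\<gamma> s) ** U s))) = 0"
      using set_borel_integral_eq_integral(2)[OF i[of 0]] R by (simp add: conn_mult)
    then have "U 0 = mat 1" using R by simp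
    ultimately show ?L by (simp add: transport_def)
  qed
qed

text \<open>A continuous transport sees the tangent only through integrals against continuous
  weights, which depend on the path alone. Hence the arbitrary choice in \<open>path_deriv\<close>
  is harmless.\<close>

lemma transport_conn_indep:
  fixes A :: "'d::finite \<Rightarrow> real^'d \<Rightarrow> complex^'n^'n"
  assumes A: "\<And>\<mu>. smooth (A \<mu>)" and g: "primitive \<gamma> g" and g': "primitive \<gamma> g'"
    and U: "transport (conn A \<gamma> g) U"
  shows "transport (conn A \<gamma> g') U"
proof -
  have c: "continuous_on {0..1} (\<lambda>s. A \<mu> (\<gamma> s) ** U s)" for \<mu>
    by (intro cmat.continuous_on transport_continuous[OF U]
      continuous_on_compose2[OF C1_continuous[OF smooth_C1[OF A]] primitive_continuous[OF g]]) auto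
  show ?thesis
    using U unfolding transport_conn_iff[OF A g] transport_conn_iff[OF A g'] using weighted_sum_unique[OF g g' c] by simp
qed

text \<open>Makes the definite description meaningful: existence is Picard iteration, uniqueness on
  [0,1] comes from skewness. The equation is then transferred from the chosen tangent to an
  arbitrary \<open>g\<close>.\<close>

lemma par_transport:
  fixes A :: "'d::finite \<Rightarrow> real^'d \<Rightarrow> complex^'n^'n"
  assumes A: "\<And>\<mu>. smooth (A \<mu>)" and sk: "\<And>\<mu> x. cadj (A \<mu> x) = - A \<mu> x" and g: "is_L2_deriv \<gamma> g"
  shows "transport (conn A \<gamma> g) (par_transport A \<gamma>)"
proof -
  define k where "k = path_deriv \<gamma>"
  have k: "primitive \<gamma> k"
    unfolding k_def path_deriv_def by (rule L2_deriv_primitive[OF someI[of "is_L2_deriv \<gamma>", OF g]])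
  obtain V where V: "transport (conn A \<gamma> k) V" 
    by (metis transport_exists[OF conn_integrable[of A, OF assms(1) k]])
  \<comment> \<open>The description asks for a function on all reals; the value 0 outside [0,1]
    makes it unique there too.\<close>
  define W where "W t = (if t \<in> {0..1} then V t else 0)" for t
  have W: "transport (conn A \<gamma> k) W"
    using V unfolding transport_def by (auto simp: W_def intro: primitive_cong[where F=V])
  define Q where "Q U \<longleftrightarrow> continuous_on {0..1} U \<and> (\<forall>t. t \<notin> {0..1} \<longrightarrow> U t = 0) \<and>
     (\<forall>t\<in>{0..1}. U t = mat 1 - (LINT s:{0..t}|lborel.
         (\<Sum>\<mu>\<in>UNIV. (k s $ \<mu>) *\<^sub>R (A \<mu> (\<gamma> s) ** U s))))" for U
  have Qiff: "Q U \<longleftrightarrow> transport (conn A \<gamma> k) U \<and> (\<forall>t. t \<notin> {0..1} \<longrightarrow> U t = 0)" for U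
    unfolding Q_def transport_conn_iff[OF A k] by blast
  have pt: "par_transport A \<gamma> = (THE U. Q U)" unfolding par_transport_def Q_def k_def ..
  have "Q (par_transport A \<gamma>)"
    unfolding pt
  proof (rule theI[of Q W])
    show "Q W" using W by (simp add: Qiff W_def)
    fix U assume "Q U"
    then show "U = W" using transport_unique[OF _ W conn_skew[OF sk]] by (auto simp: Qiff fun_eq_iff W_def)
  qed
  then have "transport (conn A \<gamma> k) (par_transport A \<gamma>)" by (simp add: Qiff)
  then show ?thesis by (rule transport_conn_indep[OF A k L2_deriv_primitive[OF g]])
qed

section \<open>The second derivative of the parallel transport\<close>

context
  fixes A :: "'d::finite \<Rightarrow> real^'d \<Rightarrow> complex^'n::finite^'n"
  assumes A: "\<And>\<mu>. smooth (A \<mu>)" and sk: "\<And>\<mu> x. cadj (A \<mu> x) = - A \<mu> x"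
begin

text \<open>An instance of the second variation with \<beta> = h A_\<mu> and G = h F_{\<mu>\<nu>}
  contracted with the tangent. The conditions at the two ends of h make \<beta> vanish there, so no
  boundary term and no derivative of h survive.\<close>

lemma second_deriv_dir_par_transport:
  fixes \<gamma> g :: "real \<Rightarrow> real^'d" and h h' :: "real \<Rightarrow> real" and \<mu> :: 'd
  assumes g: "is_L2_deriv \<gamma> g" and h: "primitive h h'" "continuous_on UNIV h'" "h 0 = 0" "h 1 = 0"
  defines "U \<equiv> par_transport A \<gamma>"
  defines "P \<equiv> \<lambda>t. h t *\<^sub>R (cadj (U t) ** (\<Sum>\<nu>\<in>UNIV. g t $ \<nu> *\<^sub>R curvature A \<mu> \<nu> (\<gamma> t)) ** U t)"
  shows "second_deriv_dir (\<lambda>\<gamma>'. par_transport A \<gamma>' 1) \<gamma> (\<lambda>t. h t *\<^sub>R axis \<mu> 1) =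
    U 1 ** (2 *\<^sub>R (LINT t:{0..1}|lborel. P t ** (LINT s:{0..t}|lborel. P s))
      - (LINT t:{0..1}|lborel. (h t)\<^sup>2 *\<^sub>R
          (cadj (U t) ** (\<Sum>\<nu>\<in>UNIV. g t $ \<nu> *\<^sub>R cov_deriv A \<mu> (curvature A \<mu> \<nu>) (\<gamma> t)) ** U t)))"
proof -
  define p where "p r t = \<gamma> t + (r * h t) *\<^sub>R axis \<mu> 1" for r t
  define q where "q r t = g t + (r * h' t) *\<^sub>R axis \<mu> 1" for r t
  define V where "V r = par_transport A (p r)" for r
  define M where "M r = conn A (p r) (q r)" for r
  define M' where "M' r t = (\<Sum>\<nu>\<in>UNIV. q r t $ \<nu> *\<^sub>R (h t *\<^sub>R partial \<mu> (A \<nu>) (p r t))) + h' t *\<^sub>R A \<mu> (p r t)" for r t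
  define \<beta> where "\<beta> r t = h t *\<^sub>R A \<mu> (p r t)" for r t
  \<comment> \<open>The unvaried tangent \<open>g\<close> may be used in place of \<open>q r\<close>
    since F_{\<mu>\<mu>} = 0; this makes the tangent factor of \<open>G\<close> independent of
    r.\<close>
  define G where "G r t = h t *\<^sub>R (\<Sum>\<nu>\<in>UNIV. g t $ \<nu> *\<^sub>R curvature A \<mu> \<nu> (p r t))" for r t
  define G' where "G' r t = h t *\<^sub>R (\<Sum>\<nu>\<in>UNIV. g t $ \<nu> *\<^sub>R (h t *\<^sub>R partial \<mu> (curvature A \<mu> \<nu>) (p r t)))" for r t
  have F: "C1 (curvature A \<mu> \<nu>)" for \<mu> \<nu> by (rule curvature_C1[OF A])
  have A1: "C1 (A \<nu>)" for \<nu> by (rule smooth_C1[OF A])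
  have hp: "primitive (\<lambda>t. (r * h t) *\<^sub>R axis \<mu> (1::real)) (\<lambda>t. (r * h' t) *\<^sub>R axis \<mu> 1)" for r
    by (rule primitive_linear[OF _ h(1)]) (intro bounded_linear_scaleR_const bounded_linear_const_mult bounded_linear_ident)
  have pq: "is_L2_deriv (p r) (q r)" for r
    unfolding p_def[abs_def] q_def[abs_def]
    by (rule is_L2_deriv_add[OF g hp]) (auto intro!: continuous_intros h simp: h(3))
  have pp: "primitive (p r) (q r)" for r by (rule L2_deriv_primitive[OF pq])
  have pc: "continuous_on {0..1} (p r)" for r by (rule primitive_continuous[OF pp])
  have gp: "primitive \<gamma> g" by (rule L2_deriv_primitive[OF g])
  have hc: "continuous_on {0..1} h" by (rule primitive_continuous[OF h(1)])
  have tr: "transport (M r) (V r)" for r unfolding M_def V_def by (rule par_transport[OF A sk pq])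
  have skM: "cadj (M r t) = - M r t" for r t unfolding M_def by (rule conn_skew[OF sk])
  have Mi: "set_integrable lborel {0..1} (M r)" for r unfolding M_def by (rule conn_integrable[OF A pp])
  have dir: "((\<lambda>r. f (p r t)) has_vector_derivative h t *\<^sub>R partial \<mu> f (p r t)) (at r)" if "C1 f" for f :: "real^'d \<Rightarrow> complex^'n^'n" and r t
    unfolding p_def by (rule C1_directional[OF that])
  have DM: "((\<lambda>r. M r t) has_vector_derivative M' r t) (at r)" for r t
  proof -
    have a: "((\<lambda>r. q r t $ \<nu>) has_vector_derivative h' t * (if \<nu> = \<mu> then 1 else 0)) (at r)" for \<nu>
      unfolding q_def by (auto intro!: derivative_eq_intros simp: axis_def has_real_derivative_iff_has_vector_derivative[symmetric])
    have "((\<lambda>r. M r t) has_vector_derivative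
      (\<Sum>\<nu>\<in>UNIV. q r t $ \<nu> *\<^sub>R (h t *\<^sub>R partial \<mu> (A \<nu>) (p r t)) + (h' t * (if \<nu> = \<mu> then 1 else 0)) *\<^sub>R A \<nu> (p r t))) (at r)"
      unfolding M_def conn_def
      by (intro has_vector_derivative_sum bounded_bilinear.has_vector_derivative[OF bounded_bilinear_scaleR] a dir A1)
    moreover have "(\<Sum>\<nu>\<in>UNIV. (h' t * (if \<nu> = \<mu> then 1 else 0)) *\<^sub>R A \<nu> (p r t)) = (\<Sum>\<nu>\<in>UNIV. if \<nu> = \<mu> then h' t *\<^sub>R A \<nu> (p r t) else 0)"
      by (intro sum.cong) auto
    ultimately show ?thesis by (simp add: sum.distrib M'_def)
  qed
  have DG: "((\<lambda>r. G r t) has_vector_derivative G' r t) (at r)" for r t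
    unfolding G_def G'_def
    by (intro bounded_linear.has_vector_derivative[OF bounded_linear_scaleR_right] has_vector_derivative_sum dir F)
  interpret cl: linear "cadj :: complex^'n^'n \<Rightarrow> _" by (rule bounded_linear.linear[OF bounded_linear_cadj])
  have skG: "cadj (G r t) = - G r t" for r t
    by (simp add: G_def cl.sum cl.scale curvature_skew[OF A sk] sum_negf)
  have skb: "cadj (\<beta> r t) = - \<beta> r t" for r t
    by (simp add: \<beta>_def cl.scale sk)
  have Gi: "set_integrable lborel {0..1} (G r)" for r
  proof -
    have "set_integrable lborel {0..1} (\<lambda>t. \<Sum>\<nu>\<in>UNIV. g t $ \<nu> *\<^sub>R curvature A \<mu> \<nu> (p r t))"
      by (rule weighted_sum_integrable[OF gp]) (rule continuous_on_compose2[OF C1_continuous[OF F] pc], auto)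
    then show ?thesis unfolding G_def by (rule set_integrable_bilinear_continuous[OF bounded_bilinear_scaleR _ hc])
  qed
  have bound: "\<exists>w. set_integrable lborel {0..1} w \<and>
      (\<forall>r t. t \<in> {0..1} \<longrightarrow> \<bar>r - r0\<bar> < 1 \<longrightarrow> norm (M' r t) \<le> w t \<and> norm (G r t) \<le> w t \<and> norm (G' r t) \<le> w t)" for r0
  proof -
    define \<rho> where "\<rho> = \<bar>r0\<bar> + 1"
    \<comment> \<open>One continuous majorant of all fields involved. For r within 1 of
      \<open>r0\<close> the points \<open>p r t\<close> stay in a compact set, so
      \<open>\<phi>\<close> is bounded there and \<open>norm (g t)\<close> is the only unbounded
      factor left.\<close>
    define \<phi> where "\<phi> x = (\<Sum>\<nu>\<in>UNIV. norm (partial \<mu> (A \<nu>) x) + norm (A \<nu> x) + norm (curvature A \<mu> \<nu> x) + norm (partial \<mu> (curvature A \<mu> \<nu>) x))" for x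
    have \<phi>c: "continuous_on UNIV \<phi>"
      unfolding \<phi>_def by (intro continuous_intros C1_continuous C1_continuous_partial A1 F)
    have "continuous_on ({-\<rho>..\<rho>} \<times> {0..1}) (\<lambda>z. p (fst z) (snd z))"
      unfolding p_def
      by (intro continuous_intros continuous_on_compose2[OF hc] continuous_on_compose2[OF primitive_continuous[OF gp]]) auto
    then have "continuous_on ({-\<rho>..\<rho>} \<times> {0..1}) (\<lambda>z. \<phi> (p (fst z) (snd z)))"
      by (rule continuous_on_compose2[OF \<phi>c]) auto
    then have "bounded ((\<lambda>z. \<phi> (p (fst z) (snd z))) ` ({-\<rho>..\<rho>} \<times> {0..1}))"
      by (intro compact_imp_bounded compact_continuous_image compact_Times) auto
    then obtain B where B: "\<And>r t. \<bar>r\<bar> \<le> \<rho> \<Longrightarrow> t \<in> {0..1} \<Longrightarrow> \<phi> (p r t) \<le> B"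
      unfolding bounded_iff by (fastforce simp: abs_le_iff)
    obtain H where H: "\<And>t. t \<in> {0..1} \<Longrightarrow> norm (h t) \<le> H" using continuous_bounded_Icc[OF hc] by blast
    obtain H' where H': "\<And>t. t \<in> {0..1} \<Longrightarrow> norm (h' t) \<le> H'"
      using continuous_bounded_Icc[OF continuous_on_subset[OF h(2)]] by blast
    have H0: "H \<ge> 0" "H' \<ge> 0" using order_trans[OF norm_ge_zero H[of 0]] order_trans[OF norm_ge_zero H'[of 0]] by auto
    have each: "norm (partial \<mu> (A \<nu>) x) \<le> \<phi> x" "norm (A \<nu> x) \<le> \<phi> x" "norm (curvature A \<mu> \<nu> x) \<le> \<phi> x"
      "norm (partial \<mu> (curvature A \<mu> \<nu>) x) \<le> \<phi> x" for \<nu> x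
    proof -
      have "norm (partial \<mu> (A \<nu>) x) + norm (A \<nu> x) + norm (curvature A \<mu> \<nu> x) + norm (partial \<mu> (curvature A \<mu> \<nu>) x) \<le> \<phi> x"
        unfolding \<phi>_def by (rule member_le_sum) auto
      then show "norm (partial \<mu> (A \<nu>) x) \<le> \<phi> x" "norm (A \<nu> x) \<le> \<phi> x" "norm (curvature A \<mu> \<nu> x) \<le> \<phi> x"
        "norm (partial \<mu> (curvature A \<mu> \<nu>) x) \<le> \<phi> x"
        using norm_ge_zero[of "partial \<mu> (A \<nu>) x"] norm_ge_zero[of "A \<nu> x"] norm_ge_zero[of "curvature A \<mu> \<nu> x"]
          norm_ge_zero[of "partial \<mu> (curvature A \<mu> \<nu>) x"] by linarith+
    qed
    have B0: "B \<ge> 0" using order_trans[OF order_trans[OF norm_ge_zero each(1)] B[of 0 0]] by (simp add: \<rho>_def)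
    define D where "D = real CARD('d)"
    define w1 where "w1 t = D * ((norm (g t) + \<rho> * H') * (H * B)) + H' * B" for t
    define w2 where "w2 t = H * (D * (norm (g t) * B))" for t
    define w3 where "w3 t = H * (D * (norm (g t) * (H * B)))" for t
    have gi: "set_integrable lborel {0..1} (\<lambda>t. norm (g t))" using set_integrable_norm[OF primitive_integrable[OF gp]] by auto
    have ci: "set_integrable lborel {0..1} (\<lambda>t::real. c)" for c :: real by (intro continuous_set_integrable continuous_intros)
    have "set_integrable lborel {0..1} (\<lambda>t. w1 t + w2 t + w3 t)"
      unfolding w1_def w2_def w3_def
      by (intro set_integral_add(1) set_integrable_mult_right set_integrable_mult_left gi ci)
    moreover have "norm (M' r t) \<le> w1 t + w2 t + w3 t \<and> norm (G r t) \<le> w1 t + w2 t + w3 t \<and> norm (G' r t) \<le> w1 t + w2 t + w3 t"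
      if t: "t \<in> {0..1}" and r: "\<bar>r - r0\<bar> < 1" for r t
    proof -
      have rr: "\<bar>r\<bar> \<le> \<rho>" using r unfolding \<rho>_def by linarith
      have b: "norm (partial \<mu> (A \<nu>) (p r t)) \<le> B" "norm (A \<nu> (p r t)) \<le> B" "norm (curvature A \<mu> \<nu> (p r t)) \<le> B"
        "norm (partial \<mu> (curvature A \<mu> \<nu>) (p r t)) \<le> B" for \<nu>
        using each[where x="p r t"] B[OF rr t] order_trans by blast+
      have hb: "\<bar>h t\<bar> \<le> H" "\<bar>h' t\<bar> \<le> H'" using H[OF t] H'[OF t] by auto
      have gb: "\<bar>g t $ \<nu>\<bar> \<le> norm (g t)" for \<nu> by (rule component_le_norm_cart)
      have qb: "\<bar>q r t $ \<nu>\<bar> \<le> norm (g t) + \<rho> * H'" for \<nu>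
      proof -
        have "\<bar>q r t $ \<nu>\<bar> \<le> \<bar>g t $ \<nu>\<bar> + \<bar>r * h' t\<bar>" by (auto simp: q_def axis_def)
        moreover have "\<bar>r * h' t\<bar> \<le> \<rho> * H'" unfolding abs_mult using rr hb(2) by (intro mult_mono) auto
        ultimately show ?thesis using gb[of \<nu>] by linarith
      qed
      have \<rho>0: "\<rho> \<ge> 0" by (simp add: \<rho>_def)
      have s: "norm (\<Sum>\<nu>\<in>UNIV. k \<nu> *\<^sub>R X \<nu>) \<le> D * (a * b)" if "\<And>\<nu>. \<bar>k \<nu>\<bar> \<le> a" "\<And>\<nu>. norm (X \<nu>) \<le> b"
        for k :: "'d \<Rightarrow> real" and X :: "'d \<Rightarrow> complex^'n^'n" and a b
      proof -
        have a0: "a \<ge> 0" using order_trans[OF abs_ge_zero that(1)] .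
        have "norm (\<Sum>\<nu>\<in>UNIV. k \<nu> *\<^sub>R X \<nu>) \<le> (\<Sum>\<nu>\<in>(UNIV::'d set). a * b)"
          using that a0 by (intro sum_norm_le) (auto intro!: mult_mono)
        then show ?thesis by (simp add: D_def)
      qed
      have hX: "norm (h t *\<^sub>R X) \<le> H * b" if "norm X \<le> b" for X :: "complex^'n^'n" and b
        using hb(1) that H0 by (auto intro!: mult_mono)
      have "norm (M' r t) \<le> w1 t"
        unfolding M'_def w1_def
        using hb(2) b(2) H0 by (intro norm_triangle_le add_mono s qb hX b) (auto intro!: mult_mono)
      moreover have "norm (G r t) \<le> w2 t" unfolding G_def w2_def by (intro hX s gb b)
      moreover have "norm (G' r t) \<le> w3 t" unfolding G'_def w3_def by (intro hX s gb b)
      moreover have "w1 t \<ge> 0" "w2 t \<ge> 0" "w3 t \<ge> 0"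
        using H0 B0 \<rho>0 by (auto simp: w1_def w2_def w3_def D_def)
      ultimately show ?thesis by linarith
    qed
    ultimately show ?thesis by blast
  qed
  have bprim: "primitive (\<lambda>t. cadj (V r t) ** \<beta> r t ** V r t) (\<lambda>t. cadj (V r t) ** (M' r t - G r t) ** V r t)" for r
  proof -
    define \<beta>' where "\<beta>' t = h t *\<^sub>R (\<Sum>\<nu>\<in>UNIV. q r t $ \<nu> *\<^sub>R partial \<nu> (A \<mu>) (p r t)) + h' t *\<^sub>R A \<mu> (p r t)" for t
    have bp: "primitive (\<beta> r) \<beta>'"
      unfolding \<beta>_def \<beta>'_def by (rule primitive_bilinear[OF bounded_bilinear_scaleR h(1) primitive_C1[OF A1 pp]])
    have Vp: "primitive (V r) (\<lambda>t. - (M r t ** V r t))" using tr by (simp add: transport_def)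
    have raw: "primitive (\<lambda>t. cadj (V r t) ** \<beta> r t ** V r t)
      (\<lambda>t. (cadj (V r t) ** \<beta> r t) ** (- (M r t ** V r t)) + (cadj (V r t) ** \<beta>' t + cadj (- (M r t ** V r t)) ** \<beta> r t) ** V r t)"
      by (intro primitive_bilinear[OF bounded_bilinear_cmat] primitive_linear[OF bounded_linear_cadj] Vp bp)
    \<comment> \<open>Subtracting F_{\<mu>\<nu>} from the partial derivative of A_\<nu> in direction
      \<mu> leaves that of A_\<mu> in direction \<nu> plus [A_\<nu>, A_\<mu>]. So the remainder is
      the covariant derivative of \<beta> along the path, which conjugation by U turns into a total
      derivative.\<close>
    have key: "M' r t - G r t = \<beta>' t + (M r t ** \<beta> r t - \<beta> r t ** M r t)" for t
    proof -
      have Gq: "G r t = h t *\<^sub>R (\<Sum>\<nu>\<in>UNIV. q r t $ \<nu> *\<^sub>R curvature A \<mu> \<nu> (p r t))"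
        unfolding G_def by (intro arg_cong[where f="scaleR (h t)"] sum.cong) (auto simp: q_def axis_def curvature_self)
      have c: "M r t ** \<beta> r t - \<beta> r t ** M r t = h t *\<^sub>R (\<Sum>\<nu>\<in>UNIV. q r t $ \<nu> *\<^sub>R (A \<nu> (p r t) ** A \<mu> (p r t) - A \<mu> (p r t) ** A \<nu> (p r t)))"
        unfolding M_def \<beta>_def conn_def
        by (simp add: cmat.sum_left cmat.sum_right matrix_scaleR_left matrix_scaleR_right
          scaleR_diff_right sum_subtractf scaleR_sum_right mult.commute)
      show ?thesis
        unfolding c unfolding M'_def Gq \<beta>'_def curvature_def commutator_def
        by (simp add: scaleR_sum_right sum_subtractf sum.distrib scaleR_add_right scaleR_diff_right mult.commute)
    qed
    show ?thesis
      by (rule primitive_cong[OF raw]) (simp_all add: key cadj_minus cadj_mult skM cmat_arith)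
  qed
  have b0: "\<beta> r 0 = 0" "\<beta> r 1 = 0" for r by (simp_all add: \<beta>_def h)
  note sv = second_variation[OF skM tr Mi DM bound Gi skG skb DG bprim b0]
  have f: "par_transport A (\<lambda>t. \<gamma> t + r *\<^sub>R h t *\<^sub>R axis \<mu> 1) 1 = V r 1" for r
    by (simp add: V_def p_def[abs_def])
  have p0: "p 0 = \<gamma>" by (simp add: p_def[abs_def])
  have V0: "V 0 = U" by (simp add: V_def p0 U_def)
  have P0: "cadj (V 0 t) ** G 0 t ** V 0 t = P t" for t
    by (simp add: P_def V0 G_def p0 matrix_scaleR_left matrix_scaleR_right)
  have Q0: "cadj (V 0 t) ** (G' 0 t + \<beta> 0 t ** G 0 t - G 0 t ** \<beta> 0 t) ** V 0 t =
    (h t)\<^sup>2 *\<^sub>R (cadj (U t) ** (\<Sum>\<nu>\<in>UNIV. g t $ \<nu> *\<^sub>R cov_deriv A \<mu> (curvature A \<mu> \<nu>) (\<gamma> t)) ** U t)" for t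
  proof -
    \<comment> \<open>One factor h comes from \<open>G\<close>; the other comes from the direction
      of variation in \<open>G'\<close> and from \<open>\<beta>\<close> in the commutator.\<close>
    have "G' 0 t + \<beta> 0 t ** G 0 t - G 0 t ** \<beta> 0 t = (h t)\<^sup>2 *\<^sub>R (\<Sum>\<nu>\<in>UNIV. g t $ \<nu> *\<^sub>R cov_deriv A \<mu> (curvature A \<mu> \<nu>) (\<gamma> t))"
      by (simp add: G'_def G_def \<beta>_def p0 cov_deriv_def commutator_def cmat.sum_left cmat.sum_right matrix_scaleR_left matrix_scaleR_right
        scaleR_sum_right scaleR_add_right scaleR_diff_right sum.distrib sum_subtractf power2_eq_square mult_ac)
    then show ?thesis by (simp add: V0 matrix_scaleR_left matrix_scaleR_right)
  qed
  show ?thesis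
    \<comment> \<open>\<open>sv(1)\<close> holds at every r, so the inner
      \<open>vector_derivative\<close> is rewritten as a function of s before the outer derivative
      is taken at 0.\<close>
    unfolding second_deriv_dir_def f vector_derivative_at[OF sv(1)]
    by (subst vector_derivative_at[OF sv(2)]) (simp only: P0 Q0, simp only: V0)
qed

end

section \<open>Cesaro averages over the sine basis\<close>

lemma primitive_h_basis: "primitive (h_basis k) (\<lambda>t. sqrt 2 * (pi * real k) * cos (pi * real k * t))"
proof (rule primitive_of_deriv)
  show "(h_basis k has_vector_derivative sqrt 2 * (pi * real k) * cos (pi * real k * t)) (at t)" for t
    unfolding h_basis_def[abs_def] has_real_derivative_iff_has_vector_derivative[symmetric]
    by (auto intro!: derivative_eq_intros)
qed (intro continuous_intros)

lemma h_basis_ends: "h_basis k 0 = 0" "h_basis k 1 = 0"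
  by (simp_all add: h_basis_def)

lemma abs_h_basis_le: "\<bar>h_basis k t\<bar> \<le> sqrt 2"
  using mult_left_mono[OF abs_sin_le_one, of "sqrt 2"] by (simp add: h_basis_def abs_mult)

text \<open>The sum is the real part of a geometric sum in z = exp(i pi u), bounded by 2 / |1 - z|
  for all n. The range of u excludes z = 1 and covers both t - s and t + s for distinct s, t in
  (0,1).\<close>

lemma cos_average:
  assumes u: "0 < \<bar>u\<bar>" "\<bar>u\<bar> < 2"
  shows "(\<lambda>n. (1 / real n) * (\<Sum>k=1..n. cos (real k * (pi * u)))) \<longlonglongrightarrow> 0"
proof -
  define z where "z = cis (pi * u)"
  have "z \<noteq> 1"
  proof
    assume "z = 1"
    then have "cos (pi * u) = 1" by (metis z_def cis.sel(1) one_complex.sel(1))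
    then obtain m :: int where "pi * u = of_int m * 2 * pi" using cos_one_2pi_int by blast
    then have "u = 2 * of_int m" by (simp add: field_simps)
    then show False using u by auto
  qed
  have b: "\<bar>\<Sum>k=1..n. cos (real k * (pi * u))\<bar> \<le> 2 / norm (1 - z)" for n
  proof -
    have "(\<Sum>k=1..n. cos (real k * (pi * u))) = Re (\<Sum>k=1..n. z ^ k)"
      by (simp only: Re_sum z_def Complex.DeMoivre cis.sel)
    also have "(\<Sum>k=1..n. z ^ k) = z * (\<Sum>k<n. z ^ k)"
      by (simp add: sum_distrib_left sum.atLeast1_atMost_eq)
    also have "\<dots> = z * (1 - z ^ n) / (1 - z)" using \<open>z \<noteq> 1\<close> by (simp add: sum_gp_strict)
    finally have "\<bar>\<Sum>k=1..n. cos (real k * (pi * u))\<bar> \<le> norm (z * (1 - z ^ n) / (1 - z))"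
      by (simp add: abs_Re_le_cmod)
    also have "\<dots> = norm (1 - z ^ n) / norm (1 - z)" by (simp add: norm_mult norm_divide z_def)
    also have "\<dots> \<le> 2 / norm (1 - z)"
      using norm_triangle_ineq4[of 1 "z ^ n"] by (intro divide_right_mono) (auto simp: z_def norm_power)
    finally show ?thesis .
  qed
  have l: "(\<lambda>n. 2 / norm (1 - z) * (1 / real n)) \<longlonglongrightarrow> 0"
    using tendsto_mult_right_zero[OF lim_1_over_n] .
  show ?thesis
  proof (rule Lim_null_comparison[OF always_eventually l], intro allI)
    fix n
    show "norm ((1 / real n) * (\<Sum>k=1..n. cos (real k * (pi * u)))) \<le> 2 / norm (1 - z) * (1 / real n)"
      using mult_right_mono[OF b[of n], of "1 / real n"] by (simp add: abs_mult mult.commute)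
  qed
qed

text \<open>1/n times the integral kernel of the orthogonal projection onto the first n sines; on
  the open unit square it tends to the indicator function of the diagonal.\<close>

definition h_kernel :: "nat \<Rightarrow> real \<Rightarrow> real \<Rightarrow> real" where
  "h_kernel n t s = (1 / real n) * (\<Sum>k=1..n. h_basis k t * h_basis k s)"

lemma h_basis_mult: "h_basis k t * h_basis k s = cos (real k * (pi * (t - s))) - cos (real k * (pi * (t + s)))"
proof -
  have "h_basis k t * h_basis k s = 2 * (sin (pi * real k * t) * sin (pi * real k * s))"
    by (simp add: h_basis_def)
  also have "\<dots> = cos (pi * real k * t - pi * real k * s) - cos (pi * real k * t + pi * real k * s)"
    by (simp add: sin_times_sin)
  finally show ?thesis by (simp add: algebra_simps)
qed

lemma abs_h_kernel_le: "\<bar>h_kernel n t s\<bar> \<le> 2"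
proof -
  have "\<bar>h_basis k t * h_basis k s\<bar> \<le> 2" for k
    using mult_mono[OF abs_h_basis_le abs_h_basis_le, of k t k s] by (simp add: abs_mult mult.commute)
  then have "\<bar>\<Sum>k=1..n. h_basis k t * h_basis k s\<bar> \<le> (\<Sum>k=1..n. 2)"
    by (intro order_trans[OF sum_abs] sum_mono)
  then show ?thesis by (cases "n = 0") (auto simp: h_kernel_def abs_mult divide_simps)
qed

lemma h_kernel_split: "h_kernel n t s = (1 / real n) * (\<Sum>k=1..n. cos (real k * (pi * (t - s)))) - (1 / real n) * (\<Sum>k=1..n. cos (real k * (pi * (t + s))))"
  by (simp add: h_kernel_def h_basis_mult sum_subtractf right_diff_distrib)

lemma h_kernel_off_diagonal:
  assumes "0 < t" "t < 1" "0 < s" "s < 1" "t \<noteq> s"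
  shows "(\<lambda>n. h_kernel n t s) \<longlonglongrightarrow> 0"
  using tendsto_diff[OF cos_average[of "t - s"] cos_average[of "t + s"]] assms
  by (simp add: h_kernel_split[abs_def])

lemma h_kernel_diagonal:
  assumes "0 < t" "t < 1"
  shows "(\<lambda>n. h_kernel n t t) \<longlonglongrightarrow> 1"
proof -
  have "(\<lambda>n. (1 / real n) * (\<Sum>k=1..n. cos (real k * (pi * (t - t))))) \<longlonglongrightarrow> 1"
    by (rule tendsto_eventually) (auto intro!: eventually_sequentiallyI[of 1])
  from tendsto_diff[OF this cos_average[of "t + t"]] assms show ?thesis
    by (simp add: h_kernel_split[abs_def])
qed

text \<open>At the endpoints all \<open>h_basis k\<close> vanish and the diagonal limit 1 fails, so
  they are discarded as a null set.\<close>

lemma AE_Icc_interior: "AE t in lborel. t \<in> {0..1::real} \<longrightarrow> 0 < t \<and> t < 1"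
  using AE_lborel_singleton[of "0::real"] AE_lborel_singleton[of "1::real"]
  by eventually_elim auto

lemma h_basis_continuous: "continuous_on S (h_basis k)"
  unfolding h_basis_def by (intro continuous_intros)

lemma h_basis_weighted_integrable:
  assumes "set_integrable lborel {a..b} X"
  shows "set_integrable lborel {a..b} (\<lambda>t. h_basis k t *\<^sub>R X t :: 'a::euclidean_space)"
  by (rule set_integrable_bilinear_continuous[OF bounded_bilinear_scaleR assms h_basis_continuous])

section \<open>Averages of integrals against the sine basis\<close>

lemma average_diagonal:
  fixes X :: "real \<Rightarrow> 'a::euclidean_space"
  assumes X: "set_integrable lborel {0..1} X"
  shows "(\<lambda>n. (1 / real n) *\<^sub>R (\<Sum>k=1..n. LINT t:{0..1}|lborel. (h_basis k t)\<^sup>2 *\<^sub>R X t)) \<longlonglongrightarrow> (LINT t:{0..1}|lborel. X t)"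
proof -
  have i: "set_integrable lborel {0..1} (\<lambda>t. (h_basis k t)\<^sup>2 *\<^sub>R X t)" for k
    using h_basis_weighted_integrable[OF h_basis_weighted_integrable[OF X]] by (simp add: power2_eq_square)
  have e: "(1 / real n) *\<^sub>R (\<Sum>k=1..n. (h_basis k t)\<^sup>2 *\<^sub>R X t) = h_kernel n t t *\<^sub>R X t" for n t
    by (simp only: h_kernel_def power2_eq_square scaleR_scaleR[symmetric] scaleR_sum_left)
  have s: "set_integrable lborel {0..1} (\<lambda>t. h_kernel n t t *\<^sub>R X t)" for n
    unfolding e[symmetric] by (intro set_integrable_scaleR_right set_integrable_sum i)
  have "(1 / real n) *\<^sub>R (\<Sum>k=1..n. LINT t:{0..1}|lborel. (h_basis k t)\<^sup>2 *\<^sub>R X t) = (LINT t:{0..1}|lborel. h_kernel n t t *\<^sub>R X t)" for n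
    unfolding e[symmetric] by (simp add: set_integral_sum' i)
  moreover have "(\<lambda>n. LINT t:{0..1}|lborel. h_kernel n t t *\<^sub>R X t) \<longlonglongrightarrow> (LINT t:{0..1}|lborel. X t)"
  proof (rule set_dominated_convergence)
    show "set_integrable lborel {0..1} (\<lambda>t. 2 * norm (X t))" using set_integrable_norm[OF X] by auto
    show "set_borel_measurable lborel {0..1} X" by (rule set_integrable_imp_measurable[OF X])
    show "AE t in lborel. t \<in> {0..1} \<longrightarrow> (\<lambda>n. h_kernel n t t *\<^sub>R X t) \<longlonglongrightarrow> X t"
      using AE_Icc_interior
    proof eventually_elim
      case (elim t)
      then show ?case using tendsto_scaleR[OF h_kernel_diagonal[of t] tendsto_const, of "X t"] by auto
    qed
    show "norm (h_kernel n t t *\<^sub>R X t) \<le> 2 * norm (X t)" for n t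
      by (simp add: mult_right_mono abs_h_kernel_le)
  qed (rule s)
  ultimately show ?thesis by simp
qed

text \<open>Averaging under both integrals replaces the two sines by \<open>h_kernel\<close>. For
  fixed t the inner integral \<open>I\<close> tends to 0, because the diagonal s = t is a null set;
  the outer integral then follows by a second dominated convergence.\<close>

lemma average_off_diagonal:
  fixes X :: "real \<Rightarrow> complex^'n^'n"
  assumes X: "set_integrable lborel {0..1} X"
  shows "(\<lambda>n. (1 / real n) *\<^sub>R (\<Sum>k=1..n. LINT t:{0..1}|lborel.
      (h_basis k t *\<^sub>R X t) ** (LINT s:{0..t}|lborel. h_basis k s *\<^sub>R X s))) \<longlonglongrightarrow> 0"
proof -
  have Xt: "set_integrable lborel {0..t} X" if "t \<in> {0..1}" for t
    by (rule set_integrable_subset[OF X]) (use that in auto)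
  have nX: "set_integrable lborel {a..b} (\<lambda>s. 2 * norm (X s))" if "0 \<le> a" "b \<le> 1" for a b
    by (rule set_integrable_subset[of _ "{0..1}"]) (use set_integrable_norm[OF X] that in auto)
  define I where "I n t = (LINT s:{0..t}|lborel. h_kernel n t s *\<^sub>R X s)" for n t
  have i: "set_integrable lborel {0..1} (\<lambda>t. (h_basis k t *\<^sub>R X t) ** (LINT s:{0..t}|lborel. h_basis k s *\<^sub>R X s))" for k
    by (rule set_integrable_bilinear_continuous[OF bounded_bilinear.flip[OF bounded_bilinear_cmat] h_basis_weighted_integrable[OF X]
      primitive_continuous[OF primitive_integral0[OF h_basis_weighted_integrable[OF X]]]])
  have ke: "h_kernel n t s *\<^sub>R X s = (1 / real n) *\<^sub>R (\<Sum>k=1..n. h_basis k t *\<^sub>R h_basis k s *\<^sub>R X s)" for n t s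
    by (simp only: h_kernel_def scaleR_scaleR[symmetric] scaleR_sum_left)
  have ki: "set_integrable lborel {0..t} (\<lambda>s. h_kernel n t s *\<^sub>R X s)" if "t \<in> {0..1}" for n t
    unfolding ke by (intro set_integrable_scaleR_right set_integrable_sum h_basis_weighted_integrable Xt that)
  have e: "(1 / real n) *\<^sub>R (\<Sum>k=1..n. (h_basis k t *\<^sub>R X t) ** (LINT s:{0..t}|lborel. h_basis k s *\<^sub>R X s)) = X t ** I n t"
    if t: "t \<in> {0..1}" for n t
  proof -
    have "I n t = (1 / real n) *\<^sub>R (\<Sum>k=1..n. h_basis k t *\<^sub>R (LINT s:{0..t}|lborel. h_basis k s *\<^sub>R X s))"
      unfolding I_def ke
      by (simp add: set_integral_sum' set_integrable_scaleR_right h_basis_weighted_integrable Xt[OF t] del: scaleR_scaleR)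
    then show ?thesis by (simp add: matrix_scaleR_left matrix_scaleR_right cmat.sum_right)
  qed
  have s: "set_integrable lborel {0..1} (\<lambda>t. X t ** I n t)" for n
  proof -
    have "set_integrable lborel {0..1} (\<lambda>t. (1 / real n) *\<^sub>R (\<Sum>k=1..n. (h_basis k t *\<^sub>R X t) ** (LINT s:{0..t}|lborel. h_basis k s *\<^sub>R X s)))"
      by (intro set_integrable_scaleR_right set_integrable_sum i)
    then show ?thesis by (rule set_integrable_cong[THEN iffD1, rotated -1]) (auto simp: e simp del: One_nat_def)
  qed
  have eq: "(1 / real n) *\<^sub>R (\<Sum>k=1..n. LINT t:{0..1}|lborel. (h_basis k t *\<^sub>R X t) ** (LINT s:{0..t}|lborel. h_basis k s *\<^sub>R X s))
    = (LINT t:{0..1}|lborel. X t ** I n t)" for n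
  proof -
    have "(LINT t:{0..1}|lborel. X t ** I n t) = (LINT t:{0..1}|lborel. (1 / real n) *\<^sub>R (\<Sum>k=1..n. (h_basis k t *\<^sub>R X t) ** (LINT s:{0..t}|lborel. h_basis k s *\<^sub>R X s)))"
      by (intro set_lebesgue_integral_cong) (auto simp: e simp del: One_nat_def)
    then show ?thesis by (simp add: set_integral_sum' i)
  qed
  define N where "N = (LINT s:{0..1}|lborel. 2 * norm (X s))"
  \<comment> \<open>Uniformity in t and n makes a multiple of the norm of \<open>X\<close> dominate
    the outer integrand.\<close>
  have Ib: "norm (I n t) \<le> N" if t: "t \<in> {0..1}" for n t
  proof -
    have "norm (I n t) \<le> (LINT s:{0..t}|lborel. 2 * norm (X s))"
      unfolding I_def
      by (rule norm_set_integral_le[OF ki[OF t] nX]) (use t in \<open>auto intro: mult_right_mono abs_h_kernel_le\<close>)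
    also have "\<dots> \<le> N"
    proof -
      have "0 \<le> (LINT s:{t..1}|lborel. 2 * norm (X s))"
        unfolding set_lebesgue_integral_def by (intro Bochner_Integration.integral_nonneg) (auto simp: indicator_def)
      then show ?thesis unfolding N_def using set_integral_split[OF nX[of 0 1], of t] t by simp
    qed
    finally show ?thesis .
  qed
  obtain K where K: "K > 0" "\<And>X Y. norm ((X::complex^'n^'n) ** (Y::complex^'n^'n)) \<le> norm X * norm Y * K"
    using cmat.pos_bounded by blast
  have Il: "(\<lambda>n. I n t) \<longlonglongrightarrow> 0" if t: "0 < t" "t < 1" for t
  proof -
    have "(\<lambda>n. I n t) \<longlonglongrightarrow> (LINT s:{0..t}|lborel. 0)"
      unfolding I_def
    proof (rule set_dominated_convergence)
      show "set_integrable lborel {0..t} (\<lambda>s. 2 * norm (X s))" using nX t by auto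
      show "set_integrable lborel {0..t} (\<lambda>s. h_kernel n t s *\<^sub>R X s)" for n using ki t by auto
      show "set_borel_measurable lborel {0..t} (\<lambda>s. 0 :: complex^'n^'n)" by (simp add: set_borel_measurable_def)
      show "AE s in lborel. s \<in> {0..t} \<longrightarrow> (\<lambda>n. h_kernel n t s *\<^sub>R X s) \<longlonglongrightarrow> 0"
        using AE_lborel_singleton[of t] AE_lborel_singleton[of "0::real"]
      proof eventually_elim
        case (elim s)
        then show ?case using tendsto_scaleR[OF h_kernel_off_diagonal[of t s] tendsto_const, of "X s"] t by auto
      qed
      show "norm (h_kernel n t s *\<^sub>R X s) \<le> 2 * norm (X s)" for n s
        by (simp add: mult_right_mono abs_h_kernel_le)
    qed
    then show ?thesis by simp
  qed
  have "(\<lambda>n. LINT t:{0..1}|lborel. X t ** I n t) \<longlonglongrightarrow> (LINT t:{0..1::real}|lborel. (0::complex^'n^'n))"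
  proof (rule set_dominated_convergence(2))
    show "set_integrable lborel {0..1} (\<lambda>t. X t ** I n t)" for n by (rule s)
    show "set_integrable lborel {0..1} (\<lambda>t. (N * K) * (2 * norm (X t)))" using nX[of 0 1] by (intro set_integrable_mult_right) auto
    show "set_borel_measurable lborel {0..1} (\<lambda>s. 0 :: complex^'n^'n)" by (simp add: set_borel_measurable_def)
    show "AE t in lborel. t \<in> {0..1} \<longrightarrow> (\<lambda>n. X t ** I n t) \<longlonglongrightarrow> 0"
      using AE_Icc_interior
    proof eventually_elim
      case (elim t)
      then show ?case using cmat.tendsto[OF tendsto_const Il[of t], of "X t"] by auto
    qed
    fix n and t :: real assume t: "t \<in> {0..1}"
    have N0: "N \<ge> 0" using order_trans[OF norm_ge_zero Ib[OF t]] .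
    have "norm (X t ** I n t) \<le> norm (X t) * norm (I n t) * K" by (rule K)
    also have "\<dots> \<le> norm (X t) * N * K" using Ib[OF t] K(1) by (intro mult_right_mono mult_left_mono) auto
    also have "\<dots> \<le> (N * K) * (2 * norm (X t))"
      using N0 K(1) by (simp add: mult_ac mult_left_mono)
    finally show "norm (X t ** I n t) \<le> (N * K) * (2 * norm (X t))" .
  qed
  then show ?thesis unfolding eq by simp
qed

section \<open>The Levy Laplacian of the parallel transport\<close>

lemma matrix_inv_unique:
  assumes "U ** X = mat 1" "X ** U = mat 1"
  shows "matrix_inv U = (X :: complex^'n^'n)"
proof -
  have "U ** matrix_inv U = mat 1 \<and> matrix_inv U ** U = mat 1"
    unfolding matrix_inv_def by (rule someI[of _ X]) (use assms in auto)
  then have "X ** (U ** matrix_inv U) = X" by simp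
  then show ?thesis by (simp add: matrix_mul_assoc assms)
qed

section \<open>Stopped paths and localisation of a vanishing integral\<close>

lemma primitive_stop:
  assumes F: "primitive F f" and T: "0 \<le> T"
  shows "primitive (\<lambda>t. F (min t T)) (\<lambda>t. if t \<le> T then f t else 0)"
proof -
  have e: "indicator {0..t} s *\<^sub>R (if s \<le> T then f s else 0) = indicator {0..min t T} s *\<^sub>R f s" for t s :: real
    by (auto simp: indicator_def)
  have "set_integrable lborel {0..1} (\<lambda>t. if t \<le> T then f t else 0)"
    using primitive_integrable[OF F, of 0 "min 1 T"] unfolding set_integrable_def e by simp
  moreover have "(LINT s:{0..t}|lborel. if s \<le> T then f s else 0) = F (min t T) - F (min 0 T)" if "t \<in> {0..1}" for t
    unfolding set_lebesgue_integral_def e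
    using F that T unfolding primitive_def by (simp add: set_lebesgue_integral_def min_def)
  ultimately show ?thesis unfolding primitive_def by blast
qed

lemma indefinite_integral_zero_imp_zero:
  fixes f :: "real \<Rightarrow> 'a::euclidean_space"
  assumes f: "continuous_on {0..1} f" and z: "\<And>T. T \<in> {0..1} \<Longrightarrow> (LINT t:{0..T}|lborel. f t) = 0" and t: "0 < t" "t < 1"
  shows "f t = 0"
proof -
  have i: "integral {0..T} f = 0" if "T \<in> {0..1}" for T
    using z[OF that] set_borel_integral_eq_integral(2)[OF continuous_set_integrable[OF continuous_on_subset[OF f]], of 0 T] that by auto
  have "((\<lambda>u. integral {0..u} f) has_vector_derivative f t) (at t within {0..1})"
    by (rule integral_has_vector_derivative[OF f]) (use t in auto)
  then have "((\<lambda>u. 0) has_vector_derivative f t) (at t within {0..1})"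
    by (rule has_vector_derivative_transform[rotated 2]) (use t i in auto)
  then have "((\<lambda>u. 0) has_vector_derivative f t) (at t)"
    using t by (simp add: at_within_Icc_at)
  then show ?thesis using vector_derivative_unique_at[OF _ has_vector_derivative_const] by blast
qed

context
  fixes A :: "'d::finite \<Rightarrow> real^'d \<Rightarrow> complex^'n::finite^'n"
  assumes A: "\<And>\<mu>. smooth (A \<mu>)" and sk: "\<And>\<mu> x. cadj (A \<mu> x) = - A \<mu> x"
begin

lemma par_transport_unitary:
  assumes "is_L2_deriv \<gamma> g" "t \<in> {0..1}"
  shows "cadj (par_transport A \<gamma> t) ** par_transport A \<gamma> t = mat 1"
    "par_transport A \<gamma> t ** cadj (par_transport A \<gamma> t) = mat 1"
  using transport_unitary[OF par_transport[OF A sk assms(1)] conn_skew[OF sk] assms(2)] by auto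

lemma par_transport_continuous:
  assumes "is_L2_deriv \<gamma> g"
  shows "continuous_on {0..1} (par_transport A \<gamma>)" "continuous_on {0..1} (\<lambda>t. cadj (par_transport A \<gamma> t))"
  using transport_continuous[OF par_transport[OF A sk assms(1)]]
  by (auto intro: bounded_linear.continuous_on[OF bounded_linear_cadj])

lemma conjugated_field_continuous:
  fixes f :: "real^'d \<Rightarrow> complex^'n^'n"
  assumes "is_L2_deriv \<gamma> g" "continuous_on UNIV f"
  shows "continuous_on {0..1} (\<lambda>t. cadj (par_transport A \<gamma> t) ** f (\<gamma> t) ** par_transport A \<gamma> t)"
  by (intro cmat.continuous_on par_transport_continuous[OF assms(1)]
    continuous_on_compose2[OF assms(2) primitive_continuous[OF L2_deriv_primitive[OF assms(1)]]]) auto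

lemma conjugated_sum_integrable:
  fixes f :: "'d \<Rightarrow> real^'d \<Rightarrow> complex^'n^'n"
  assumes g: "is_L2_deriv \<gamma> g" and f: "\<And>\<nu>. continuous_on UNIV (f \<nu>)"
  shows "set_integrable lborel {0..1} (\<lambda>t. cadj (par_transport A \<gamma> t) ** (\<Sum>\<nu>\<in>UNIV. g t $ \<nu> *\<^sub>R f \<nu> (\<gamma> t)) ** par_transport A \<gamma> t)"
proof (rule sandwich_integrable[OF par_transport_continuous(2)[OF g] par_transport_continuous(1)[OF g]])
  show "set_integrable lborel {0..1} (\<lambda>t. \<Sum>\<nu>\<in>UNIV. g t $ \<nu> *\<^sub>R f \<nu> (\<gamma> t))"
    by (rule weighted_sum_integrable[OF L2_deriv_primitive[OF g]])
      (rule continuous_on_compose2[OF f primitive_continuous[OF L2_deriv_primitive[OF g]]], auto)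
qed

lemma levy_avg_par_transport:
  assumes g: "is_L2_deriv \<gamma> g"
  defines "U \<equiv> par_transport A \<gamma>"
  shows "levy_avg (\<lambda>\<gamma>'. par_transport A \<gamma>' 1) \<gamma> \<longlonglongrightarrow>
    - (U 1 ** (LINT t:{0..1}|lborel. (\<Sum>\<nu>\<in>UNIV. g t $ \<nu> *\<^sub>R (cadj (U t) ** ym_current A \<nu> (\<gamma> t) ** U t))))"
proof -
  define X where "X \<mu> t = cadj (U t) ** (\<Sum>\<nu>\<in>UNIV. g t $ \<nu> *\<^sub>R curvature A \<mu> \<nu> (\<gamma> t)) ** U t" for \<mu> t
  define Y where "Y \<mu> t = cadj (U t) ** (\<Sum>\<nu>\<in>UNIV. g t $ \<nu> *\<^sub>R cov_deriv A \<mu> (curvature A \<mu> \<nu>) (\<gamma> t)) ** U t" for \<mu> t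
  have X: "set_integrable lborel {0..1} (X \<mu>)" for \<mu>
    unfolding X_def U_def by (rule conjugated_sum_integrable[OF g C1_continuous[OF curvature_C1[OF A]]])
  have Y: "set_integrable lborel {0..1} (Y \<mu>)" for \<mu>
    unfolding Y_def U_def by (rule conjugated_sum_integrable[OF g cov_deriv_curvature_continuous[OF A]])
  define I where "I \<mu> k = (LINT t:{0..1}|lborel. (h_basis k t *\<^sub>R X \<mu> t) ** (LINT s:{0..t}|lborel. h_basis k s *\<^sub>R X \<mu> s))" for \<mu> k
  define J where "J \<mu> k = (LINT t:{0..1}|lborel. (h_basis k t)\<^sup>2 *\<^sub>R Y \<mu> t)" for \<mu> k
  have sd: "second_deriv_dir (\<lambda>\<gamma>'. par_transport A \<gamma>' 1) \<gamma> (\<lambda>t. h_basis k t *\<^sub>R axis \<mu> 1) = U 1 ** (2 *\<^sub>R I \<mu> k - J \<mu> k)" for k \<mu>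
    unfolding I_def J_def X_def Y_def U_def
    by (rule second_deriv_dir_par_transport[OF A sk g primitive_h_basis]) (auto simp: h_basis_ends intro!: continuous_intros)
  have avg: "levy_avg (\<lambda>\<gamma>'. par_transport A \<gamma>' 1) \<gamma> n = U 1 ** (\<Sum>\<mu>\<in>UNIV. 2 *\<^sub>R ((1 / real n) *\<^sub>R (\<Sum>k=1..n. I \<mu> k)) - (1 / real n) *\<^sub>R (\<Sum>k=1..n. J \<mu> k))" for n
  proof -
    have "levy_avg (\<lambda>\<gamma>'. par_transport A \<gamma>' 1) \<gamma> n = U 1 ** ((1 / real n) *\<^sub>R (\<Sum>k=1..n. \<Sum>\<mu>\<in>UNIV. 2 *\<^sub>R I \<mu> k - J \<mu> k))"
      by (simp only: levy_avg_def sd cmat.sum_right matrix_scaleR_right)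
    also have "(\<Sum>k=1..n. \<Sum>\<mu>\<in>UNIV. 2 *\<^sub>R I \<mu> k - J \<mu> k) = (\<Sum>\<mu>\<in>UNIV. \<Sum>k=1..n. 2 *\<^sub>R I \<mu> k - J \<mu> k)"
      by (rule sum.swap)
    also have "(1 / real n) *\<^sub>R \<dots> = (\<Sum>\<mu>\<in>UNIV. 2 *\<^sub>R ((1 / real n) *\<^sub>R (\<Sum>k=1..n. I \<mu> k)) - (1 / real n) *\<^sub>R (\<Sum>k=1..n. J \<mu> k))"
      by (simp add: scaleR_sum_right sum_subtractf scaleR_diff_right)
    finally show ?thesis .
  qed
  have "(\<lambda>n. U 1 ** (\<Sum>\<mu>\<in>UNIV. 2 *\<^sub>R ((1 / real n) *\<^sub>R (\<Sum>k=1..n. I \<mu> k)) - (1 / real n) *\<^sub>R (\<Sum>k=1..n. J \<mu> k)))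
    \<longlonglongrightarrow> U 1 ** (\<Sum>\<mu>\<in>UNIV. 2 *\<^sub>R 0 - (LINT t:{0..1}|lborel. Y \<mu> t))"
    unfolding I_def J_def
    by (intro cmat.tendsto tendsto_const tendsto_sum tendsto_diff tendsto_scaleR average_off_diagonal average_diagonal X Y)
  moreover have "U 1 ** (\<Sum>\<mu>\<in>UNIV. 2 *\<^sub>R 0 - (LINT t:{0..1}|lborel. Y \<mu> t)) =
    - (U 1 ** (LINT t:{0..1}|lborel. (\<Sum>\<nu>\<in>UNIV. g t $ \<nu> *\<^sub>R (cadj (U t) ** ym_current A \<nu> (\<gamma> t) ** U t))))"
  proof -
    \<comment> \<open>Summing the surviving terms over the directions of variation contracts the
      index \<mu> and produces the Yang-Mills current.\<close>
    have "(\<Sum>\<mu>\<in>UNIV. Y \<mu> t) = (\<Sum>\<nu>\<in>UNIV. g t $ \<nu> *\<^sub>R (cadj (U t) ** ym_current A \<nu> (\<gamma> t) ** U t))" for t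
    proof -
      have "(\<Sum>\<mu>\<in>UNIV. Y \<mu> t) = (\<Sum>\<mu>\<in>UNIV. \<Sum>\<nu>\<in>UNIV. g t $ \<nu> *\<^sub>R (cadj (U t) ** cov_deriv A \<mu> (curvature A \<mu> \<nu>) (\<gamma> t) ** U t))"
        by (simp add: Y_def cmat.sum_left cmat.sum_right matrix_scaleR_left matrix_scaleR_right)
      also have "\<dots> = (\<Sum>\<nu>\<in>UNIV. \<Sum>\<mu>\<in>UNIV. g t $ \<nu> *\<^sub>R (cadj (U t) ** cov_deriv A \<mu> (curvature A \<mu> \<nu>) (\<gamma> t) ** U t))"
        by (rule sum.swap)
      finally show ?thesis
        by (simp add: ym_current_def cmat.sum_left cmat.sum_right scaleR_sum_right)
    qed
    then show ?thesis
      using set_integral_sum'[of UNIV lborel "{0..1}" Y, OF Y] by (simp add: sum_negf cmat_minus)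
  qed
  ultimately show ?thesis unfolding avg[abs_def] by simp
qed

text \<open>The tangent may jump to zero at T because it is only required to be square integrable.
  From then on the coefficient vanishes and U is constant; uniqueness identifies this frozen
  solution with the transport of the stopped path.\<close>

lemma par_transport_stop:
  assumes g: "is_L2_deriv \<gamma> g" and T: "0 \<le> T"
  shows "is_L2_deriv (\<lambda>t. \<gamma> (min t T)) (\<lambda>t. if t \<le> T then g t else 0)"
    and "t \<in> {0..1} \<Longrightarrow> par_transport A (\<lambda>t. \<gamma> (min t T)) t = par_transport A \<gamma> (min t T)"
proof -
  show L: "is_L2_deriv (\<lambda>t. \<gamma> (min t T)) (\<lambda>t. if t \<le> T then g t else 0)"
  proof (rule is_L2_derivI)
    show "primitive (\<lambda>t. \<gamma> (min t T)) (\<lambda>t. if t \<le> T then g t else 0)"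
      by (rule primitive_stop[OF L2_deriv_primitive[OF g] T])
    show "\<gamma> (min 0 T) = 0" using L2_deriv_start[OF g] T by simp
    have gm: "g \<in> borel_measurable lborel" using g by (simp add: is_L2_deriv_def)
    then show m: "(\<lambda>t. if t \<le> T then g t else 0) \<in> borel_measurable lborel" by measurable
    show "set_integrable lborel {0..1} (\<lambda>t. (norm (if t \<le> T then g t else 0))\<^sup>2)"
    proof (rule set_integrable_bound)
      show "set_integrable lborel {0..1} (\<lambda>t. (norm (g t))\<^sup>2)" using g by (simp add: is_L2_deriv_def)
      have "(\<lambda>t. (norm (if t \<le> T then g t else 0))\<^sup>2) \<in> borel_measurable lborel" using m by measurable
      then show "set_borel_measurable lborel {0..1} (\<lambda>t. (norm (if t \<le> T then g t else 0))\<^sup>2)"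
        unfolding set_borel_measurable_def by (intro borel_measurable_scaleR borel_measurable_indicator) auto
    qed auto
  qed
  have p: "transport (conn A \<gamma> g) (par_transport A \<gamma>)" by (rule par_transport[OF A sk g])
  have "primitive (\<lambda>t. par_transport A \<gamma> (min t T)) (\<lambda>t. if t \<le> T then - (conn A \<gamma> g t ** par_transport A \<gamma> t) else 0)"
    by (rule primitive_stop[OF _ T]) (use p in \<open>simp add: transport_def\<close>)
  then have "primitive (\<lambda>t. par_transport A \<gamma> (min t T))
    (\<lambda>t. - (conn A (\<lambda>t. \<gamma> (min t T)) (\<lambda>t. if t \<le> T then g t else 0) t ** par_transport A \<gamma> (min t T)))"
    by (rule primitive_cong) (auto simp: conn_def min_def)
  then have q: "transport (conn A (\<lambda>t. \<gamma> (min t T)) (\<lambda>t. if t \<le> T then g t else 0)) (\<lambda>t. par_transport A \<gamma> (min t T))"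
    using p T by (simp add: transport_def)
  show "par_transport A (\<lambda>t. \<gamma> (min t T)) t = par_transport A \<gamma> (min t T)" if "t \<in> {0..1}"
    by (rule transport_unique[OF par_transport[OF A sk L] q conn_skew[OF sk] that])
qed

text \<open>A test path passes through \<open>x\<close> at time 1/2 with velocity
  \<open>axis \<nu> 1\<close>. Stopping it at every T makes the indefinite integral vanish, hence
  its continuous integrand, and at 1/2 this integrand is the conjugated \<nu>-component at
  \<open>x\<close>.\<close>

lemma ym_current_zero:
  assumes z: "\<And>\<gamma> g. is_L2_deriv \<gamma> g \<Longrightarrow>
    (LINT t:{0..1}|lborel. (\<Sum>\<nu>\<in>UNIV. g t $ \<nu> *\<^sub>R (cadj (par_transport A \<gamma> t) ** ym_current A \<nu> (\<gamma> t) ** par_transport A \<gamma> t))) = 0"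
  shows "ym_current A \<nu> x = 0"
proof -
  \<comment> \<open>The coefficient of \<open>x\<close> is 1 with zero slope at 1/2, and that of the
    axis vector is 0 with slope 1 there; both vanish at 0, as \<open>W120\<close> requires.\<close>
  define \<gamma> where "\<gamma> t = (4 * t * (1 - t)) *\<^sub>R x + (t * (2 * t - 1)) *\<^sub>R axis \<nu> 1" for t
  define g where "g t = (4 - 8 * t) *\<^sub>R x + (4 * t - 1) *\<^sub>R axis \<nu> 1" for t
  have gc: "continuous_on S g" for S unfolding g_def by (intro continuous_intros)
  have g: "is_L2_deriv \<gamma> g"
  proof (rule is_L2_derivI)
    show "primitive \<gamma> g"
    proof (rule primitive_of_deriv[OF _ gc])
      fix t :: real
      have "((\<lambda>t. 4 * t * (1 - t)) has_real_derivative 4 - 8 * t) (at t)" "((\<lambda>t. t * (2 * t - 1)) has_real_derivative 4 * t - 1) (at t)"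
        by (auto intro!: derivative_eq_intros simp: algebra_simps)
      then show "(\<gamma> has_vector_derivative g t) (at t)"
        unfolding \<gamma>_def[abs_def] g_def has_real_derivative_iff_has_vector_derivative
        by (intro has_vector_derivative_add bounded_linear.has_vector_derivative[OF bounded_linear_scaleR_left])
    qed
    show "\<gamma> 0 = 0" by (simp add: \<gamma>_def)
    show "g \<in> borel_measurable lborel" using borel_measurable_continuous_onI[OF gc] by simp
    show "set_integrable lborel {0..1} (\<lambda>t. (norm (g t))\<^sup>2)"
      by (intro continuous_set_integrable continuous_intros gc)
  qed
  define U where "U = par_transport A \<gamma>"
  define f where "f t = (\<Sum>\<kappa>\<in>UNIV. g t $ \<kappa> *\<^sub>R (cadj (U t) ** ym_current A \<kappa> (\<gamma> t) ** U t))" for t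
  have fc: "continuous_on {0..1} f"
    unfolding f_def U_def
    by (intro continuous_on_sum continuous_on_scaleR continuous_intros gc conjugated_field_continuous[OF g] ym_current_continuous[OF A])
  have fT: "(LINT t:{0..T}|lborel. f t) = 0" if T: "T \<in> {0..1}" for T
  proof -
    have T0: "0 \<le> T" using T by simp
    define k where "k t = (if t \<le> T then g t else 0)" for t
    have "0 = (LINT t:{0..1}|lborel. (\<Sum>\<kappa>\<in>UNIV. k t $ \<kappa> *\<^sub>R (cadj (par_transport A (\<lambda>t. \<gamma> (min t T)) t) ** ym_current A \<kappa> (\<gamma> (min t T)) ** par_transport A (\<lambda>t. \<gamma> (min t T)) t)))"
      using z[OF par_transport_stop(1)[OF g T0]] by (simp add: k_def)
    also have "\<dots> = (LINT t:{0..1}|lborel. if t \<le> T then f t else 0)"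
      by (intro set_lebesgue_integral_cong) (auto simp: k_def f_def U_def par_transport_stop(2)[OF g T0] min.absorb1)
    \<comment> \<open>The stopped primitive of \<open>f\<close>, evaluated between 0 and 1, is the
      integral of \<open>f\<close> up to T.\<close>
    also have "\<dots> = (LINT t:{0..T}|lborel. f t)"
      using primitive_diff_eq[OF primitive_stop[OF primitive_integral0[OF continuous_set_integrable[OF fc]] T0], of 0 1] T
        set_borel_integral_eq_integral(2)[OF continuous_set_integrable[OF continuous_on_subset[OF fc]], of 0 0] by (simp add: min.absorb2)
    finally show ?thesis by simp
  qed
  have "f (1/2) = 0" by (rule indefinite_integral_zero_imp_zero[OF fc fT]) auto
  moreover have "g (1/2) = axis \<nu> 1" "\<gamma> (1/2) = x" by (simp_all add: g_def \<gamma>_def)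
  then have "f (1/2) = (\<Sum>\<kappa>\<in>UNIV. if \<kappa> = \<nu> then cadj (U (1/2)) ** ym_current A \<kappa> x ** U (1/2) else 0)"
    unfolding f_def by (intro sum.cong) (auto simp: axis_def)
  ultimately have "U (1/2) ** (cadj (U (1/2)) ** ym_current A \<nu> x ** U (1/2)) ** cadj (U (1/2)) = 0"
    by simp
  then show ?thesis
    using par_transport_unitary[OF g, of "1/2"] by (simp add: matrix_mul_assoc U_def) (simp add: matrix_mul_assoc[symmetric])
qed

end

theorem theorem1:
  fixes A :: "'d::finite \<Rightarrow> real^'d \<Rightarrow> complex^'n::finite^'n"
  assumes smoothA: "\<And>\<mu>. smooth (A \<mu>)"
    and uN: "\<And>\<mu> x. anti_hermitian (A \<mu> x)"
  shows "(\<forall>\<gamma>\<in>W120.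
           levy_avg (\<lambda>\<gamma>'. par_transport A \<gamma>' 1) \<gamma> \<longlonglongrightarrow>
             - (par_transport A \<gamma> 1 ** (LINT t:{0..1}|lborel.
                  (\<Sum>\<nu>\<in>UNIV. (path_deriv \<gamma> t $ \<nu>) *\<^sub>R
                     (matrix_inv (par_transport A \<gamma> t) ** ym_current A \<nu> (\<gamma> t)
                        ** par_transport A \<gamma> t)))))
       \<and> ((\<forall>\<nu> x. ym_current A \<nu> x = 0) \<longleftrightarrow>
           (\<forall>\<gamma>\<in>W120. levy_laplacian (\<lambda>\<gamma>'. par_transport A \<gamma>' 1) \<gamma> = 0))"
proof -
  have sk: "cadj (A \<mu> x) = - A \<mu> x" for \<mu> x using uN by (simp add: anti_hermitian_iff)
  have lim: "levy_avg (\<lambda>\<gamma>'. par_transport A \<gamma>' 1) \<gamma> \<longlonglongrightarrow>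
             - (par_transport A \<gamma> 1 ** (LINT t:{0..1}|lborel.
                  (\<Sum>\<nu>\<in>UNIV. (path_deriv \<gamma> t $ \<nu>) *\<^sub>R
                     (matrix_inv (par_transport A \<gamma> t) ** ym_current A \<nu> (\<gamma> t)
                        ** par_transport A \<gamma> t))))" if "\<gamma> \<in> W120" for \<gamma>
  proof -
    have g: "is_L2_deriv \<gamma> (path_deriv \<gamma>)" using that unfolding W120_def path_deriv_def by (simp add: someI_ex)
    have inv: "matrix_inv (par_transport A \<gamma> t) = cadj (par_transport A \<gamma> t)" if "t \<in> {0..1}" for t
      using par_transport_unitary[OF smoothA sk g that] by (intro matrix_inv_unique)
    have "(LINT t:{0..1}|lborel. (\<Sum>\<nu>\<in>UNIV. (path_deriv \<gamma> t $ \<nu>) *\<^sub>R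
            (matrix_inv (par_transport A \<gamma> t) ** ym_current A \<nu> (\<gamma> t) ** par_transport A \<gamma> t)))
        = (LINT t:{0..1}|lborel. (\<Sum>\<nu>\<in>UNIV. (path_deriv \<gamma> t $ \<nu>) *\<^sub>R
            (cadj (par_transport A \<gamma> t) ** ym_current A \<nu> (\<gamma> t) ** par_transport A \<gamma> t)))"
      by (intro set_lebesgue_integral_cong) (auto simp: inv)
    then show ?thesis using levy_avg_par_transport[OF smoothA sk g] by simp
  qed
  moreover have "levy_laplacian (\<lambda>\<gamma>'. par_transport A \<gamma>' 1) \<gamma> = 0"
    if "\<forall>\<nu> x. ym_current A \<nu> x = 0" "\<gamma> \<in> W120" for \<gamma>
    using limI[OF lim[OF that(2)]] that(1) by (simp add: levy_laplacian_def)
  moreover have "ym_current A \<nu> x = 0" if L: "\<forall>\<gamma>\<in>W120. levy_laplacian (\<lambda>\<gamma>'. par_transport A \<gamma>' 1) \<gamma> = 0" for \<nu> x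
  proof (rule ym_current_zero[OF smoothA sk])
    fix \<gamma> g assume g: "is_L2_deriv (\<gamma> :: real \<Rightarrow> real^'d) g"
    let ?U = "par_transport A \<gamma>"
    let ?I = "LINT t:{0..1}|lborel. (\<Sum>\<nu>\<in>UNIV. g t $ \<nu> *\<^sub>R (cadj (?U t) ** ym_current A \<nu> (\<gamma> t) ** ?U t))"
    have "\<gamma> \<in> W120" using g by (auto simp: W120_def)
    moreover have "levy_avg (\<lambda>\<gamma>'. par_transport A \<gamma>' 1) \<gamma> \<longlonglongrightarrow> - (?U 1 ** ?I)"
      by (rule levy_avg_par_transport[OF smoothA sk g])
    \<comment> \<open>\<open>levy_laplacian\<close> is defined by \<open>lim\<close>; the
      convergence just established identifies it with the integral expression, and invertibility of
      the transport at time 1 then removes the outer factor.\<close>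
    ultimately have "?U 1 ** ?I = 0"
      using limI L by (fastforce simp: levy_laplacian_def)
    then have "cadj (?U 1) ** (?U 1 ** ?I) = 0" by simp
    then show "?I = 0" using par_transport_unitary(1)[OF smoothA sk g, of 1] by (simp add: matrix_mul_assoc)
  qed
  ultimately show ?thesis by blast
qed

end
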